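(* Let $\omega>0$ and let $Y(t)$, $t\in[0,1]$, be the Bogoliubov process, i.e. the centered continuous Gaussian process with covariance $$ \mathsf{E}\,Y(t)Y(s)=\frac{1}{2\omega\sinh(\omega/2)}\cosh\left(\omega|t-s|-\frac{\omega}{2}\right),\qquad s,t\in[0,1]. $$ Let $\psi:[0,1]\to\mathbb{R}$ be positive and twice continuously differentiable on $[0,1]$, and let $\vartheta=\int_0^1\sqrt{\psi(t)}\,dt$. Then, as $\varepsilon\to0+$, $$ \mathsf{P}\{\|Y\|_\psi\leq\varepsilon\}\sim \frac{8\sinh(\omega/2)\,\psi^{1/8}(0)\,\psi^{1/8}(1)}{\vartheta\,\pi^{1/2}\left(\psi^{1/2}(0)+\psi^{1/2}(1)\right)^{1/2}}\, \varepsilon\, \exp\left(-\frac{\vartheta^2}{8}\varepsilon^{-2}\right). $$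
   Context: For a process $X(t)$, $0\le t\le 1$, and a non-negative weight $\psi$ on $[0,1]$, $\|X\|_\psi=\left(\int_0^1X^2(t)\psi(t)\,dt\right)^{1/2}$. The notation $f(\varepsilon)\sim g(\varepsilon)$ means $f(\varepsilon)/g(\varepsilon)\to1$. $\psi^{a}(t)$ means $(\psi(t))^{a}$. *)

theory Defs
  imports "HOL-Probability.Probability" "HOL-Library.Landau_Symbols"
begin

text \<open>Constants count as (degenerate) Gaussian variables, so that linear combinations of jointly
  Gaussian variables are always Gaussian.\<close>

definition gaussian_rv :: "'a measure \<Rightarrow> ('a \<Rightarrow> real) \<Rightarrow> bool" where
  "gaussian_rv M X \<longleftrightarrow> X \<in> borel_measurable M \<and>
     ((\<exists>\<mu> \<sigma>. 0 < \<sigma> \<and> distributed M lborel X (normal_density \<mu> \<sigma>)) \<or>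
      (\<exists>\<mu>. AE x in M. X x = \<mu>))"

definition gaussian_process :: "'a measure \<Rightarrow> 'i set \<Rightarrow> ('i \<Rightarrow> 'a \<Rightarrow> real) \<Rightarrow> bool" where
  "gaussian_process M T X \<longleftrightarrow>
     (\<forall>F c. finite F \<and> F \<subseteq> T \<longrightarrow> gaussian_rv M (\<lambda>x. \<Sum>t\<in>F. c t * X t x))"

text \<open>Continuity is required of every sample path, on an arbitrary (not necessarily complete)
  probability space, so that the weighted norm of the path is a measurable function.\<close>

definition bogoliubov_process :: "'a measure \<Rightarrow> real \<Rightarrow> (real \<Rightarrow> 'a \<Rightarrow> real) \<Rightarrow> bool" where
  "bogoliubov_process M \<omega> Y \<longleftrightarrow>
     gaussian_process M {0..1} Y \<and>
     (\<forall>x\<in>space M. continuous_on {0..1} (\<lambda>t. Y t x)) \<and>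
     (\<forall>t\<in>{0..1}. (LINT x|M. Y t x) = 0) \<and>
     (\<forall>t\<in>{0..1}. \<forall>s\<in>{0..1}.
        (LINT x|M. Y t x * Y s x) =
          1 / (2 * \<omega> * sinh (\<omega> / 2)) * cosh (\<omega> * \<bar>t - s\<bar> - \<omega> / 2))"

definition weighted_norm :: "(real \<Rightarrow> real) \<Rightarrow> (real \<Rightarrow> real) \<Rightarrow> real" where
  "weighted_norm \<psi> f = sqrt (LBINT t:{0..1}. (f t)\<^sup>2 * \<psi> t)"

text \<open>Derivatives are taken within \<open>S\<close>, hence one-sided at the endpoints of a closed interval;
  the values of the function outside \<open>S\<close> are irrelevant.\<close>

definition C2_on :: "real set \<Rightarrow> (real \<Rightarrow> real) \<Rightarrow> bool" where
  "C2_on S f \<longleftrightarrow> (\<exists>f' f''.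
     (\<forall>t\<in>S. (f has_real_derivative f' t) (at t within S)) \<and>
     (\<forall>t\<in>S. (f' has_real_derivative f'' t) (at t within S)) \<and>
     continuous_on S f'')"

end

theory Submission
  imports Defs "HOL-Complex_Analysis.Complex_Analysis" "HOL-Real_Asymp.Real_Asymp"
begin

text \<open>Sampling the process on a grid turns the Laplace transform of the squared norm into a Gaussian
  expectation with finitely many quadratic weights. The covariance is the periodic Green function of
  \<open>f'' = \<omega>\<^sup>2 f\<close>, and each weight is a point potential (a kick of \<open>f'\<close>), so switching the weights on one
  by one shows that \<open>L\<^sup>2\<close> times the discriminant \<open>trace P - 2\<close> of the kicked transfer matrix \<open>P\<close> is
  constant. Refining the grid replaces the kicked equation by \<open>f'' = (\<omega>\<^sup>2 + 2 s \<psi>) f\<close>, whose discriminant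
  has WKB asymptotics uniformly in a complex half plane; hence \<open>L s\<close> is uniformly asymptotic to
  \<open>c exp (- (\<theta> / 2) \<surd>(2 s))\<close>. Without the factor \<open>c\<close>, this is the Laplace transform of \<open>a\<^sup>2 / Z\<^sup>2\<close> with \<open>Z\<close>
  standard normal and \<open>a = \<theta> / 2\<close>. Comparing the two laws by Fourier inversion on the saddle line
  \<open>Re s = a\<^sup>2 / (2 x\<^sup>2)\<close> gives the asymptotics of the distribution function as \<open>x\<close> tends to \<open>0\<close>.\<close>

section \<open>Kicked transfer matrices and their Green functions\<close>

text \<open>Asymptotics of the Laplace transform on the real axis alone would in general determine
  only the logarithm of a small ball probability; hence the half plane, with a relative error
  uniform in the imaginary part. Gaussian conditioning makes sense only for nonnegative weights, so
  identities are found for real s and continued analytically. The discriminant gives L^2 only;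
  connectedness of the half plane settles the sign of the root. With \<mu> = sqrt(2 s) the
  discriminant grows like \<kappa> exp(\<theta> \<mu>), where 2 \<kappa> is the sum of
  (\<psi>(0)/\<psi>(1))^(1/4) and its reciprocal; this explains \<open>a = \<theta> / 2\<close> and
  c^2 = 4 sinh(\<omega>/2)^2/\<kappa>. A relative error survives inversion because the modulus of
  exp(-a sqrt(2 s)) on the line Re s = \<sigma> has integral at most of order \<sigma>^(3/4) exp(-a
  sqrt(2 \<sigma>)). The saddle value of \<sigma> minimises \<sigma> x - a sqrt(2 \<sigma>), and the
  inversion factor exp(\<sigma> x)/\<sigma> then leaves sqrt(x) exp(-a^2/(2 x)), the exact order of
  the reference distribution function, so no power of x is lost.\<close>

text \<open>The state \<open>(\<alpha>, \<beta>)\<close> stands for the free solution \<open>f t = \<alpha> exp (\<omega> t) + \<beta> exp (- \<omega> t)\<close> of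
  \<open>f'' = \<omega>\<^sup>2 f\<close>. A kick of weight \<open>w k\<close> at \<open>p k\<close> keeps \<open>f\<close> and increases \<open>f'\<close> by \<open>w k f (p k)\<close>.\<close>

primrec kicks :: "real \<Rightarrow> (nat \<Rightarrow> real) \<Rightarrow> (nat \<Rightarrow> 'a::real_normed_field) \<Rightarrow> nat \<Rightarrow> 'a \<times> 'a \<Rightarrow> 'a \<times> 'a" where
  "kicks \<omega> p w 0 x = x"
| "kicks \<omega> p w (Suc k) x =
    (let y = kicks \<omega> p w k x;
         v = w k * (fst y * of_real (exp (\<omega> * p k)) + snd y * of_real (exp (- \<omega> * p k))) / of_real (2 * \<omega>)
     in (fst y + v * of_real (exp (- \<omega> * p k)), snd y - v * of_real (exp (\<omega> * p k))))"

abbreviation grid_kicks :: "real \<Rightarrow> (real \<Rightarrow> real) \<Rightarrow> complex \<Rightarrow> nat \<Rightarrow> nat \<Rightarrow> complex \<times> complex \<Rightarrow> complex \<times> complex" where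
  "grid_kicks \<omega> \<psi> \<zeta> n \<equiv> kicks \<omega> (\<lambda>k. real k / real n) (\<lambda>k. \<zeta> * of_real (\<psi> (real k / real n) / real n))"

text \<open>The periodic Green function at points \<open>t, u\<close> beyond the last kick, where \<open>a b c d\<close> are the entries of
  the product (kicked transfer matrix) * (shift by one period).\<close>

definition green :: "real \<Rightarrow> real \<Rightarrow> real \<Rightarrow> real \<Rightarrow> real \<Rightarrow> real \<Rightarrow> real \<Rightarrow> real" where
  "green \<omega> a b c d t u = - sinh (\<omega> * \<bar>t - u\<bar>) / (2 * \<omega>)
     + (- 2 * b * exp (\<omega> * (t + u)) + (a - d) * (exp (\<omega> * (t - u)) + exp (\<omega> * (u - t)))
        + 2 * c * exp (- \<omega> * (t + u))) / (4 * \<omega> * (a + d - 2))"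

lemma green_commute: "green \<omega> a b c d t u = green \<omega> a b c d u t"
  unfolding green_def by (simp add: abs_minus_commute add.commute add.left_commute)

text \<open>Adding a kick changes the Green function by the rank-one update of Gaussian conditioning.\<close>

lemma green_kick:
  fixes \<omega> a b c d w p t u :: real
  defines "r1 \<equiv> w / (2 * \<omega>) * (exp (\<omega> * p) * a + exp (- \<omega> * p) * c)"
    and "r2 \<equiv> w / (2 * \<omega>) * (exp (\<omega> * p) * b + exp (- \<omega> * p) * d)"
  defines "a' \<equiv> a + exp (- \<omega> * p) * r1" and "b' \<equiv> b + exp (- \<omega> * p) * r2"
    and "c' \<equiv> c - exp (\<omega> * p) * r1" and "d' \<equiv> d - exp (\<omega> * p) * r2"
  assumes "\<omega> > 0" and det: "a * d - b * c = 1" and D: "a + d - 2 > 0"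
    and W: "1 + w * green \<omega> a b c d p p > 0"
  shows "a' + d' - 2 = (a + d - 2) * (1 + w * green \<omega> a b c d p p)"
    and "a' * d' - b' * c' = 1"
    and "t \<ge> p \<Longrightarrow> u \<ge> p \<Longrightarrow> green \<omega> a' b' c' d' t u =
      green \<omega> a b c d t u - w * green \<omega> a b c d t p * green \<omega> a b c d u p / (1 + w * green \<omega> a b c d p p)"
proof -
  define P where "P = exp (\<omega> * p)"
  define k where "k = w / (2 * \<omega>)"
  define D where "D = a + d - 2"
  have P: "P > 0" "exp (- \<omega> * p) = 1 / P" "exp (- (\<omega> * p)) = 1 / P" by (auto simp: P_def exp_minus field_simps)
  have Dp: "D > 0" using D by (simp add: D_def)
  have wk: "w = 2 * \<omega> * k" using \<open>\<omega> > 0\<close> by (simp add: k_def)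
  have a'_eq: "a' = a + k * (a + c / P\<^sup>2)" and b'_eq: "b' = b + k * (b + d / P\<^sup>2)"
    and c'_eq: "c' = c - k * (a * P\<^sup>2 + c)" and d'_eq: "d' = d - k * (b * P\<^sup>2 + d)"
    unfolding a'_def b'_def c'_def d'_def r1_def r2_def P P_def[symmetric] k_def[symmetric]
    using P by (simp_all add: field_simps power2_eq_square)
  have gpp: "w * green \<omega> a b c d p p = k * ((- 2 * b * P\<^sup>2 + 2 * (a - d) + 2 * c / P\<^sup>2)) / (2 * D)"
  proof -
    have e: "exp (\<omega> * (p + p)) = P\<^sup>2" "exp (- \<omega> * (p + p)) = 1 / P\<^sup>2"
    proof -
      show 1: "exp (\<omega> * (p + p)) = P\<^sup>2"
        by (simp only: P_def exp_add[symmetric] power2_eq_square distrib_left)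
      have "exp (- \<omega> * (p + p)) = inverse (exp (\<omega> * (p + p)))"
        by (simp add: exp_minus)
      with 1 show "exp (- \<omega> * (p + p)) = 1 / P\<^sup>2" by (simp add: field_simps)
    qed
    show ?thesis
      unfolding green_def e wk D_def[symmetric] using \<open>\<omega> > 0\<close> Dp P(1) by (simp add: field_simps)
  qed
  show D': "a' + d' - 2 = (a + d - 2) * (1 + w * green \<omega> a b c d p p)"
  proof -
    have "(a + d - 2) * (1 + w * green \<omega> a b c d p p) = D + k * (- 2 * b * P\<^sup>2 + 2 * (a - d) + 2 * c / P\<^sup>2) / 2"
    proof -
      have "D * (1 + k * x / (2 * D)) = D + k * x / 2" for x
        using Dp by (simp add: field_simps)
      then show ?thesis unfolding gpp D_def[symmetric] .
    qed
    also have "\<dots> = a' + d' - 2"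
      unfolding a'_eq d'_eq D_def using P(1) by (simp add: field_simps)
    finally show ?thesis by simp
  qed
  show det': "a' * d' - b' * c' = 1"
  proof -
    have "a' * d' - b' * c' = a * d - b * c"
      unfolding a'_eq b'_eq c'_eq d'_eq using P(1) by (simp add: field_simps)
    with det show ?thesis by simp
  qed
  assume tu: "t \<ge> p" "u \<ge> p"
  \<comment> \<open>Measuring times from the kick moves it to \<open>P = 1\<close>. Only the
    off-diagonal entries change, to \<open>B\<close> and \<open>C\<close>, and the determinant
    condition becomes \<open>B * C = a * d - 1\<close>.\<close>
  define B where "B = b * P\<^sup>2"
  define C where "C = c / P\<^sup>2"
  have BC: "B * C = a * d - 1" using det P(1) by (simp add: B_def C_def)
  have b_eq: "b = B / P\<^sup>2" "c = C * P\<^sup>2" using P(1) by (auto simp: B_def C_def)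
  \<comment> \<open>\<open>N\<close> is the numerator of \<open>green\<close> for
    \<open>u \<le> t\<close> in the variables S = exp(\<omega> (t - p)) and V = exp(\<omega> (u -
    p)). The sinh term is absorbed into the coefficients of S/V and V/S, where it turns
    \<open>a - d\<close> into \<open>2 - 2 * d\<close> and \<open>2 * a - 2\<close>.\<close>
  define N where "N = (\<lambda>a b c d S V :: real. (S / V) * (2 - 2 * d) + (V / S) * (2 * a - 2) - 2 * b * (S * V) + 2 * c / (S * V))"
  have N: "green \<omega> a b c d t u = N a (b * P\<^sup>2) (c / P\<^sup>2) d (exp (\<omega> * (t - p))) (exp (\<omega> * (u - p))) / (4 * \<omega> * (a + d - 2))"
    if "u \<le> t" "a + d - 2 > 0" for a b c d t u
  proof -
    define T where "T = exp (\<omega> * t)"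
    define U where "U = exp (\<omega> * u)"
    have TU: "T > 0" "U > 0" by (auto simp: T_def U_def)
    have e: "exp (\<omega> * (t - p)) = T / P" "exp (\<omega> * (u - p)) = U / P" "exp (\<omega> * (t + u)) = T * U"
      "exp (- \<omega> * (t + u)) = 1 / (T * U)" "exp (\<omega> * (t - u)) = T / U" "exp (\<omega> * (u - t)) = U / T"
      "sinh (\<omega> * \<bar>t - u\<bar>) = (T / U - U / T) / 2"
      using that(1) by (simp_all add: T_def U_def P_def sinh_def exp_diff exp_add exp_minus algebra_simps field_simps)
    show ?thesis
      unfolding green_def e N_def using TU P(1) \<open>\<omega> > 0\<close> that(2)
      by (simp add: divide_simps) (simp add: algebra_simps power2_eq_square)
  qed
  have main: "green \<omega> a' b' c' d' t u =
      green \<omega> a b c d t u - w * green \<omega> a b c d t p * green \<omega> a b c d u p / (1 + w * green \<omega> a b c d p p)"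
    if "u \<le> t" "u \<ge> p" for t u
  proof -
    define S where "S = exp (\<omega> * (t - p))"
    define V where "V = exp (\<omega> * (u - p))"
    have SV: "S > 0" "V > 0" by (auto simp: S_def V_def)
    have D'p: "a' + d' - 2 > 0" using D' W D by simp
    have W': "1 + w * green \<omega> a b c d p p = (a' + d' - 2) / D"
      using D' Dp by (simp add: D_def)
    have gtu: "green \<omega> a b c d t u = N a B C d S V / (4 * \<omega> * D)"
      using N[of u t a d b c] that D by (simp add: S_def V_def D_def B_def C_def)
    have gtp: "green \<omega> a b c d t p = N a B C d S 1 / (4 * \<omega> * D)"
      using N[of p t a d b c] that D by (simp add: S_def V_def D_def B_def C_def)
    have gup: "green \<omega> a b c d u p = N a B C d V 1 / (4 * \<omega> * D)"
      using N[of p u a d b c] that D by (simp add: S_def V_def D_def B_def C_def)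
    have g': "green \<omega> a' b' c' d' t u = N a' (b' * P\<^sup>2) (c' / P\<^sup>2) d' S V / (4 * \<omega> * (a' + d' - 2))"
      using N[of u t a' d' b' c'] that D'p by (simp add: S_def V_def)
    have e': "a' = a + k * (a + C)" "b' * P\<^sup>2 = B + k * (B + d)" "c' / P\<^sup>2 = C - k * (a + C)" "d' = d - k * (B + d)"
      unfolding a'_eq b'_eq c'_eq d'_eq B_def C_def using P(1)
      by (simp_all add: field_simps)
    \<comment> \<open>At V = 1 the numerator is 2 ((1 - d - B) S + (a - 1 + C)/S), so the product of
      the two one-point numerators has rank one in S and V. The claim splits into the coefficients
      of x, y, z, v, each a consequence of \<open>B * C = a * d - 1\<close>.\<close>
    have key: "D * N a' (b' * P\<^sup>2) (c' / P\<^sup>2) d' S V = (a' + d' - 2) * N a B C d S V - k / 2 * N a B C d S 1 * N a B C d V 1"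
    proof -
      define x where "x = S / V"
      define y where "y = V / S"
      define z where "z = S * V"
      define v where "v = 1 / (S * V)"
      have "N a B C d S 1 * N a B C d V 1 = 4 * ((1 - d - B)\<^sup>2 * z + (1 - d - B) * (a - 1 + C) * (x + y) + (a - 1 + C)\<^sup>2 * v)"
        unfolding N_def x_def y_def z_def v_def using SV by (simp add: field_simps power2_eq_square)
      moreover have NN: "N a b c d S V = x * (2 - 2 * d) + y * (2 * a - 2) - 2 * b * z + 2 * c * v" for a b c d
        unfolding N_def x_def y_def z_def v_def by simp
      moreover have 1: "D * (B + k * (B + d)) = (a' + d' - 2) * B + k * (1 - d - B)\<^sup>2"
        unfolding D_def e' using BC by algebra
      moreover have 2: "D * (C - k * (a + C)) = (a' + d' - 2) * C - k * (a - 1 + C)\<^sup>2"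
        unfolding D_def e' using BC by algebra
      moreover have 3: "D * (1 - d') = (a' + d' - 2) * (1 - d) - k * (1 - d - B) * (a - 1 + C)"
        unfolding D_def e' using BC by algebra
      moreover have 4: "D * (a' - 1) = (a' + d' - 2) * (a - 1) - k * (1 - d - B) * (a - 1 + C)"
        unfolding D_def e' using BC by algebra
      ultimately show ?thesis
        unfolding NN e'(2,3)
      proof -
        have "D * (x * (2 - 2 * d') + y * (2 * a' - 2) - 2 * (B + k * (B + d)) * z + 2 * (C - k * (a + C)) * v)
          = 2 * x * (D * (1 - d')) + 2 * y * (D * (a' - 1)) - 2 * z * (D * (B + k * (B + d))) + 2 * v * (D * (C - k * (a + C)))"
          by (simp add: algebra_simps)
        also have "\<dots> = (a' + d' - 2) * (x * (2 - 2 * d) + y * (2 * a - 2) - 2 * B * z + 2 * C * v)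
           - k / 2 * (4 * ((1 - d - B)\<^sup>2 * z + (1 - d - B) * (a - 1 + C) * (x + y) + (a - 1 + C)\<^sup>2 * v))"
          unfolding 1 2 3 4 by (simp add: algebra_simps)
        finally show "D * (x * (2 - 2 * d') + y * (2 * a' - 2) - 2 * (B + k * (B + d)) * z + 2 * (C - k * (a + C)) * v) =
           (a' + d' - 2) * (x * (2 - 2 * d) + y * (2 * a - 2) - 2 * B * z + 2 * C * v)
           - k / 2 * N a B C d S 1 * N a B C d V 1"
          using \<open>N a B C d S 1 * N a B C d V 1 = _\<close> by (simp add: mult.assoc)
      qed
    qed
    have "N a' (b' * P\<^sup>2) (c' / P\<^sup>2) d' S V = ((a' + d' - 2) * N a B C d S V - k / 2 * N a B C d S 1 * N a B C d V 1) / D"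
      using key Dp by (simp add: field_simps)
    then show ?thesis
    proof -
      assume *: "N a' (b' * P\<^sup>2) (c' / P\<^sup>2) d' S V = ((a' + d' - 2) * N a B C d S V - k / 2 * N a B C d S 1 * N a B C d V 1) / D"
      have "((a' + d' - 2) * x - k / 2 * y * z) / D / (4 * \<omega> * (a' + d' - 2))
        = x / (4 * \<omega> * D) - 2 * \<omega> * k * (y / (4 * \<omega> * D)) * (z / (4 * \<omega> * D)) / ((a' + d' - 2) / D)" for x y z
      proof -
        define q where "q = a' + d' - 2"
        have "q > 0" using D'p by (simp add: q_def)
        then have "(q * x - k / 2 * y * z) / D / (4 * \<omega> * q)
          = x / (4 * \<omega> * D) - 2 * \<omega> * k * (y / (4 * \<omega> * D)) * (z / (4 * \<omega> * D)) / (q / D)"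
          using Dp \<open>\<omega> > 0\<close> by (simp add: field_simps)
        then show ?thesis by (simp only: q_def)
      qed
      then show ?thesis
        unfolding W' gtu gtp gup g' * by (simp only: wk)
    qed
  qed
  show "green \<omega> a' b' c' d' t u =
      green \<omega> a b c d t u - w * green \<omega> a b c d t p * green \<omega> a b c d u p / (1 + w * green \<omega> a b c d p p)"
  proof (cases "u \<le> t")
    case True
    with main tu show ?thesis by blast
  next
    case False
    with main[of t u] tu show ?thesis
      by (simp add: green_commute[of \<omega> a' b' c' d' t u] green_commute[of \<omega> a b c d t u] mult_ac)
  qed
qed

section \<open>Gaussian quadratic functionals on a grid\<close>

text \<open>Completing the square: the integrand is a constant times the normal density with mean
  \<open>- q * b / v\<close> and standard deviation \<open>1 / sqrt v\<close>, where
  \<open>v = 1 + w * r\<close>. Complex values appear only because the formula is used inside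
  complex expectations.\<close>

lemma std_normal_integral_exp_quadratic:
  fixes b r w :: real
  assumes "w \<ge> 0" and v: "1 + w * r > 0"
  shows "(LINT z|std_normal_distribution. complex_of_real (exp (- (sqrt w * z * b) - w * z\<^sup>2 * r / 2)))
    = of_real (exp (w * b\<^sup>2 / (2 * (1 + w * r))) / sqrt (1 + w * r))"
proof -
  define v where "v = 1 + w * r"
  have v: "v > 0" using assms by (simp add: v_def)
  define q where "q = sqrt w"
  have w: "w = q\<^sup>2" using assms by (simp add: q_def)
  have eq: "std_normal_density z * exp (- (q * z * b) - w * z\<^sup>2 * r / 2)
      = exp (w * b\<^sup>2 / (2 * v)) / sqrt v * normal_density (- q * b / v) (1 / sqrt v) z" for z
  proof -
    have s: "(1 / sqrt v)\<^sup>2 = 1 / v" using v by (simp add: power_divide)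
    have "- z\<^sup>2 / 2 + (- (q * z * b) - w * z\<^sup>2 * r / 2) = w * b\<^sup>2 / (2 * v) + - (z - (- q * b / v))\<^sup>2 / (2 * (1 / v))"
    proof -
      have "w * r = v - 1" by (simp add: v_def)
      then have "w * z\<^sup>2 * r = (v - 1) * z\<^sup>2" by (simp add: mult_ac)
      then have "- z\<^sup>2 / 2 + (- (q * z * b) - w * z\<^sup>2 * r / 2) = - (q * z * b) - v * z\<^sup>2 / 2"
        by (simp add: field_simps)
      also have "\<dots> = w * b\<^sup>2 / (2 * v) + - (z - (- q * b / v))\<^sup>2 / (2 * (1 / v))"
        unfolding w using v by (simp add: power2_eq_square field_simps)
      finally show ?thesis .
    qed
    then have e: "exp (- z\<^sup>2 / 2) * exp (- (q * z * b) - w * z\<^sup>2 * r / 2)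
      = exp (w * b\<^sup>2 / (2 * v)) * exp (- (z - (- q * b / v))\<^sup>2 / (2 * (1 / v)))"
      by (simp only: exp_add[symmetric])
    have c: "1 / sqrt (2 * pi * (1 / v)) = sqrt v / sqrt (2 * pi)"
      using v by (simp add: real_sqrt_divide)
    have "std_normal_density z * exp (- (q * z * b) - w * z\<^sup>2 * r / 2)
      = 1 / sqrt (2 * pi) * (exp (- z\<^sup>2 / 2) * exp (- (q * z * b) - w * z\<^sup>2 * r / 2))"
      by (simp add: normal_density_def)
    also have "\<dots> = exp (w * b\<^sup>2 / (2 * v)) / sqrt v * normal_density (- q * b / v) (1 / sqrt v) z"
      unfolding e normal_density_def s c using v by simp
    finally show ?thesis .
  qed
  have "(LINT z|std_normal_distribution. complex_of_real (exp (- (q * z * b) - w * z\<^sup>2 * r / 2)))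
    = (LINT z|lborel. complex_of_real (std_normal_density z * exp (- (q * z * b) - w * z\<^sup>2 * r / 2)))"
    by (subst integral_density) (auto simp: scaleR_conv_of_real)
  also have "\<dots> = (LINT z|lborel. complex_of_real (exp (w * b\<^sup>2 / (2 * v)) / sqrt v * normal_density (- q * b / v) (1 / sqrt v) z))"
    unfolding eq ..
  also have "\<dots> = complex_of_real (exp (w * b\<^sup>2 / (2 * v)) / sqrt v * (LINT z|lborel. normal_density (- q * b / v) (1 / sqrt v) z))"
    by (simp only: integral_complex_of_real integral_mult_right_zero)
  also have "(LINT z|lborel. normal_density (- q * b / v) (1 / sqrt v) z) = 1"
    using v by (intro integral_normal_density) simp
  finally show ?thesis by (simp add: q_def v_def)
qed

lemma quadratic_form_shift:
  fixes R :: "nat \<Rightarrow> nat \<Rightarrow> real"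
  assumes "k < n" and sym: "\<And>i j. R i j = R j i"
  shows "(\<Sum>i<n. \<Sum>j<n. (c i + (if i = k then e else 0)) * (c j + (if j = k then e else 0)) * R i j)
    = (\<Sum>i<n. \<Sum>j<n. c i * c j * R i j) + 2 * e * (\<Sum>i<n. c i * R i k) + e\<^sup>2 * R k k"
proof -
  have d: "(\<Sum>j<n. (if j = k then e else 0) * f j) = e * f k" for f :: "nat \<Rightarrow> real"
    using assms(1) by (simp add: sum.delta if_distrib[where f="\<lambda>x. x * _"] cong: if_cong)
  have "(\<Sum>j<n. (c i + (if i = k then e else 0)) * (c j + (if j = k then e else 0)) * R i j)
     = (\<Sum>j<n. c i * c j * R i j) + (if i = k then e else 0) * (\<Sum>j<n. c j * R i j)
       + e * (c i * R i k) + (if i = k then e else 0) * (e * R i k)" for i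
  proof -
    have "(\<Sum>j<n. (c i + (if i = k then e else 0)) * (c j + (if j = k then e else 0)) * R i j)
      = (\<Sum>j<n. c i * c j * R i j + (if i = k then e else 0) * (c j * R i j)
         + (if j = k then e else 0) * (c i * R i j) + (if j = k then e else 0) * ((if i = k then e else 0) * R i j))"
      by (intro sum.cong refl) (simp add: algebra_simps)
    then show ?thesis
      by (simp only: sum.distrib d sum_distrib_left[symmetric]) simp
  qed
  moreover have sR: "(\<Sum>j<n. c j * R k j) = (\<Sum>j<n. c j * R j k)"
    by (intro sum.cong refl arg_cong2[where f="(*)"] sym)
  ultimately show ?thesis
    by (simp only: sum.distrib d sum_distrib_left[symmetric] sR) (simp add: power2_eq_square)
qed

text \<open>The factor \<open>exp (- w y\<^sup>2 / 2)\<close> is the characteristic function of a normal variable at \<open>\<surd>w y\<close>, so it only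
  shifts the linear form under the integral; no joint density of the \<open>X i\<close> is needed.\<close>

lemma gaussian_char_weighted_step:
  fixes X :: "nat \<Rightarrow> 'a \<Rightarrow> real" and R :: "nat \<Rightarrow> nat \<Rightarrow> real" and w :: real
  assumes "prob_space M" and X[measurable]: "\<And>i. i < n \<Longrightarrow> X i \<in> borel_measurable M"
    and g[measurable]: "g \<in> borel_measurable M" and g01: "\<And>x. x \<in> space M \<Longrightarrow> 0 \<le> g x \<and> g x \<le> (1::real)"
    and w: "w \<ge> 0" and k: "k < n" and sym: "\<And>i j. R i j = R j i" and \<Lambda>: "\<Lambda> > 0"
    and H: "\<And>c. (\<forall>i<k. c i = 0) \<Longrightarrow>
      (LINT x|M. iexp (\<Sum>i<n. c i * X i x) * complex_of_real (g x))
        = of_real (\<Lambda> * exp (- (\<Sum>i<n. \<Sum>j<n. c i * c j * R i j) / 2))"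
  shows "R k k \<ge> 0"
    and "\<And>c. (\<forall>i<k. c i = 0) \<Longrightarrow>
      (LINT x|M. iexp (\<Sum>i<n. c i * X i x) * complex_of_real (g x * exp (- w * (X k x)\<^sup>2 / 2)))
        = of_real (\<Lambda> / sqrt (1 + w * R k k) *
            exp (- (\<Sum>i<n. \<Sum>j<n. c i * c j * (R i j - w * R i k * R j k / (1 + w * R k k))) / 2))"
proof -
  interpret prob_space M by fact
  let ?c = "\<lambda>i. if i = k then 1 else 0 :: real"
  have d: "(\<Sum>j<n. (if j = k then e else 0) * f j) = e * f k" for e and f :: "nat \<Rightarrow> real"
    using k by (simp add: if_distrib[where f="\<lambda>x. x * _"] cong: if_cong)
  have int_g: "integrable M g"
    by (rule integrable_const_bound[where B=1]) (use g01 in auto)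
  have Xs[measurable]: "(\<lambda>x. \<Sum>i<n. c i * X i x) \<in> borel_measurable M" for c
    by (intro borel_measurable_sum) auto
  have Xk[measurable]: "X k \<in> borel_measurable M" using k by auto
  \<comment> \<open>The total mass \<Lambda> bounds every characteristic value of the weighted law
    in modulus; the unit vector at \<open>k\<close> turns this into exp(- R k k / 2) \<le> 1.
    Positivity of \<open>1 + w * R k k\<close> rests on it.\<close>
  show Rkk: "R k k \<ge> 0"
  proof -
    have "cmod (LINT x|M. iexp (\<Sum>i<n. ?c i * X i x) * complex_of_real (g x))
        \<le> (LINT x|M. norm (iexp (\<Sum>i<n. ?c i * X i x) * complex_of_real (g x)))"
      by (rule integral_norm_bound)
    also have "\<dots> = (LINT x|M. g x)"
      by (intro Bochner_Integration.integral_cong refl) (use g01 in \<open>auto simp: norm_mult\<close>)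
    also have "\<dots> = \<Lambda>"
    proof -
      have "complex_of_real (LINT x|M. g x) = of_real \<Lambda>"
        using H[of "\<lambda>_. 0"] by simp
      then show ?thesis by simp
    qed
    finally have "cmod (of_real (\<Lambda> * exp (- (\<Sum>i<n. \<Sum>j<n. ?c i * ?c j * R i j) / 2))) \<le> \<Lambda>"
      by (subst (asm) H) auto
    moreover have "(\<Sum>i<n. \<Sum>j<n. ?c i * ?c j * R i j) = R k k"
      using quadratic_form_shift[OF k sym, of "\<lambda>_. 0" 1] by simp
    ultimately have "\<Lambda> * exp (- R k k / 2) \<le> \<Lambda>"
      using \<Lambda> by (simp only: norm_of_real)
    then show ?thesis using \<Lambda> by simp
  qed
  fix c :: "nat \<Rightarrow> real" assume c: "\<forall>i<k. c i = 0"
  define b where "b = (\<Sum>i<n. c i * R i k)"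
  define q where "q = sqrt w"
  define QR where "QR = (\<Sum>i<n. \<Sum>j<n. c i * c j * R i j)"
  have v: "1 + w * R k k > 0" using w Rkk by (simp add: add_pos_nonneg)
  have qw: "q\<^sup>2 = w" using w by (simp add: q_def)
  let ?N = std_normal_distribution
  interpret N: prob_space ?N by (intro prob_space_normal_density) simp
  interpret P: pair_prob_space M ?N ..
  have char: "complex_of_real (exp (- w * y\<^sup>2 / 2)) = (LINT z|?N. iexp (q * y * z))" for y
    using fun_cong[OF char_std_normal_distribution, of "q * y"]
    by (simp add: char_def power_mult_distrib qw)
  have int: "integrable (M \<Otimes>\<^sub>M ?N) (\<lambda>(x, z). iexp (\<Sum>i<n. c i * X i x) * complex_of_real (g x) * iexp (q * X k x * z))"
  proof (rule P.P.integrable_const_bound[where B=1])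
    show "AE z in M \<Otimes>\<^sub>M ?N. norm (case z of (x, z) \<Rightarrow> iexp (\<Sum>i<n. c i * X i x) * complex_of_real (g x) * iexp (q * X k x * z)) \<le> 1"
      by (rule AE_I2) (use g01 in \<open>auto simp: norm_mult space_pair_measure\<close>)
  qed measurable
  have "(LINT x|M. iexp (\<Sum>i<n. c i * X i x) * complex_of_real (g x * exp (- w * (X k x)\<^sup>2 / 2)))
    = (LINT x|M. (LINT z|?N. iexp (\<Sum>i<n. c i * X i x) * complex_of_real (g x) * iexp (q * X k x * z)))"
    by (intro Bochner_Integration.integral_cong refl)
       (simp only: of_real_mult char mult.assoc[symmetric] integral_mult_right_zero)
  also have "\<dots> = (LINT z|?N. (LINT x|M. iexp (\<Sum>i<n. c i * X i x) * complex_of_real (g x) * iexp (q * X k x * z)))"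
    using P.Fubini_integral[OF int] by simp
  also have "\<dots> = (LINT z|?N. complex_of_real (\<Lambda> * exp (- QR / 2)) * complex_of_real (exp (- (q * z * b) - w * z\<^sup>2 * R k k / 2)))"
  proof (intro Bochner_Integration.integral_cong refl)
    fix z
    \<comment> \<open>Absorbing the extra oscillation changes the coefficient at \<open>k\<close>
      only, so the shifted vector still vanishes below \<open>k\<close> and \<open>H\<close>
      applies.\<close>
    let ?c' = "\<lambda>i. c i + (if i = k then q * z else 0)"
    have "(\<Sum>i<n. ?c' i * X i x) = (\<Sum>i<n. c i * X i x) + q * z * X k x" for x
      by (simp only: distrib_right sum.distrib d)
    then have "(LINT x|M. iexp (\<Sum>i<n. c i * X i x) * complex_of_real (g x) * iexp (q * X k x * z))
      = (LINT x|M. iexp (\<Sum>i<n. ?c' i * X i x) * complex_of_real (g x))"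
      by (intro Bochner_Integration.integral_cong refl)
        (simp add: distrib_left exp_add mult_ac)
    also have "\<dots> = of_real (\<Lambda> * exp (- (\<Sum>i<n. \<Sum>j<n. ?c' i * ?c' j * R i j) / 2))"
      by (rule H) (use c in auto)
    also have "(\<Sum>i<n. \<Sum>j<n. ?c' i * ?c' j * R i j) = QR + 2 * (q * z) * b + (q * z)\<^sup>2 * R k k"
      unfolding QR_def b_def by (rule quadratic_form_shift[OF k sym])
    also have "\<Lambda> * exp (- (QR + 2 * (q * z) * b + (q * z)\<^sup>2 * R k k) / 2)
      = \<Lambda> * exp (- QR / 2) * exp (- (q * z * b) - w * z\<^sup>2 * R k k / 2)"
    proof -
      have "- (QR + 2 * (q * z) * b + (q * z)\<^sup>2 * R k k) / 2 = - QR / 2 + (- (q * z * b) - w * z\<^sup>2 * R k k / 2)"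
        unfolding power_mult_distrib qw by (simp add: field_simps)
      then show ?thesis by (simp only: exp_add mult.assoc)
    qed
    finally show "(LINT x|M. iexp (\<Sum>i<n. c i * X i x) * complex_of_real (g x) * iexp (q * X k x * z))
      = complex_of_real (\<Lambda> * exp (- QR / 2)) * complex_of_real (exp (- (q * z * b) - w * z\<^sup>2 * R k k / 2))"
      by simp
  qed
  also have "\<dots> = complex_of_real (\<Lambda> * exp (- QR / 2)) * of_real (exp (w * b\<^sup>2 / (2 * (1 + w * R k k))) / sqrt (1 + w * R k k))"
    by (simp only: integral_mult_right_zero q_def std_normal_integral_exp_quadratic[OF w v])
  also have "\<dots> = of_real (\<Lambda> / sqrt (1 + w * R k k) * exp (- (QR - w * b\<^sup>2 / (1 + w * R k k)) / 2))"
  proof -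
    have "- (QR - w * b\<^sup>2 / (1 + w * R k k)) / 2 = - QR / 2 + w * b\<^sup>2 / (2 * (1 + w * R k k))"
      using v by (simp add: field_simps)
    then show ?thesis by (simp only: exp_add of_real_mult of_real_divide) simp
  qed
  also have "QR - w * b\<^sup>2 / (1 + w * R k k)
     = (\<Sum>i<n. \<Sum>j<n. c i * c j * (R i j - w * R i k * R j k / (1 + w * R k k)))"
  proof -
    have "b\<^sup>2 = (\<Sum>i<n. \<Sum>j<n. c i * R i k * (c j * R j k))"
      unfolding b_def power2_eq_square by (rule sum_product)
    then show ?thesis
      unfolding QR_def right_diff_distrib sum_subtractf
      by (simp add: sum_distrib_left sum_divide_distrib mult_ac)
  qed
  finally show "(LINT x|M. iexp (\<Sum>i<n. c i * X i x) * complex_of_real (g x * exp (- w * (X k x)\<^sup>2 / 2)))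
        = of_real (\<Lambda> / sqrt (1 + w * R k k) *
            exp (- (\<Sum>i<n. \<Sum>j<n. c i * c j * (R i j - w * R i k * R j k / (1 + w * R k k))) / 2))" .
qed

lemma gaussian_rv_square_integrable:
  assumes "prob_space M" "gaussian_rv M X"
  shows "integrable M X" "integrable M (\<lambda>x. (X x)\<^sup>2)"
proof -
  interpret prob_space M by fact
  have X[measurable]: "X \<in> borel_measurable M" using assms(2) by (simp add: gaussian_rv_def)
  have "integrable M X \<and> integrable M (\<lambda>x. (X x)\<^sup>2)"
    using assms(2) unfolding gaussian_rv_def
  proof (elim conjE disjE exE)
    fix \<mu> \<sigma> :: real
    assume s: "0 < \<sigma>" and D: "distributed M lborel X (normal_density \<mu> \<sigma>)"
    have 1: "integrable lborel (\<lambda>x. normal_density \<mu> \<sigma> x * x)"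
    proof -
      have "integrable lborel (\<lambda>x. normal_density \<mu> \<sigma> x * (x - \<mu>)^1 + \<mu> * normal_density \<mu> \<sigma> x)"
        by (intro Bochner_Integration.integrable_add integrable_mult_right
            integrable_normal_moment integrable_normal_density s)
      then show ?thesis
        by (rule Bochner_Integration.integrable_cong[THEN iffD1, OF refl, rotated]) (auto simp: algebra_simps)
    qed
    have "integrable lborel (\<lambda>x. normal_density \<mu> \<sigma> x * (x - \<mu>)^2 + 2 * \<mu> * (normal_density \<mu> \<sigma> x * x) - \<mu>\<^sup>2 * normal_density \<mu> \<sigma> x)"
      by (intro Bochner_Integration.integrable_add Bochner_Integration.integrable_diff integrable_mult_right
          integrable_normal_moment integrable_normal_density 1 s)
    then have 2: "integrable lborel (\<lambda>x. normal_density \<mu> \<sigma> x * x\<^sup>2)"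
      by (rule Bochner_Integration.integrable_cong[THEN iffD1, OF refl, rotated]) (auto simp: power2_eq_square algebra_simps)
    show ?thesis
      using 1 2 distributed_integrable[OF D, of "\<lambda>x. x"] distributed_integrable[OF D, of "\<lambda>x. x\<^sup>2"] by simp
  next
    fix \<mu> assume ae: "AE x in M. X x = \<mu>"
    have "integrable M X" "integrable M (\<lambda>x. (X x)\<^sup>2)"
      by (rule integrable_cong_AE_imp[of _ "\<lambda>_. \<mu>"] integrable_cong_AE_imp[of _ "\<lambda>_. \<mu>\<^sup>2"];
          use ae in auto)+
    then show ?thesis by simp
  qed
  then show "integrable M X" "integrable M (\<lambda>x. (X x)\<^sup>2)" by auto
qed

lemma gaussian_rv_char:
  assumes "prob_space M" "gaussian_rv M X" and zero: "(LINT x|M. X x) = 0"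
  shows "(LINT x|M. iexp (X x)) = of_real (exp (- (LINT x|M. (X x)\<^sup>2) / 2))"
proof -
  interpret prob_space M by fact
  have X[measurable]: "X \<in> borel_measurable M" using assms(2) by (simp add: gaussian_rv_def)
  show ?thesis
    using assms(2) unfolding gaussian_rv_def
  proof (elim conjE disjE exE)
    fix \<mu> \<sigma> :: real
    assume s: "0 < \<sigma>" and D: "distributed M lborel X (normal_density \<mu> \<sigma>)"
    have mu: "\<mu> = 0" using normal_distributed_expectation[OF s D] zero by simp
    have var: "(LINT x|M. (X x)\<^sup>2) = \<sigma>\<^sup>2"
      using normal_distributed_variance[OF s D] zero by simp
    have "distributed M lborel (\<lambda>x. X x / \<sigma>) std_normal_density"
      using D normal_standard_normal_convert[OF s, of X 0] by (simp add: mu)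
    then have Z: "distr M lborel (\<lambda>x. X x / \<sigma>) = std_normal_distribution"
      by (simp add: distributed_def)
    have "(LINT x|M. iexp (X x)) = (LINT x|M. iexp (\<sigma> * (X x / \<sigma>)))" using s by simp
    also have "\<dots> = (LINT z|distr M lborel (\<lambda>x. X x / \<sigma>). iexp (\<sigma> * z))"
      by (subst integral_distr) auto
    also have "\<dots> = char std_normal_distribution \<sigma>" unfolding Z char_def by simp
    finally show ?thesis unfolding var char_std_normal_distribution by simp
  next
    fix \<mu> assume ae: "AE x in M. X x = \<mu>"
    have "(LINT x|M. X x) = (LINT x|M. \<mu>)" using ae by (intro integral_cong_AE) auto
    then have mu: "\<mu> = 0" using zero by (simp add: prob_space)
    have "(LINT x|M. iexp (X x)) = (LINT x|M. 1)" using ae mu by (intro integral_cong_AE) auto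
    moreover have "(LINT x|M. (X x)\<^sup>2) = (LINT x|M. 0)" using ae mu by (intro integral_cong_AE) auto
    ultimately show ?thesis by (simp add: prob_space)
  qed
qed

text \<open>\<open>gaussian_process\<close> speaks of sums over finite sets of times; injectivity of
  \<open>p\<close> turns the indexed sum into one of these. A centered Gaussian variable is
  determined by its variance, here expanded into covariances.\<close>

lemma gaussian_process_char:
  fixes p :: "nat \<Rightarrow> 'i"
  assumes "prob_space M" and G: "gaussian_process M T Y" and mean: "\<And>t. t \<in> T \<Longrightarrow> (LINT x|M. Y t x) = 0"
    and p: "p ` {..<n} \<subseteq> T" "inj_on p {..<n}"
  shows "(LINT x|M. iexp (\<Sum>i<n. c i * Y (p i) x)) =
    of_real (exp (- (\<Sum>i<n. \<Sum>j<n. c i * c j * (LINT x|M. Y (p i) x * Y (p j) x)) / 2))"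
proof -
  interpret prob_space M by fact
  have lin: "gaussian_rv M (\<lambda>x. \<Sum>t\<in>F. c t * Y t x)" if "finite F" "F \<subseteq> T" for F c
    using G that by (auto simp: gaussian_process_def)
  have one: "gaussian_rv M (Y t)" if "t \<in> T" for t
    using lin[of "{t}" "\<lambda>_. 1"] that by simp
  have int: "integrable M (Y t)" "integrable M (\<lambda>x. (Y t x)\<^sup>2)" "Y t \<in> borel_measurable M" if "t \<in> T" for t
    using gaussian_rv_square_integrable[OF assms(1) one[OF that]] by auto
  have int2: "integrable M (\<lambda>x. Y t x * Y s x)" if "t \<in> T" "s \<in> T" for t s
  proof (rule Bochner_Integration.integrable_bound)
    show "integrable M (\<lambda>x. (Y t x)\<^sup>2 + (Y s x)\<^sup>2)" using int that by auto
    show "(\<lambda>x. Y t x * Y s x) \<in> borel_measurable M" using int(3) that by auto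
    have "\<bar>a * b\<bar> \<le> a\<^sup>2 + b\<^sup>2" for a b :: real
    proof -
      have "2 * \<bar>a\<bar> * \<bar>b\<bar> \<le> a\<^sup>2 + b\<^sup>2" using sum_squares_bound[of "\<bar>a\<bar>" "\<bar>b\<bar>"] by simp
      moreover have "0 \<le> \<bar>a\<bar> * \<bar>b\<bar>" by simp
      ultimately show ?thesis unfolding abs_mult by linarith
    qed
    then show "AE x in M. norm (Y t x * Y s x) \<le> norm ((Y t x)\<^sup>2 + (Y s x)\<^sup>2)" by simp
  qed
  define X where "X = (\<lambda>x. \<Sum>i<n. c i * Y (p i) x)"
  have "X = (\<lambda>x. \<Sum>t\<in>p ` {..<n}. c (inv_into {..<n} p t) * Y t x)"
    using p(2) by (simp add: X_def sum.reindex)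
  then have GX: "gaussian_rv M X" using lin[OF finite_imageI[OF finite_lessThan] p(1)] by simp
  have pT: "p i \<in> T" if "i < n" for i using p(1) that by auto
  have "(LINT x|M. X x) = (\<Sum>i<n. c i * (LINT x|M. Y (p i) x))"
    unfolding X_def by (subst Bochner_Integration.integral_sum) (auto intro!: int pT)
  also have "\<dots> = 0" using mean pT by simp
  finally have X0: "(LINT x|M. X x) = 0" .
  have "(LINT x|M. (X x)\<^sup>2) = (LINT x|M. (\<Sum>i<n. \<Sum>j<n. c i * c j * (Y (p i) x * Y (p j) x)))"
    unfolding X_def power2_eq_square sum_product by (simp add: mult_ac)
  also have "\<dots> = (\<Sum>i<n. \<Sum>j<n. c i * c j * (LINT x|M. Y (p i) x * Y (p j) x))"
    by (subst Bochner_Integration.integral_sum, (auto intro!: int2 pT)[1], rule sum.cong[OF refl],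
        subst Bochner_Integration.integral_sum) (auto intro!: int2 pT)
  finally show ?thesis
    using gaussian_rv_char[OF assms(1) GX X0] by (simp add: X_def)
qed

lemma bogoliubov_process_measurable:
  assumes "bogoliubov_process M \<omega> Y" "t \<in> {0..1}"
  shows "Y t \<in> borel_measurable M"
proof -
  have "gaussian_rv M (\<lambda>x. \<Sum>u\<in>{t}. 1 * Y u x)"
    using assms unfolding bogoliubov_process_def gaussian_process_def
    by (elim conjE allE[of _ "{t}"] allE[of _ "\<lambda>_. 1"]) auto
  then show ?thesis by (simp add: gaussian_rv_def)
qed

text \<open>Up to sign this is det(P - 1) for the product P of transfer matrix and period shift,
  because det P = 1; it vanishes exactly when a periodic solution exists. States are coefficients of
  the free solutions, so the shift by one period is the diagonal matrix of exp(\<omega>) and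
  exp(-\<omega>). The type is polymorphic to cover real weights and their complex
  continuation.\<close>

definition discr :: "real \<Rightarrow> (nat \<Rightarrow> real) \<Rightarrow> (nat \<Rightarrow> 'a::real_normed_field) \<Rightarrow> nat \<Rightarrow> 'a" where
  "discr \<omega> p w k = of_real (exp \<omega>) * fst (kicks \<omega> p w k (1, 0))
     + of_real (exp (- \<omega>)) * snd (kicks \<omega> p w k (0, 1)) - 2"

abbreviation grid_discr :: "real \<Rightarrow> (real \<Rightarrow> real) \<Rightarrow> complex \<Rightarrow> nat \<Rightarrow> complex" where
  "grid_discr \<omega> \<psi> \<zeta> n \<equiv> discr \<omega> (\<lambda>k. real k / real n) (\<lambda>k. \<zeta> * of_real (\<psi> (real k / real n) / real n)) n"

text \<open>Without kicks the product matrix is diagonal, and with q = exp(\<omega>/2) the quotient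
  (a - d)/(a + d - 2) equals (q + 1/q)/(q - 1/q), the hyperbolic cotangent of \<omega>/2. The
  addition formula for cosh does the rest.\<close>

lemma bogoliubov_covariance_eq_green:
  assumes "\<omega> > 0"
  shows "1 / (2 * \<omega> * sinh (\<omega> / 2)) * cosh (\<omega> * \<bar>t - s\<bar> - \<omega> / 2) = green \<omega> (exp \<omega>) 0 0 (exp (- \<omega>)) t s"
proof -
  define q where "q = exp (\<omega> / 2)"
  have q: "q > 1" using assms by (simp add: q_def)
  have e: "exp \<omega> = q\<^sup>2" "exp (- \<omega>) = 1 / q\<^sup>2" "sinh (\<omega> / 2) = (q - 1 / q) / 2" "cosh (\<omega> / 2) = (q + 1 / q) / 2"
    by (simp_all add: q_def power2_eq_square exp_add[symmetric] sinh_def cosh_def exp_minus inverse_eq_divide)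
  have c: "cosh (\<omega> * \<bar>t - s\<bar>) = (exp (\<omega> * (t - s)) + exp (\<omega> * (s - t))) / 2"
    by (cases "t \<ge> s") (auto simp: cosh_def abs_if algebra_simps)
  have qq: "q\<^sup>2 - 1 > 0" using q by (simp add: one_less_power)
  define E where "E = exp (\<omega> * (t - s)) + exp (\<omega> * (s - t))"
  define S where "S = sinh (\<omega> * \<bar>t - s\<bar>)"
  have "1 / (2 * \<omega> * sinh (\<omega> / 2)) * cosh (\<omega> * \<bar>t - s\<bar> - \<omega> / 2)
      = 1 / (\<omega> * (q - 1 / q)) * (E / 2 * ((q + 1 / q) / 2) - S * ((q - 1 / q) / 2))"
    unfolding cosh_diff c e E_def S_def by simp
  also have "\<dots> = E / (4 * \<omega>) * ((q + 1 / q) / (q - 1 / q)) - S / (2 * \<omega>)"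
  proof -
    have "q - 1 / q \<noteq> 0" using q qq by (simp add: field_simps power2_eq_square)
    moreover have "1 / (\<omega> * r) * (E / 2 * (m / 2) - S * (r / 2)) = E / (4 * \<omega>) * (m / r) - S / (2 * \<omega>)"
      if "r \<noteq> 0" for r m :: real
      using assms that by (simp add: field_simps)
    ultimately show ?thesis by blast
  qed
  also have "(q + 1 / q) / (q - 1 / q) = (q\<^sup>2 - 1 / q\<^sup>2) / (q\<^sup>2 + 1 / q\<^sup>2 - 2)"
  proof -
    have nz: "q - 1 / q \<noteq> 0" using q qq by (simp add: field_simps power2_eq_square)
    have "q\<^sup>2 - 1 / q\<^sup>2 = (q + 1 / q) * (q - 1 / q)" "q\<^sup>2 + 1 / q\<^sup>2 - 2 = (q - 1 / q) * (q - 1 / q)"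
      using q by (simp_all add: power2_eq_square algebra_simps)
    then show ?thesis using nz by simp
  qed
  finally show ?thesis
    unfolding green_def e E_def[symmetric] S_def[symmetric] by simp
qed

text \<open>Each weight multiplies the mass by 1/sqrt(1 + w R k k) and the discriminant by 1 + w R k
  k, so the square of the mass times the discriminant keeps its initial value, the discriminant of
  the free shift.\<close>

lemma bogoliubov_discrete_laplace:
  fixes w p :: "nat \<Rightarrow> real"
  assumes "prob_space M" and \<omega>: "\<omega> > 0" and Y: "bogoliubov_process M \<omega> Y"
    and p: "\<And>i. i < n \<Longrightarrow> p i \<in> {0..1}" "\<And>i j. i < j \<Longrightarrow> j < n \<Longrightarrow> p i < p j"
    and w: "\<And>i. i < n \<Longrightarrow> w i \<ge> 0"
  shows "(LINT x|M. exp (- (\<Sum>k<n. w k * (Y (p k) x)\<^sup>2) / 2))\<^sup>2 * discr \<omega> p w n = exp \<omega> + exp (- \<omega>) - 2"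
proof -
  interpret prob_space M by fact
  have inj: "inj_on p {..<n}"
    by (rule inj_onI) (metis p(2) lessThan_iff less_irrefl linorder_neqE_nat)
  have sub: "p ` {..<n} \<subseteq> {0..1}" using p(1) by auto
  have G: "gaussian_process M {0..1} Y" and mean: "\<And>t. t \<in> {0..1} \<Longrightarrow> (LINT x|M. Y t x) = 0"
    and cov: "\<And>t s. t \<in> {0..1} \<Longrightarrow> s \<in> {0..1} \<Longrightarrow> (LINT x|M. Y t x * Y s x) = green \<omega> (exp \<omega>) 0 0 (exp (- \<omega>)) t s"
    using Y unfolding bogoliubov_process_def bogoliubov_covariance_eq_green[OF \<omega>] by auto
  have meas: "Y (p i) \<in> borel_measurable M" if "i < n" for i
    by (rule bogoliubov_process_measurable[OF Y p(1)[OF that]])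
  define a where "a k = exp \<omega> * fst (kicks \<omega> p w k (1, 0))" for k
  define b where "b k = exp (- \<omega>) * fst (kicks \<omega> p w k (0, 1))" for k
  define c where "c k = exp \<omega> * snd (kicks \<omega> p w k (1, 0))" for k
  define d where "d k = exp (- \<omega>) * snd (kicks \<omega> p w k (0, 1))" for k
  define D where "D k = a k + d k - 2" for k
  define R where "R k i j = green \<omega> (a k) (b k) (c k) (d k) (p i) (p j)" for k i j
  define g where "g k x = exp (- (\<Sum>i<k. w i * (Y (p i) x)\<^sup>2) / 2)" for k x
  have D0: "D 0 > 0"
  proof -
    have "D 0 = (exp (\<omega> / 2) - exp (- \<omega> / 2))\<^sup>2"
      by (simp add: D_def a_def d_def power2_eq_square algebra_simps exp_add[symmetric])
    then show ?thesis using \<omega> by simp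
  qed
  \<comment> \<open>Only coefficient vectors vanishing below \<open>k\<close> are controlled: after
    \<open>k\<close> kicks \<open>green\<close> describes the covariance between times beyond the
    last kick, and these are the only times that the remaining weights involve.
    \<open>D k > 0\<close> is carried along because \<open>D k\<close> is a denominator of
    \<open>green\<close>.\<close>
  have "a k * d k - b k * c k = 1 \<and> D k > 0 \<and>
    (\<forall>e. (\<forall>i<k. e i = 0) \<longrightarrow> (LINT x|M. iexp (\<Sum>i<n. e i * Y (p i) x) * complex_of_real (g k x))
        = of_real (sqrt (D 0 / D k) * exp (- (\<Sum>i<n. \<Sum>j<n. e i * e j * R k i j) / 2)))"
    if "k \<le> n" for k
    using that
  proof (induction k)
    case 0
    have "a 0 * d 0 - b 0 * c 0 = 1" by (simp add: a_def b_def c_def d_def exp_add[symmetric])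
    moreover have "(LINT x|M. iexp (\<Sum>i<n. e i * Y (p i) x) * complex_of_real (g 0 x))
        = of_real (sqrt (D 0 / D 0) * exp (- (\<Sum>i<n. \<Sum>j<n. e i * e j * R 0 i j) / 2))" for e
    proof -
      have "(\<Sum>i<n. \<Sum>j<n. e i * e j * (LINT x|M. Y (p i) x * Y (p j) x)) = (\<Sum>i<n. \<Sum>j<n. e i * e j * R 0 i j)"
        by (intro sum.cong refl) (subst cov, auto simp: p(1)[simplified] R_def a_def b_def c_def d_def)
      then show ?thesis
        using gaussian_process_char[OF assms(1) G mean sub inj, of e] D0 by (simp add: g_def)
    qed
    ultimately show ?case using D0 by blast
  next
    case (Suc k)
    then have k: "k < n" and det: "a k * d k - b k * c k = 1" and Dk: "D k > 0"
      and IH: "\<And>e. (\<forall>i<k. e i = 0) \<Longrightarrow> (LINT x|M. iexp (\<Sum>i<n. e i * Y (p i) x) * complex_of_real (g k x))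
        = of_real (sqrt (D 0 / D k) * exp (- (\<Sum>i<n. \<Sum>j<n. e i * e j * R k i j) / 2))"
      by auto
    have g_meas: "g k \<in> borel_measurable M"
    proof -
      have [measurable]: "(\<lambda>x. \<Sum>i<k. w i * (Y (p i) x)\<^sup>2) \<in> borel_measurable M"
        using k by (intro borel_measurable_sum borel_measurable_times borel_measurable_power meas borel_measurable_const) auto
      show ?thesis unfolding g_def by measurable
    qed
    have g01: "0 \<le> g k x \<and> g k x \<le> 1" for x
      unfolding g_def using k w by (auto intro!: sum_nonneg)
    have sym: "R k i j = R k j i" for i j by (simp add: R_def green_commute)
    have Lp: "sqrt (D 0 / D k) > 0" using D0 Dk by simp
    note step = gaussian_char_weighted_step[of M n "\<lambda>i. Y (p i)" "g k" "w k" k "R k" "sqrt (D 0 / D k)",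
        OF assms(1) meas g_meas g01 w[OF k] k sym Lp IH]
    have Rkk: "R k k k \<ge> 0" by (rule step(1))
    have W: "1 + w k * R k k k > 0" using w[OF k] Rkk by (simp add: add_pos_nonneg)
    have upd: "a (Suc k) = a k + exp (- \<omega> * p k) * (w k / (2 * \<omega>) * (exp (\<omega> * p k) * a k + exp (- \<omega> * p k) * c k))"
      "b (Suc k) = b k + exp (- \<omega> * p k) * (w k / (2 * \<omega>) * (exp (\<omega> * p k) * b k + exp (- \<omega> * p k) * d k))"
      "c (Suc k) = c k - exp (\<omega> * p k) * (w k / (2 * \<omega>) * (exp (\<omega> * p k) * a k + exp (- \<omega> * p k) * c k))"
      "d (Suc k) = d k - exp (\<omega> * p k) * (w k / (2 * \<omega>) * (exp (\<omega> * p k) * b k + exp (- \<omega> * p k) * d k))"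
      using \<omega> by (simp_all add: a_def b_def c_def d_def Let_def algebra_simps add_divide_distrib)
    note gk = green_kick[OF \<omega> det Dk[unfolded D_def] W[unfolded R_def], folded upd]
    have DS: "D (Suc k) = D k * (1 + w k * R k k k)"
      using gk(1) by (simp add: D_def R_def)
    have "a (Suc k) * d (Suc k) - b (Suc k) * c (Suc k) = 1" by (rule gk(2))
    moreover have "D (Suc k) > 0" unfolding DS using Dk W by simp
    moreover have "(LINT x|M. iexp (\<Sum>i<n. e i * Y (p i) x) * complex_of_real (g (Suc k) x))
        = of_real (sqrt (D 0 / D (Suc k)) * exp (- (\<Sum>i<n. \<Sum>j<n. e i * e j * R (Suc k) i j) / 2))"
      if e: "\<forall>i<Suc k. e i = 0" for e
    proof -
      have gS: "g (Suc k) x = g k x * exp (- w k * (Y (p k) x)\<^sup>2 / 2)" for x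
        unfolding g_def by (simp add: exp_add[symmetric] add_divide_distrib)
      \<comment> \<open>The update of the Green function holds for times from \<open>p k\<close> on;
        a pair with an index at most \<open>k\<close> is annihilated by \<open>e\<close>.\<close>
      have "e i * e j * (R k i j - w k * R k i k * R k j k / (1 + w k * R k k k)) = e i * e j * R (Suc k) i j"
        if "i < n" "j < n" for i j
      proof (cases "k < i \<and> k < j")
        case True
        then have "p k \<le> p i" "p k \<le> p j" using p(2) that by (auto intro: less_imp_le)
        then show ?thesis using gk(3) by (simp add: R_def)
      next
        case False
        then have "e i = 0 \<or> e j = 0" using e by (auto simp: not_less less_Suc_eq_le)
        then show ?thesis by auto
      qed
      then have "(\<Sum>i<n. \<Sum>j<n. e i * e j * (R k i j - w k * R k i k * R k j k / (1 + w k * R k k k)))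
        = (\<Sum>i<n. \<Sum>j<n. e i * e j * R (Suc k) i j)" by (intro sum.cong refl) auto
      moreover have "sqrt (D 0 / D k) / sqrt (1 + w k * R k k k) = sqrt (D 0 / D (Suc k))"
        unfolding DS by (simp add: real_sqrt_divide real_sqrt_mult)
      ultimately show ?thesis using step(2)[of e] e by (simp add: gS)
    qed
    ultimately show ?case by blast
  qed
  from this[of n] have Dn: "D n > 0" and H: "(LINT x|M. complex_of_real (g n x)) = of_real (sqrt (D 0 / D n))"
    by (auto dest!: spec[of _ "\<lambda>_. 0"])
  have "(LINT x|M. g n x) = sqrt (D 0 / D n)"
    using H by (simp only: integral_complex_of_real of_real_eq_iff)
  moreover have "discr \<omega> p w n = D n" by (simp add: discr_def D_def a_def d_def)
  moreover have "D 0 = exp \<omega> + exp (- \<omega>) - 2" by (simp add: D_def a_def d_def)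
  ultimately show ?thesis using Dn D0 by (simp add: g_def)
qed

section \<open>Passage to complex parameters\<close>

text \<open>Differentiation under the integral by dominated convergence. On the half plane Re z > c
  with c = Re s / 2, the derivative in z is at most q exp(-c q) \<le> 1/c in modulus, so the
  difference quotients have a constant bound, which is integrable on a probability space.\<close>

lemma laplace_transform_holomorphic:
  fixes Q :: "'a \<Rightarrow> real"
  assumes "prob_space M" and Q[measurable]: "Q \<in> borel_measurable M" and Q0: "\<And>x. x \<in> space M \<Longrightarrow> Q x \<ge> 0"
  shows "(\<lambda>s. LINT x|M. exp (- s * complex_of_real (Q x))) holomorphic_on {s. Re s > 0}"
proof -
  interpret prob_space M by fact
  let ?L = "\<lambda>s. LINT x|M. exp (- s * complex_of_real (Q x))"
  have int: "integrable M (\<lambda>x. exp (- s * complex_of_real (Q x)))" if "Re s > 0" for s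
    proof (rule integrable_const_bound[where B=1])
    show "AE x in M. norm (exp (- s * complex_of_real (Q x))) \<le> 1"
      by (rule AE_I2) (use Q0 that in simp)
  qed measurable
  have "(?L has_field_derivative (LINT x|M. - complex_of_real (Q x) * exp (- s * complex_of_real (Q x)))) (at s)"
    if s: "Re s > 0" for s
  proof -
    define c where "c = Re s / 2"
    have c: "c > 0" using s by (simp add: c_def)
    define S where "S = {z. Re z > c}"
    have opS: "open S" and sS: "s \<in> S" and convS: "convex S"
      using s by (simp_all only: S_def open_halfspace_Re_gt convex_halfspace_Re_gt) (simp add: c_def)
    have bd: "norm (- complex_of_real q * exp (- z * complex_of_real q)) \<le> 1 / c" if "z \<in> S" "q \<ge> 0" for z q
    proof -
      have "norm (- complex_of_real q * exp (- z * complex_of_real q)) = q * exp (- (Re z * q))"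
        using that by (simp only: norm_mult norm_minus_cancel norm_exp_eq_Re) simp
      also have "\<dots> \<le> q * exp (- (c * q))"
        using that by (intro mult_left_mono) (simp_all add: S_def mult_right_mono)
      also have "\<dots> \<le> 1 / c"
      proof -
        have "c * q \<le> exp (c * q)" using exp_ge_add_one_self[of "c * q"] by linarith
        then have "c * q * exp (- (c * q)) \<le> 1" by (simp add: exp_minus field_simps)
        then show ?thesis using c by (simp add: field_simps)
      qed
      finally show ?thesis .
    qed
    have lip: "norm (exp (- z * complex_of_real q) - exp (- s * complex_of_real q)) \<le> 1 / c * norm (z - s)"
      if "z \<in> S" "q \<ge> 0" for z q
    proof (rule field_differentiable_bound[OF convS])
      show "((\<lambda>z. exp (- z * complex_of_real q)) has_field_derivative - complex_of_real q * exp (- u * complex_of_real q)) (at u within S)" for u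
        by (rule derivative_eq_intros refl | simp)+
      show "norm (- complex_of_real q * exp (- u * complex_of_real q)) \<le> 1 / c" if "u \<in> S" for u
        using that \<open>q \<ge> 0\<close> by (rule bd)
      show "z \<in> S" "s \<in> S" by fact+
    qed
    have "((\<lambda>z. (?L z - ?L s) / (z - s)) \<longlongrightarrow> (LINT x|M. - complex_of_real (Q x) * exp (- s * complex_of_real (Q x)))) (at s within S)"
      unfolding tendsto_at_iff_sequentially
    proof (intro allI impI)
      fix X assume X: "\<forall>i. X i \<in> S - {s}" "X \<longlonglongrightarrow> s"
      let ?f = "\<lambda>n x. (exp (- X n * complex_of_real (Q x)) - exp (- s * complex_of_real (Q x))) / (X n - s)"
      have "(\<lambda>n. LINT x|M. ?f n x) \<longlonglongrightarrow> (LINT x|M. - complex_of_real (Q x) * exp (- s * complex_of_real (Q x)))"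
      proof (rule integral_dominated_convergence[where w="\<lambda>_. 1 / c"])
        show "AE x in M. norm (?f n x) \<le> 1 / c" for n
        proof (rule AE_I2)
          fix x assume "x \<in> space M"
          then have "norm (exp (- X n * complex_of_real (Q x)) - exp (- s * complex_of_real (Q x))) \<le> 1 / c * norm (X n - s)"
            using X Q0 by (intro lip) auto
          moreover have "norm (X n - s) > 0" using X by auto
          ultimately show "norm (?f n x) \<le> 1 / c"
            by (simp only: norm_divide pos_divide_le_eq)
        qed
        have "((\<lambda>z. exp (- z * complex_of_real q)) has_field_derivative - complex_of_real q * exp (- s * complex_of_real q)) (at s within S)" for q
          by (rule derivative_eq_intros refl | simp)+
        then have D: "((\<lambda>z. (exp (- z * complex_of_real q) - exp (- s * complex_of_real q)) / (z - s))
            \<longlongrightarrow> - complex_of_real q * exp (- s * complex_of_real q)) (at s within S)" for q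
          by (simp only: has_field_derivative_iff)
        have "(\<lambda>n. (exp (- X n * complex_of_real q) - exp (- s * complex_of_real q)) / (X n - s))
            \<longlonglongrightarrow> - complex_of_real q * exp (- s * complex_of_real q)" for q
          using tendsto_at_iff_sequentially[THEN iffD1, rule_format, OF D[of q], of X] X
          by (simp only: comp_def Ball_def)
        then show "AE x in M. (\<lambda>n. ?f n x) \<longlonglongrightarrow> - complex_of_real (Q x) * exp (- s * complex_of_real (Q x))"
          by (intro AE_I2)
        show "(\<lambda>x. - complex_of_real (Q x) * exp (- s * complex_of_real (Q x))) \<in> borel_measurable M" by measurable
        show "?f n \<in> borel_measurable M" for n by measurable
        show "integrable M (\<lambda>_. 1 / c)" by simp
      qed
      moreover have "(LINT x|M. ?f n x) = (?L (X n) - ?L s) / (X n - s)" for n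
      proof -
        have "X n \<in> S" using X by auto
        then have "Re (X n) > 0" using c by (simp add: S_def)
        then show ?thesis using int s by simp
      qed
      ultimately show "((\<lambda>z. (?L z - ?L s) / (z - s)) \<circ> X) \<longlonglongrightarrow> (LINT x|M. - complex_of_real (Q x) * exp (- s * complex_of_real (Q x)))"
        unfolding comp_def by (simp only:)
    qed
    then show ?thesis
      by (simp only: has_field_derivative_iff at_within_open[OF sS opS])
  qed
  then show ?thesis
    unfolding holomorphic_on_def by (auto simp: field_differentiable_def intro!: exI dest: has_field_derivative_at_within)
qed

text \<open>The identity theorem on a connected half plane, with the positive reals accumulating at
  1. It is the bridge from computations with real parameters to complex ones.\<close>

lemma halfplane_identity:
  assumes "f holomorphic_on {s. Re s > 0}" "g holomorphic_on {s. Re s > 0}"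
    and eq: "\<And>x::real. x > 0 \<Longrightarrow> f (of_real x) = g (of_real x)" and s: "Re s > 0"
  shows "f s = g s"
proof -
  have "f s - g s = 0"
  proof (rule analytic_continuation[where f="\<lambda>s. f s - g s" and w=s and S="{s. Re s > 0}" and U="complex_of_real ` {0<..}" and \<xi>=1])
    show "(1::complex) islimpt complex_of_real ` {0<..}"
      unfolding islimpt_sequential
    proof (intro exI conjI allI)
      show "complex_of_real (1 + inverse (real (Suc n))) \<in> complex_of_real ` {0<..} - {1}" for n
      proof -
        have "1 + inverse (real (Suc n)) > 0" "1 + inverse (real (Suc n)) \<noteq> 1" by (auto simp: add_pos_pos)
        then show ?thesis by (metis DiffI image_eqI greaterThan_iff of_real_eq_1_iff singletonD)
      qed
      have "(\<lambda>n. complex_of_real (1 + inverse (real (Suc n)))) \<longlonglongrightarrow> of_real (1 + 0)"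
        by (intro tendsto_of_real tendsto_add tendsto_const LIMSEQ_inverse_real_of_nat)
      then show "(\<lambda>n. complex_of_real (1 + inverse (real (Suc n)))) \<longlonglongrightarrow> 1" by simp
    qed
  qed (use assms in \<open>auto intro!: holomorphic_intros simp: open_halfspace_Re_gt convex_connected convex_halfspace_Re_gt\<close>)
  then show ?thesis by simp
qed

lemma kicks_of_real:
  "kicks \<omega> p (\<lambda>k. complex_of_real (w k)) k (of_real x, of_real y)
    = (of_real (fst (kicks \<omega> p w k (x, y))), of_real (snd (kicks \<omega> p w k (x, y))))"
  by (induction k) (auto simp: Let_def)

lemma kicks_holomorphic:
  "(\<lambda>s. fst (kicks \<omega> p (\<lambda>k. s * complex_of_real (v k)) k x)) holomorphic_on S \<and>
   (\<lambda>s. snd (kicks \<omega> p (\<lambda>k. s * complex_of_real (v k)) k x)) holomorphic_on S"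
proof (induction k)
  case 0
  then show ?case by simp
next
  case (Suc k)
  let ?v = "\<lambda>s. s * complex_of_real (v k) * (fst (kicks \<omega> p (\<lambda>k. s * complex_of_real (v k)) k x) * of_real (exp (\<omega> * p k))
      + snd (kicks \<omega> p (\<lambda>k. s * complex_of_real (v k)) k x) * of_real (exp (- \<omega> * p k))) * (1 / of_real (2 * \<omega>))"
  have "?v holomorphic_on S"
    using Suc by (intro holomorphic_on_mult holomorphic_on_add holomorphic_on_const holomorphic_on_ident) blast+
  then have "(\<lambda>s. fst (kicks \<omega> p (\<lambda>k. s * complex_of_real (v k)) k x) + ?v s * of_real (exp (- \<omega> * p k))) holomorphic_on S"
    "(\<lambda>s. snd (kicks \<omega> p (\<lambda>k. s * complex_of_real (v k)) k x) - ?v s * of_real (exp (\<omega> * p k))) holomorphic_on S"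
    using Suc by (intro holomorphic_on_mult[of ?v] holomorphic_on_add holomorphic_on_diff holomorphic_on_const; blast)+
  then show ?case by (simp add: Let_def)
qed

text \<open>For complex s the factors are no longer Gaussian weights, but both sides are
  holomorphic, the discriminant being a polynomial in s, and they agree for real s > 0.\<close>

lemma bogoliubov_discrete_laplace_complex:
  fixes v p :: "nat \<Rightarrow> real"
  assumes "prob_space M" and \<omega>: "\<omega> > 0" and Y: "bogoliubov_process M \<omega> Y"
    and p: "\<And>i. i < n \<Longrightarrow> p i \<in> {0..1}" "\<And>i j. i < j \<Longrightarrow> j < n \<Longrightarrow> p i < p j"
    and v: "\<And>i. i < n \<Longrightarrow> v i \<ge> 0" and s: "Re s > 0"
  shows "(LINT x|M. exp (- s * complex_of_real (\<Sum>k<n. v k * (Y (p k) x)\<^sup>2)))\<^sup>2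
     * discr \<omega> p (\<lambda>k. 2 * s * complex_of_real (v k)) n = of_real (exp \<omega> + exp (- \<omega>) - 2)"
proof -
  have meas: "Y (p i) \<in> borel_measurable M" if "i < n" for i
    by (rule bogoliubov_process_measurable[OF Y p(1)[OF that]])
  have Q: "(\<lambda>x. \<Sum>k<n. v k * (Y (p k) x)\<^sup>2) \<in> borel_measurable M"
    by (intro borel_measurable_sum borel_measurable_times borel_measurable_power meas borel_measurable_const) auto
  show ?thesis
  proof (rule halfplane_identity[OF _ _ _ s, where g="\<lambda>_. of_real (exp \<omega> + exp (- \<omega>) - 2)"])
    have "(\<lambda>s. discr \<omega> p (\<lambda>k. 2 * s * complex_of_real (v k)) n) holomorphic_on {s. Re s > 0}"
    proof -
      have "(\<lambda>k. 2 * s * complex_of_real (v k)) = (\<lambda>k. s * complex_of_real (2 * v k))" for s by auto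
      then show ?thesis
        unfolding discr_def using kicks_holomorphic[of \<omega> p "\<lambda>k. 2 * v k" n]
        by (simp only:) (intro holomorphic_on_mult holomorphic_on_add holomorphic_on_diff holomorphic_on_const; blast)
    qed
    then show "(\<lambda>s. (LINT x|M. exp (- s * complex_of_real (\<Sum>k<n. v k * (Y (p k) x)\<^sup>2)))\<^sup>2
       * discr \<omega> p (\<lambda>k. 2 * s * complex_of_real (v k)) n) holomorphic_on {s. Re s > 0}"
      by (intro holomorphic_intros laplace_transform_holomorphic[OF assms(1) Q]) (auto intro!: sum_nonneg mult_nonneg_nonneg v)
  next
    fix r :: real assume r: "r > 0"
    \<comment> \<open>The real identity uses factors exp(- w y^2 / 2), so a Laplace parameter
      \<open>r\<close> corresponds to the weights \<open>2 * r * v k\<close>.\<close>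
    have "(LINT x|M. exp (- (\<Sum>k<n. 2 * r * v k * (Y (p k) x)\<^sup>2) / 2))\<^sup>2 * discr \<omega> p (\<lambda>k. 2 * r * v k) n
      = exp \<omega> + exp (- \<omega>) - 2"
      by (rule bogoliubov_discrete_laplace[OF assms(1) \<omega> Y]) (use p v r in auto)
    moreover have "(\<Sum>k<n. 2 * r * v k * (Y (p k) x)\<^sup>2) / 2 = r * (\<Sum>k<n. v k * (Y (p k) x)\<^sup>2)" for x
      by (simp add: sum_distrib_left sum_divide_distrib mult.assoc)
    ultimately have R: "(LINT x|M. exp (- (r * (\<Sum>k<n. v k * (Y (p k) x)\<^sup>2))))\<^sup>2 * discr \<omega> p (\<lambda>k. 2 * r * v k) n
      = exp \<omega> + exp (- \<omega>) - 2" by simp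
    have "(LINT x|M. exp (- complex_of_real r * complex_of_real (\<Sum>k<n. v k * (Y (p k) x)\<^sup>2)))
      = (LINT x|M. complex_of_real (exp (- (r * (\<Sum>k<n. v k * (Y (p k) x)\<^sup>2)))))"
      by (intro Bochner_Integration.integral_cong refl) (simp only: exp_of_real[symmetric] of_real_mult of_real_minus mult_minus_left)
    moreover have "discr \<omega> p (\<lambda>k. 2 * complex_of_real r * complex_of_real (v k)) n = of_real (discr \<omega> p (\<lambda>k. 2 * r * v k) n)"
      using kicks_of_real[of \<omega> p "\<lambda>k. 2 * r * v k" n 1 0] kicks_of_real[of \<omega> p "\<lambda>k. 2 * r * v k" n 0 1]
      by (simp add: discr_def)
    ultimately show "(LINT x|M. exp (- complex_of_real r * complex_of_real (\<Sum>k<n. v k * (Y (p k) x)\<^sup>2)))\<^sup>2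
       * discr \<omega> p (\<lambda>k. 2 * complex_of_real r * complex_of_real (v k)) n = of_real (exp \<omega> + exp (- \<omega>) - 2)"
      using R by (simp only: integral_complex_of_real of_real_power[symmetric] of_real_mult[symmetric])
  qed (auto intro!: holomorphic_intros)
qed

section \<open>The continuum limit of the transfer matrices\<close>

text \<open>Local error of one Euler step: the mean value inequality for \<open>f\<close> minus a
  linear function with the slope of \<open>f\<close> at the left grid point.\<close>

lemma mesh_vector_derivative_bound:
  fixes f :: "real \<Rightarrow> 'b::real_normed_vector"
  assumes der: "\<And>t. t \<in> {0..1} \<Longrightarrow> (f has_vector_derivative f' t) (at t within {0..1})"
    and bd: "\<And>s t. s \<in> {0..1} \<Longrightarrow> t \<in> {0..1} \<Longrightarrow> \<bar>s - t\<bar> \<le> 1 / real n \<Longrightarrow> norm (f' s - f' t) \<le> e"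
    and k: "k < n"
  shows "norm (f (real (Suc k) / real n) - f (real k / real n) - (1 / real n) *\<^sub>R f' (real k / real n)) \<le> e / real n"
proof -
  define a where "a = real k / real n"
  define b where "b = real (Suc k) / real n"
  have n: "n > 0" using k by auto
  have ab: "0 \<le> a" "a \<le> b" "b \<le> 1" "b - a = 1 / real n"
    using k n by (auto simp: a_def b_def field_simps)
  define h where "h = (\<lambda>t. f t - t *\<^sub>R f' a)"
  have "norm (h b - h a) \<le> e * norm (b - a)"
  proof (rule differentiable_bound[of "{a..b}"])
    show "convex {a..b}" by simp
    fix t assume t: "t \<in> {a..b}"
    have "(h has_vector_derivative f' t - f' a) (at t within {a..b})"
      unfolding h_def
      by (rule derivative_eq_intros has_vector_derivative_within_subset[OF der[of t]] | use t ab in auto)+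
    then show "(h has_derivative (\<lambda>x. x *\<^sub>R (f' t - f' a))) (at t within {a..b})"
      by (simp add: has_vector_derivative_def)
    have "norm (f' t - f' a) \<le> e" using t ab by (intro bd) auto
    then show "onorm (\<lambda>x. x *\<^sub>R (f' t - f' a)) \<le> e"
      using onorm_scaleR_left_lemma[of "\<lambda>x::real. x" "f' t - f' a"] by (simp add: onorm_scaleR_left onorm_id)
  qed (use ab in auto)
  moreover have "h b - h a = f b - f a - (1 / real n) *\<^sub>R f' a"
    unfolding h_def ab(4)[symmetric] by (simp add: algebra_simps)
  ultimately show ?thesis using ab by (simp add: a_def b_def)
qed

lemma mesh_modulus:
  fixes f :: "real \<Rightarrow> 'b::metric_space"
  assumes "continuous_on {0..1} f" "e > 0"
  obtains N where "\<And>n s t. n \<ge> N \<Longrightarrow> s \<in> {0..1} \<Longrightarrow> t \<in> {0..1} \<Longrightarrow> \<bar>s - t\<bar> \<le> 1 / real n \<Longrightarrow> dist (f s) (f t) < e"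
    and "N > 0"
proof -
  have "uniformly_continuous_on {0..1} f"
    using assms by (intro compact_uniformly_continuous) auto
  then obtain d where d: "d > 0" "\<And>s t. s \<in> {0..1} \<Longrightarrow> t \<in> {0..1} \<Longrightarrow> dist s t < d \<Longrightarrow> dist (f s) (f t) < e"
    using \<open>e > 0\<close> unfolding uniformly_continuous_on_def by metis
  obtain N where N: "N > 0" "1 / real N < d" using nat_approx_posE[OF d(1)] by (metis zero_less_Suc)
  show ?thesis
  proof (rule that[of N])
    fix n s t assume "n \<ge> N" "s \<in> {0..1}" "t \<in> {0..1::real}" "\<bar>s - t\<bar> \<le> 1 / real n"
    moreover have "1 / real n \<le> 1 / real N" using N \<open>n \<ge> N\<close> by (intro divide_left_mono) auto
    ultimately show "dist (f s) (f t) < e" using N d(2)[of s t] by (simp add: dist_real_def)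
  qed (use N in auto)
qed

text \<open>The explicit Euler method with step 1/n: local errors e/n are amplified by a factor of
  at most 1 + |K|/n per step. It serves for the kicked transfer matrices and, with
  \<open>K = 0\<close>, for Riemann sums.\<close>

lemma euler_converges:
  fixes x :: "real \<Rightarrow> 'b::real_normed_vector" and A :: "real \<Rightarrow> 'b \<Rightarrow> 'b" and y :: "nat \<Rightarrow> nat \<Rightarrow> 'b"
  assumes der: "\<And>t. t \<in> {0..1} \<Longrightarrow> (x has_vector_derivative A t (x t)) (at t within {0..1})"
    and cont: "continuous_on {0..1} (\<lambda>t. A t (x t))"
    and lip: "\<And>t u v. t \<in> {0..1} \<Longrightarrow> norm (A t u - A t v) \<le> K * norm (u - v)"
    and y0: "\<And>n. y n 0 = x 0"
    and yS: "\<And>n k. k < n \<Longrightarrow> y n (Suc k) = y n k + (1 / real n) *\<^sub>R A (real k / real n) (y n k)"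
  shows "(\<lambda>n. y n n) \<longlonglongrightarrow> x 1"
proof (rule LIMSEQ_I)
  fix r :: real assume r: "r > 0"
  \<comment> \<open>Chosen so that the accumulated error \<open>e * exp \<bar>K\<bar>\<close> is
    r/2.\<close>
  define e where "e = r * exp (- \<bar>K\<bar>) / 2"
  have e: "e > 0" using r by (simp add: e_def)
  obtain N where N: "\<And>n s t. n \<ge> N \<Longrightarrow> s \<in> {0..1} \<Longrightarrow> t \<in> {0..1} \<Longrightarrow> \<bar>s - t\<bar> \<le> 1 / real n \<Longrightarrow> dist (A s (x s)) (A t (x t)) < e"
    and Np: "N > 0"
    using mesh_modulus[OF cont e] by metis
  have "norm (y n n - x 1) < r" if n: "n \<ge> N" for n
  proof -
    have n0: "n > 0" using n Np by simp
    have "norm (y n k - x (real k / real n)) \<le> e * (real k / real n) * (1 + \<bar>K\<bar> / real n) ^ k" if "k \<le> n" for k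
      using that
    proof (induction k)
      case 0
      then show ?case using y0 by simp
    next
      case (Suc k)
      let ?t = "real k / real n"
      let ?q = "1 + \<bar>K\<bar> / real n"
      have t: "?t \<in> {0..1}" using Suc n0 by auto
      have loc: "norm (x (real (Suc k) / real n) - x ?t - (1 / real n) *\<^sub>R A ?t (x ?t)) \<le> e / real n"
        by (rule mesh_vector_derivative_bound[OF der]) (use N[OF n] Suc in \<open>auto simp: dist_norm intro: less_imp_le\<close>)
      have "norm (A ?t (y n k) - A ?t (x ?t)) \<le> \<bar>K\<bar> * norm (y n k - x ?t)"
        by (rule order_trans[OF lip[OF t]]) (simp add: mult_right_mono)
      then have 1: "norm ((1 / real n) *\<^sub>R (A ?t (y n k) - A ?t (x ?t))) \<le> \<bar>K\<bar> / real n * norm (y n k - x ?t)"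
      proof -
        assume *: "norm (A ?t (y n k) - A ?t (x ?t)) \<le> \<bar>K\<bar> * norm (y n k - x ?t)"
        have "norm ((1 / real n) *\<^sub>R z) = norm z / real n" for z :: 'b by simp
        then show ?thesis using divide_right_mono[OF *, of "real n"] by simp
      qed
      have "y n (Suc k) - x (real (Suc k) / real n) = (y n k - x ?t) + (1 / real n) *\<^sub>R (A ?t (y n k) - A ?t (x ?t))
         - (x (real (Suc k) / real n) - x ?t - (1 / real n) *\<^sub>R A ?t (x ?t))"
        using Suc by (subst yS) (auto simp: algebra_simps)
      then have "norm (y n (Suc k) - x (real (Suc k) / real n)) \<le> norm (y n k - x ?t) + \<bar>K\<bar> / real n * norm (y n k - x ?t) + e / real n"
        using loc 1 by (smt (verit) norm_triangle_ineq norm_triangle_ineq4)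
      also have "\<dots> = ?q * norm (y n k - x ?t) + e / real n" by (simp add: algebra_simps)
      also have "\<dots> \<le> ?q * (e * ?t * ?q ^ k) + e / real n * ?q ^ Suc k"
      proof (rule add_mono)
        show "?q * norm (y n k - x ?t) \<le> ?q * (e * ?t * ?q ^ k)"
          using Suc by (intro mult_left_mono) auto
        have "1 \<le> ?q ^ Suc k" by (intro one_le_power) simp
        then show "e / real n \<le> e / real n * ?q ^ Suc k"
          using e by (metis divide_nonneg_nonneg less_imp_le mult.right_neutral mult_left_mono of_nat_0_le_iff)
      qed
      also have "\<dots> = e * (real (Suc k) / real n) * ?q ^ Suc k"
        by (simp add: add_divide_distrib algebra_simps)
      finally show ?case .
    qed
    from this[of n] have "norm (y n n - x 1) \<le> e * (1 + \<bar>K\<bar> / real n) ^ n" using n0 by simp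
    also have "\<dots> \<le> e * exp \<bar>K\<bar>"
    proof -
      have "(1 + \<bar>K\<bar> / real n) ^ n \<le> exp (\<bar>K\<bar> / real n) ^ n"
        by (intro power_mono) (auto simp: add_nonneg_nonneg)
      also have "\<dots> = exp \<bar>K\<bar>" using n0 by (simp add: exp_of_nat_mult[symmetric])
      finally show ?thesis using e by simp
    qed
    also have "\<dots> = r / 2" by (simp add: e_def exp_minus)
    finally show ?thesis using r by simp
  qed
  then show "\<exists>no. \<forall>n\<ge>no. norm (y n n - x 1) < r" by blast
qed

text \<open>The integral up to t solves x' = f(t), and Euler's method for a right-hand side
  independent of the state is the left Riemann sum.\<close>

lemma riemann_sum_tendsto_integral:
  fixes f :: "real \<Rightarrow> real"
  assumes cont: "continuous_on {0..1} f"
  shows "(\<lambda>n. (\<Sum>k<n. f (real k / real n) / real n)) \<longlonglongrightarrow> integral {0..1} f"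
proof -
  let ?x = "\<lambda>t. integral {0..t} f"
  let ?y = "\<lambda>n m. \<Sum>k<m. f (real k / real n) / real n"
  have "(\<lambda>n. ?y n n) \<longlonglongrightarrow> ?x 1"
  proof (rule euler_converges[where A="\<lambda>t _. f t" and K=0 and x="?x" and y="?y"])
    fix t :: real assume "t \<in> {0..1}"
    then show "(?x has_vector_derivative f t) (at t within {0..1})"
      using integral_has_vector_derivative[OF cont] by blast
  qed (use cont in auto)
  then show ?thesis by simp
qed

lemma kicks_linear:
  fixes u v :: complex
  shows "kicks \<omega> p w k (a * fst x + b * fst y, a * snd x + b * snd y)
    = (a * fst (kicks \<omega> p w k x) + b * fst (kicks \<omega> p w k y), a * snd (kicks \<omega> p w k x) + b * snd (kicks \<omega> p w k y))"
  by (induction k) (auto simp: Let_def algebra_simps add_divide_distrib)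

text \<open>Variation of constants: write f = \<alpha> exp(\<omega> t) + \<beta> exp(-\<omega> t),
  with f' as if \<alpha> and \<beta> were constant. Then f'' = (\<omega>^2 + \<zeta> \<psi>) f
  becomes a linear first order system driven by \<zeta> \<psi> alone, and a kick of weight \<zeta>
  \<psi> / n is exactly one Euler step of that system.\<close>

lemma kicks_tendsto_ode:
  fixes f f1 :: "real \<Rightarrow> complex" and \<psi> :: "real \<Rightarrow> real" and \<zeta> :: complex
  assumes \<omega>: "\<omega> > 0" and \<psi>: "continuous_on {0..1} \<psi>"
    and f: "\<And>t. t \<in> {0..1} \<Longrightarrow> (f has_vector_derivative f1 t) (at t within {0..1})"
    and f1: "\<And>t. t \<in> {0..1} \<Longrightarrow> (f1 has_vector_derivative (of_real (\<omega>\<^sup>2) + \<zeta> * of_real (\<psi> t)) * f t) (at t within {0..1})"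
  shows "(\<lambda>n. grid_kicks \<omega> \<psi> \<zeta> n n
        ((f 0 + f1 0 / of_real \<omega>) / 2, (f 0 - f1 0 / of_real \<omega>) / 2))
    \<longlonglongrightarrow> ((f 1 + f1 1 / of_real \<omega>) * of_real (exp (- \<omega>)) / 2, (f 1 - f1 1 / of_real \<omega>) * of_real (exp \<omega>) / 2)"
proof -
  define v where "v t x = \<zeta> * of_real (\<psi> t) * (fst x * of_real (exp (\<omega> * t)) + snd x * of_real (exp (- \<omega> * t))) / of_real (2 * \<omega>)"
    for t and x :: "complex \<times> complex"
  define A where "A t x = (v t x * of_real (exp (- \<omega> * t)), - (v t x * of_real (exp (\<omega> * t))))" for t and x :: "complex \<times> complex"
  define x where "x t = ((f t + f1 t / of_real \<omega>) * of_real (exp (- \<omega> * t)) / 2, (f t - f1 t / of_real \<omega>) * of_real (exp (\<omega> * t)) / 2)" for t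
  have fx: "fst (x t) * of_real (exp (\<omega> * t)) + snd (x t) * of_real (exp (- \<omega> * t)) = f t" for t
  proof -
    have "complex_of_real (exp (- \<omega> * t)) * of_real (exp (\<omega> * t)) = 1"
      by (simp only: of_real_mult[symmetric] exp_add[symmetric]) simp
    then show ?thesis by (simp add: x_def field_simps)
  qed
  have vx: "v t (x t) = \<zeta> * of_real (\<psi> t) * f t / of_real (2 * \<omega>)" for t
    by (simp only: v_def fx)
  have contf: "continuous_on {0..1} f" using f by (rule continuous_on_vector_derivative)
  obtain B where B: "\<And>t. t \<in> {0..1} \<Longrightarrow> \<bar>\<psi> t\<bar> \<le> B"
  proof -
    have "bounded (\<psi> ` {0..1})"
      by (rule compact_imp_bounded[OF compact_continuous_image[OF \<psi> compact_Icc]])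
    then obtain B where "\<forall>x\<in>\<psi> ` {0..1}. norm x \<le> B" unfolding bounded_iff by blast
    then show thesis using that[of B] by simp
  qed
  have B0: "B \<ge> 0" using B[of 0] by auto
  have "(\<lambda>n. grid_kicks \<omega> \<psi> \<zeta> n n (x 0)) \<longlonglongrightarrow> x 1"
  \<comment> \<open>Both exponentials are bounded by \<open>exp \<omega>\<close> on [0,1]. The bound
    enters twice in the Lipschitz constant: once where \<open>f\<close> is read off the state and
    once where the kick is fed back.\<close>
  proof (rule euler_converges[where A=A and x=x and K="norm \<zeta> * B * 4 * exp \<omega> * exp \<omega> / (2 * \<omega>)"
      and y="\<lambda>n k. grid_kicks \<omega> \<psi> \<zeta> n k (x 0)"])
    fix t :: real assume t: "t \<in> {0..1}"
    have e: "((\<lambda>t. complex_of_real (exp (c * t))) has_vector_derivative of_real (c * exp (c * t))) (at t within {0..1})" for c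
      by (auto intro!: derivative_eq_intros simp: has_real_derivative_iff_has_vector_derivative[symmetric])
    have a: "((\<lambda>t. (f t + f1 t / of_real \<omega>) * of_real (exp (- \<omega> * t)) / 2) has_vector_derivative fst (A t (x t))) (at t within {0..1})"
      by (rule derivative_eq_intros f[OF t] f1[OF t] e refl | simp)+
        (use \<omega> in \<open>simp add: A_def vx field_simps power2_eq_square\<close>)
    have b: "((\<lambda>t. (f t - f1 t / of_real \<omega>) * of_real (exp (\<omega> * t)) / 2) has_vector_derivative snd (A t (x t))) (at t within {0..1})"
      by (rule derivative_eq_intros f[OF t] f1[OF t] e refl | simp)+
        (use \<omega> in \<open>simp add: A_def vx field_simps power2_eq_square\<close>)
    show "(x has_vector_derivative A t (x t)) (at t within {0..1})"
      using has_vector_derivative_Pair[OF a b] by (simp add: x_def[abs_def])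
  next
    show "continuous_on {0..1} (\<lambda>t. A t (x t))"
      unfolding A_def vx using \<omega> by (intro continuous_intros contf \<psi>) auto
  next
    fix t :: real and y z assume t: "t \<in> {0..1}"
    have ex: "exp (\<omega> * t) \<le> exp \<omega>" "exp (- \<omega> * t) \<le> exp \<omega>"
      using t \<omega> by (auto simp: mult_left_le intro: order_trans[of _ 0])
    have vd: "v t y - v t z = v t (y - z)" by (simp add: v_def algebra_simps diff_divide_distrib)
    have "norm (A t y - A t z) \<le> norm ((v t y - v t z) * of_real (exp (- \<omega> * t))) + norm ((v t y - v t z) * of_real (exp (\<omega> * t)))"
    proof -
      have "A t y - A t z = ((v t y - v t z) * of_real (exp (- \<omega> * t)), - ((v t y - v t z) * of_real (exp (\<omega> * t))))"
        by (simp add: A_def left_diff_distrib)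
      then show ?thesis
        using norm_Pair_le[of "(v t y - v t z) * of_real (exp (- \<omega> * t))" "- ((v t y - v t z) * of_real (exp (\<omega> * t)))"]
        by (simp only: norm_minus_cancel)
    qed
    also have "\<dots> \<le> norm (v t (y - z)) * exp \<omega> + norm (v t (y - z)) * exp \<omega>"
      unfolding vd using ex by (intro add_mono) (auto simp: norm_mult intro!: mult_left_mono)
    also have "\<dots> = norm (v t (y - z)) * (2 * exp \<omega>)" by simp
    also have "\<dots> \<le> (norm \<zeta> * B * (2 * exp \<omega> * norm (y - z)) / (2 * \<omega>)) * (2 * exp \<omega>)"
    proof (intro mult_right_mono)
      have "norm (fst (y - z) * complex_of_real (exp (\<omega> * t)) + snd (y - z) * complex_of_real (exp (- \<omega> * t)))
        \<le> norm (fst (y - z)) * exp (\<omega> * t) + norm (snd (y - z)) * exp (- \<omega> * t)"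
        by (rule order_trans[OF norm_triangle_ineq]) (simp add: norm_mult)
      also have "\<dots> \<le> norm (y - z) * exp \<omega> + norm (y - z) * exp \<omega>"
        using ex norm_fst_le[of "fst (y - z)" "snd (y - z)"] norm_snd_le[of "snd (y - z)" "fst (y - z)"]
        by (intro add_mono mult_mono) (simp_all only: prod.collapse norm_ge_zero exp_ge_zero)
      finally have "norm (fst (y - z) * complex_of_real (exp (\<omega> * t)) + snd (y - z) * complex_of_real (exp (- \<omega> * t))) \<le> 2 * exp \<omega> * norm (y - z)"
        by simp
      moreover have "norm (\<zeta> * complex_of_real (\<psi> t)) \<le> norm \<zeta> * B"
        using B[OF t] by (simp add: norm_mult mult_left_mono)
      ultimately have "norm (\<zeta> * complex_of_real (\<psi> t) * (fst (y - z) * complex_of_real (exp (\<omega> * t)) + snd (y - z) * complex_of_real (exp (- \<omega> * t))))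
         \<le> norm \<zeta> * B * (2 * exp \<omega> * norm (y - z))"
        unfolding norm_mult[of "\<zeta> * complex_of_real (\<psi> t)"] using B0 by (intro mult_mono) auto
      then show "norm (v t (y - z)) \<le> norm \<zeta> * B * (2 * exp \<omega> * norm (y - z)) / (2 * \<omega>)"
        unfolding v_def norm_divide norm_of_real using \<omega>
        by (simp only: abs_of_pos mult_pos_pos zero_less_numeral) (rule divide_right_mono, auto)
    qed auto
    also have "\<dots> = norm \<zeta> * B * 4 * exp \<omega> * exp \<omega> / (2 * \<omega>) * norm (y - z)" by simp
    finally show "norm (A t y - A t z) \<le> norm \<zeta> * B * 4 * exp \<omega> * exp \<omega> / (2 * \<omega>) * norm (y - z)" .
  next
    fix n k :: nat assume "k < n"
    then show "grid_kicks \<omega> \<psi> \<zeta> n (Suc k) (x 0)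
      = grid_kicks \<omega> \<psi> \<zeta> n k (x 0)
        + (1 / real n) *\<^sub>R A (real k / real n) (grid_kicks \<omega> \<psi> \<zeta> n k (x 0))"
      by (simp add: Let_def A_def v_def scaleR_conv_of_real prod_eq_iff)
  qed simp
  then show ?thesis by (simp add: x_def)
qed

text \<open>The trace is written in an arbitrary pair of solutions with nonzero Wronskian, so that a
  growing and a decaying WKB solution can be inserted directly instead of the fundamental system at
  0.\<close>

lemma discr_tendsto_trace:
  fixes f f1 g g1 :: "real \<Rightarrow> complex" and \<psi> :: "real \<Rightarrow> real" and \<zeta> :: complex
  assumes \<omega>: "\<omega> > 0" and \<psi>: "continuous_on {0..1} \<psi>"
    and f: "\<And>t. t \<in> {0..1} \<Longrightarrow> (f has_vector_derivative f1 t) (at t within {0..1})"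
    and f1: "\<And>t. t \<in> {0..1} \<Longrightarrow> (f1 has_vector_derivative (of_real (\<omega>\<^sup>2) + \<zeta> * of_real (\<psi> t)) * f t) (at t within {0..1})"
    and g: "\<And>t. t \<in> {0..1} \<Longrightarrow> (g has_vector_derivative g1 t) (at t within {0..1})"
    and g1: "\<And>t. t \<in> {0..1} \<Longrightarrow> (g1 has_vector_derivative (of_real (\<omega>\<^sup>2) + \<zeta> * of_real (\<psi> t)) * g t) (at t within {0..1})"
    and W: "f 0 * g1 0 - f1 0 * g 0 \<noteq> 0"
  shows "(\<lambda>n. grid_discr \<omega> \<psi> \<zeta> n)
    \<longlonglongrightarrow> (f 1 * g1 0 - f1 1 * g 0 - g 1 * f1 0 + g1 1 * f 0) / (f 0 * g1 0 - f1 0 * g 0) - 2"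
proof -
  define K where "K n = grid_kicks \<omega> \<psi> \<zeta> n n" for n
  let ?w = "complex_of_real \<omega>"
  define a0 b0 c0 d0 where "a0 = (f 0 + f1 0 / ?w) / 2" and "b0 = (f 0 - f1 0 / ?w) / 2"
    and "c0 = (g 0 + g1 0 / ?w) / 2" and "d0 = (g 0 - g1 0 / ?w) / 2"
  define E where "E = a0 * d0 - b0 * c0"
  have E: "E = - (f 0 * g1 0 - f1 0 * g 0) / (2 * ?w)"
    using \<omega> by (simp add: E_def a0_def b0_def c0_def d0_def field_simps)
  have E0: "E \<noteq> 0" using W \<omega> unfolding E by auto
  have F: "(\<lambda>n. K n (a0, b0)) \<longlonglongrightarrow> ((f 1 + f1 1 / ?w) * of_real (exp (- \<omega>)) / 2, (f 1 - f1 1 / ?w) * of_real (exp \<omega>) / 2)"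
    unfolding K_def a0_def b0_def by (rule kicks_tendsto_ode[OF \<omega> \<psi> f f1])
  have G: "(\<lambda>n. K n (c0, d0)) \<longlonglongrightarrow> ((g 1 + g1 1 / ?w) * of_real (exp (- \<omega>)) / 2, (g 1 - g1 1 / ?w) * of_real (exp \<omega>) / 2)"
    unfolding K_def c0_def d0_def by (rule kicks_tendsto_ode[OF \<omega> \<psi> g g1])
  \<comment> \<open>Cramer's rule in the basis of the two initial states; their determinant
    \<open>E\<close> is the Wronskian times -1/(2 \<omega>).\<close>
  have e10: "(1, 0) = (d0 / E * fst (a0, b0) + (- b0 / E) * fst (c0, d0), d0 / E * snd (a0, b0) + (- b0 / E) * snd (c0, d0))"
    using E0 by (simp add: field_simps) (simp add: E_def algebra_simps)
  have e01: "(0, 1) = (- c0 / E * fst (a0, b0) + a0 / E * fst (c0, d0), - c0 / E * snd (a0, b0) + a0 / E * snd (c0, d0))"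
    using E0 by (simp add: field_simps) (simp add: E_def algebra_simps)
  have k1: "fst (K n (1, 0)) = d0 / E * fst (K n (a0, b0)) + (- b0 / E) * fst (K n (c0, d0))" for n
    unfolding e10 K_def kicks_linear by simp
  have k2: "snd (K n (0, 1)) = - c0 / E * snd (K n (a0, b0)) + a0 / E * snd (K n (c0, d0))" for n
    unfolding e01 K_def kicks_linear by simp
  have lim: "(\<lambda>n. of_real (exp \<omega>) * fst (K n (1, 0)) + of_real (exp (- \<omega>)) * snd (K n (0, 1)) - 2)
    \<longlonglongrightarrow> of_real (exp \<omega>) * (d0 / E * ((f 1 + f1 1 / ?w) * of_real (exp (- \<omega>)) / 2) + (- b0 / E) * ((g 1 + g1 1 / ?w) * of_real (exp (- \<omega>)) / 2))
     + of_real (exp (- \<omega>)) * (- c0 / E * ((f 1 - f1 1 / ?w) * of_real (exp \<omega>) / 2) + a0 / E * ((g 1 - g1 1 / ?w) * of_real (exp \<omega>) / 2)) - 2"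
    unfolding k1 k2
    using tendsto_fst[OF F] tendsto_snd[OF F] tendsto_fst[OF G] tendsto_snd[OF G]
    by (intro tendsto_intros) auto
  have ee: "complex_of_real (exp (- \<omega>)) = 1 / of_real (exp \<omega>)" by (simp add: exp_minus field_simps)
  have "of_real (exp \<omega>) * (d0 / E * ((f 1 + f1 1 / ?w) * of_real (exp (- \<omega>)) / 2) + (- b0 / E) * ((g 1 + g1 1 / ?w) * of_real (exp (- \<omega>)) / 2))
     + of_real (exp (- \<omega>)) * (- c0 / E * ((f 1 - f1 1 / ?w) * of_real (exp \<omega>) / 2) + a0 / E * ((g 1 - g1 1 / ?w) * of_real (exp \<omega>) / 2)) - 2
     = (d0 * (f 1 + f1 1 / ?w) - b0 * (g 1 + g1 1 / ?w) - c0 * (f 1 - f1 1 / ?w) + a0 * (g 1 - g1 1 / ?w)) / (2 * E) - 2"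
    unfolding ee using E0 by (simp add: field_simps)
  also have "d0 * (f 1 + f1 1 / ?w) - b0 * (g 1 + g1 1 / ?w) - c0 * (f 1 - f1 1 / ?w) + a0 * (g 1 - g1 1 / ?w)
     = - (f 1 * g1 0 - f1 1 * g 0 - g 1 * f1 0 + g1 1 * f 0) / ?w"
    using \<omega> by (simp add: a0_def b0_def c0_def d0_def field_simps)
  also have "\<dots> / (2 * E) = (f 1 * g1 0 - f1 1 * g 0 - g 1 * f1 0 + g1 1 * f 0) / (f 0 * g1 0 - f1 0 * g 0)"
    unfolding E using \<omega> W by (simp add: field_simps)
  finally show ?thesis using lim unfolding discr_def K_def by simp
qed

section \<open>WKB asymptotics\<close>

text \<open>With \<open>p = S'\<close>, the system \<open>g' = p k\<close>, \<open>k' = - 2 \<mu> p k + q g\<close> is the correction equation for the WKB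
  ansatz. Its integrated form damps by \<open>exp (- 2 \<mu> (S t - S u))\<close>, which is bounded since \<open>Re \<mu> \<ge> 0\<close>.\<close>

lemma damped_volterra_bounds:
  fixes p q S :: "real \<Rightarrow> real" and \<mu> :: complex and g :: "real \<Rightarrow> complex"
  defines "I1 \<equiv> \<lambda>t. integral {0..t} (\<lambda>u. of_real (q u) * g u)"
    and "k \<equiv> \<lambda>t. exp (- 2 * \<mu> * of_real (S t)) * integral {0..t} (\<lambda>u. exp (2 * \<mu> * of_real (S u)) * of_real (q u) * g u)"
  assumes S: "\<And>t. t \<in> {0..1} \<Longrightarrow> (S has_real_derivative p t) (at t within {0..1})"
    and p: "\<And>t. t \<in> {0..1} \<Longrightarrow> p t \<ge> 0" and q: "continuous_on {0..1} q"
    and C: "\<And>t. t \<in> {0..1} \<Longrightarrow> \<bar>q t\<bar> \<le> C" and \<mu>: "Re \<mu> \<ge> 0"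
    and g: "continuous_on {0..1} g"
  shows "t \<in> {0..1} \<Longrightarrow> (I1 has_vector_derivative of_real (q t) * g t) (at t within {0..1})"
    and "t \<in> {0..1} \<Longrightarrow> (k has_vector_derivative - 2 * \<mu> * of_real (p t) * k t + of_real (q t) * g t) (at t within {0..1})"
    and "t \<in> {0..1} \<Longrightarrow> (\<And>u. u \<in> {0..1} \<Longrightarrow> norm (g u) \<le> G) \<Longrightarrow> norm (I1 t) \<le> C * G"
    and "t \<in> {0..1} \<Longrightarrow> (\<And>u. u \<in> {0..1} \<Longrightarrow> norm (g u) \<le> G) \<Longrightarrow> norm (k t) \<le> C * G"
proof -
  have contS: "continuous_on {0..1} S"
    using S by (intro continuous_on_vector_derivative) (auto simp: has_real_derivative_iff_has_vector_derivative)
  have c1: "continuous_on {0..1} (\<lambda>u. of_real (q u) * g u)"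
    by (intro continuous_intros q g)
  have c2: "continuous_on {0..1} (\<lambda>u. exp (2 * \<mu> * of_real (S u)) * of_real (q u) * g u)"
    by (intro continuous_intros contS q g)
  have d1: "(I1 has_vector_derivative of_real (q t) * g t) (at t within {0..1})" if "t \<in> {0..1}" for t
    unfolding I1_def using integral_has_vector_derivative[OF c1 that] .
  then show "t \<in> {0..1} \<Longrightarrow> (I1 has_vector_derivative of_real (q t) * g t) (at t within {0..1})" .
  show "(k has_vector_derivative - 2 * \<mu> * of_real (p t) * k t + of_real (q t) * g t) (at t within {0..1})" if t: "t \<in> {0..1}"
  proof -
    have "((\<lambda>t. - 2 * \<mu> * complex_of_real (S t)) has_vector_derivative - 2 * \<mu> * of_real (p t)) (at t within {0..1})"
      by (intro has_vector_derivative_mult_right has_vector_derivative_of_real S t)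
    from field_vector_diff_chain_within[OF this, of exp "exp (- 2 * \<mu> * of_real (S t))"]
    have e: "((\<lambda>t. exp (- 2 * \<mu> * of_real (S t))) has_vector_derivative - 2 * \<mu> * of_real (p t) * exp (- 2 * \<mu> * of_real (S t))) (at t within {0..1})"
      by (simp add: comp_def DERIV_exp[THEN DERIV_subset])
    have "exp (- 2 * \<mu> * of_real (S t)) * exp (2 * \<mu> * of_real (S t)) = 1"
      by (simp add: exp_add[symmetric])
    then have *: "exp (- 2 * \<mu> * of_real (S t)) * (exp (2 * \<mu> * of_real (S t)) * of_real (q t) * g t) = of_real (q t) * g t"
      by (simp only: mult.assoc[symmetric] mult_1)
    show ?thesis unfolding k_def
      by (rule has_vector_derivative_eq_rhs[OF has_vector_derivative_mult[OF e integral_has_vector_derivative[OF c2 t]]])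
        (simp only: *, simp add: mult.assoc)
  qed
  assume t: "t \<in> {0..1}" and G: "\<And>u. u \<in> {0..1} \<Longrightarrow> norm (g u) \<le> G"
  have G0: "G \<ge> 0" using G[of 0] norm_ge_zero[of "g 0"] by (auto intro: order_trans simp del: norm_ge_zero)
  have C0: "C \<ge> 0" using C[of 0] by auto
  have sub: "{0..t} \<subseteq> {0..1}" using t by auto
  have "norm (I1 t) \<le> C * G * (t - 0)"
    unfolding I1_def
  proof (rule integral_bound)
    show "continuous_on {0..t} (\<lambda>u. of_real (q u) * g u)" using c1 sub by (rule continuous_on_subset)
    fix u assume "u \<in> {0..t}"
    then show "norm (of_real (q u) * g u) \<le> C * G"
      using C[of u] G[of u] sub C0 by (auto simp: norm_mult intro!: mult_mono)
  qed (use t in auto)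
  also have "\<dots> \<le> C * G * 1" using t G0 C0 by (intro mult_left_mono) auto
  finally show "norm (I1 t) \<le> C * G" by simp
  \<comment> \<open>Since \<open>p\<close> is nonnegative, \<open>S\<close> increases, and for u
    \<le> t the kernel exp(-2 \<mu> (S t - S u)) has modulus at most 1.\<close>
  have mono: "S u \<le> S t" if "u \<in> {0..t}" for u
  proof -
    have "u \<le> t" using that by simp
    then show ?thesis
    proof (rule DERIV_nonneg_imp_increasing_open)
      show "continuous_on {u..t} S" using contS by (rule continuous_on_subset) (use t that in auto)
      fix x assume x: "u < x" "x < t"
      then have "(S has_real_derivative p x) (at x within {0<..<1})"
        using S[of x] t that by (auto intro: DERIV_subset)
      then have "(S has_real_derivative p x) (at x)"
        using x t that at_within_open[of x "{0<..<1}"] by simp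
      moreover have "p x \<ge> 0" using x t that p[of x] by auto
      ultimately show "\<exists>y. (S has_real_derivative y) (at x) \<and> 0 \<le> y" by blast
    qed
  qed
  have "k t = integral {0..t} (\<lambda>u. exp (- 2 * \<mu> * of_real (S t)) * (exp (2 * \<mu> * of_real (S u)) * of_real (q u) * g u))"
    unfolding k_def by simp
  also have "norm \<dots> \<le> C * G * (t - 0)"
  proof (rule integral_bound)
    show "continuous_on {0..t} (\<lambda>u. exp (- 2 * \<mu> * of_real (S t)) * (exp (2 * \<mu> * of_real (S u)) * of_real (q u) * g u))"
      by (intro continuous_on_mult continuous_on_const continuous_on_subset[OF c2 sub])
    fix u assume u: "u \<in> {0..t}"
    have "norm (exp (- 2 * \<mu> * of_real (S t)) * exp (2 * \<mu> * of_real (S u))) \<le> 1"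
      using mult_left_mono[OF mono[OF u] \<mu>] by (simp add: exp_add[symmetric])
    then have "norm (exp (- 2 * \<mu> * of_real (S t)) * exp (2 * \<mu> * of_real (S u))) * norm (of_real (q u) * g u) \<le> 1 * (C * G)"
      using C[of u] G[of u] u sub C0 by (intro mult_mono) (auto simp: norm_mult intro!: mult_mono)
    then show "norm (exp (- 2 * \<mu> * of_real (S t)) * (exp (2 * \<mu> * of_real (S u)) * of_real (q u) * g u)) \<le> C * G"
      by (simp only: norm_mult mult.assoc mult_1)
  qed (use t in auto)
  also have "\<dots> \<le> C * G * 1" using t G0 C0 by (intro mult_left_mono) auto
  finally show "norm (k t) \<le> C * G" by simp
qed

text \<open>Because 2 \<mu> p k = q g - k', the integral of p k is (I1 - k)/(2 \<mu>). This gain of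
  1/\<mu> turns g' = p k into a fixed point equation whose right-hand side is affine in
  \<open>g\<close> with Lipschitz constant C/|\<mu>| \<le> 1/2, so Banach's theorem applies with
  bounds uniform in \<mu>.\<close>

lemma damped_system_solution:
  fixes p q S :: "real \<Rightarrow> real" and \<mu> :: complex
  assumes S: "\<And>t. t \<in> {0..1} \<Longrightarrow> (S has_real_derivative p t) (at t within {0..1})"
    and p: "\<And>t. t \<in> {0..1} \<Longrightarrow> p t \<ge> 0" and q: "continuous_on {0..1} q"
    and C: "\<And>t. t \<in> {0..1} \<Longrightarrow> \<bar>q t\<bar> \<le> C" and \<mu>: "Re \<mu> \<ge> 0" "\<mu> \<noteq> 0" "2 * C \<le> norm \<mu>"
  obtains g k where
    "\<And>t. t \<in> {0..1} \<Longrightarrow> (g has_vector_derivative of_real (p t) * k t) (at t within {0..1})"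
    "\<And>t. t \<in> {0..1} \<Longrightarrow> (k has_vector_derivative - 2 * \<mu> * of_real (p t) * k t + of_real (q t) * g t) (at t within {0..1})"
    "g 0 = 1" "k 0 = 0" "\<And>t. t \<in> {0..1} \<Longrightarrow> norm (g t - 1) \<le> 2 * C / norm \<mu>"
    "\<And>t. t \<in> {0..1} \<Longrightarrow> norm (k t) \<le> 2 * C"
proof -
  define I1 where "I1 g t = integral {0..t} (\<lambda>u. of_real (q u) * g u)" for g :: "real \<Rightarrow> complex" and t
  define k where "k g t = exp (- 2 * \<mu> * of_real (S t)) * integral {0..t} (\<lambda>u. exp (2 * \<mu> * of_real (S u)) * of_real (q u) * g u)" for g :: "real \<Rightarrow> complex" and t
  define F where "F g t = 1 + (I1 g t - k g t) / (2 * \<mu>)" for g t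
  note B = damped_volterra_bounds[OF S p q C \<mu>(1), folded I1_def k_def]
  have C0: "C \<ge> 0" using C[of 0] by auto
  define m where "m = norm \<mu>"
  have m: "m > 0" "2 * C \<le> m" using \<mu> by (auto simp: m_def)
  have F1: "norm (F g t - 1) \<le> C / m * G"
    if "continuous_on {0..1} g" "t \<in> {0..1}" "\<And>u. u \<in> {0..1} \<Longrightarrow> norm (g u) \<le> G" for g t G
  proof -
    have "norm (I1 g t - k g t) \<le> C * G + C * G"
      by (rule order_trans[OF norm_triangle_ineq4]) (intro add_mono B(3,4) that)
    then have "norm (I1 g t - k g t) / (2 * m) \<le> (C * G + C * G) / (2 * m)"
      using m by (intro divide_right_mono) auto
    then show ?thesis by (simp add: F_def norm_divide norm_mult m_def[symmetric] field_simps)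
  qed
  have dF: "(F g has_vector_derivative of_real (p t) * k g t) (at t within {0..1})"
    if "continuous_on {0..1} g" "t \<in> {0..1}" for g t
  proof -
    have "(F g has_vector_derivative 0 + (of_real (q t) * g t - (- 2 * \<mu> * of_real (p t) * k g t + of_real (q t) * g t)) / (2 * \<mu>)) (at t within {0..1})"
      unfolding F_def by (intro has_vector_derivative_add has_vector_derivative_const has_vector_derivative_divide
          has_vector_derivative_diff B(1,2) that)
    then show ?thesis using \<mu> by simp
  qed
  have contF: "continuous_on {0..1} (F g)" if "continuous_on {0..1} g" for g
    using dF[OF that] by (intro continuous_on_vector_derivative)
  \<comment> \<open>\<open>F\<close> is affine with constant term 1, so differences reduce to the
    bound \<open>F1\<close> for its linear part.\<close>
  have diffF: "F g t - F h t = F (\<lambda>u. g u - h u) t - 1"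
    if "continuous_on {0..1} g" "continuous_on {0..1} h" "t \<in> {0..1}" for g h t
  proof -
    have sub: "{0..t} \<subseteq> {0..1}" using that by auto
    have contS: "continuous_on {0..1} S"
      using S by (intro continuous_on_vector_derivative) (auto simp: has_real_derivative_iff_has_vector_derivative)
    have i: "(\<lambda>u. of_real (q u) * g u) integrable_on {0..t}"
      "(\<lambda>u. exp (2 * \<mu> * of_real (S u)) * of_real (q u) * g u) integrable_on {0..t}"
      if "continuous_on {0..1} g" for g
      by (intro integrable_continuous_real continuous_intros continuous_on_subset[OF q sub]
        continuous_on_subset[OF contS sub] continuous_on_subset[OF that sub])+
    have "I1 (\<lambda>u. g u - h u) t = I1 g t - I1 h t"
      unfolding I1_def right_diff_distrib by (intro integral_diff i that)
    moreover have "k (\<lambda>u. g u - h u) t = k g t - k h t"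
      unfolding k_def right_diff_distrib[symmetric] using i that
      by (subst integral_diff[symmetric]) (auto simp: right_diff_distrib)
    ultimately show ?thesis by (simp add: F_def diff_divide_distrib)
  qed
  \<comment> \<open>The fixed point is sought among bounded continuous functions on the whole line;
    clamping the argument to [0,1] makes \<open>F\<close> a self-map of that space.\<close>
  define c where "c t = max 0 (min 1 t)" for t :: real
  have c: "c t \<in> {0..1}" for t by (auto simp: c_def)
  have c_id: "c t = t" if "t \<in> {0..1}" for t using that by (auto simp: c_def)
  have contc: "continuous_on UNIV c" unfolding c_def by (intro continuous_intros)
  define T where "T g = Bcontfun (\<lambda>t. F (apply_bcontfun g) (c t))" for g :: "real \<Rightarrow>\<^sub>C complex"
  have contg: "continuous_on A (apply_bcontfun g)" for A and g :: "real \<Rightarrow>\<^sub>C complex"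
    by (rule continuous_on_subset[OF continuous_on_apply_bcontfun]) auto
  have T: "apply_bcontfun (T g) t = F (apply_bcontfun g) (c t)" for g t
  proof -
    have "continuous_on UNIV (\<lambda>t. F (apply_bcontfun g) (c t))"
      using c by (intro continuous_on_compose2[OF contF[OF contg] contc]) auto
    moreover have "bounded (range (\<lambda>t. F (apply_bcontfun g) (c t)))"
    proof (rule bounded_subset)
      show "bounded (F (apply_bcontfun g) ` {0..1})"
        by (intro compact_imp_bounded compact_continuous_image contF contg compact_Icc)
    qed (use c in auto)
    ultimately have "(\<lambda>t. F (apply_bcontfun g) (c t)) \<in> bcontfun" by (simp add: bcontfun_def)
    then show ?thesis by (simp add: T_def Bcontfun_inverse)
  qed
  have "\<exists>!g. T g = g"
  proof (rule banach_fix_type[where c="1/2"])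
    show "\<forall>g h. dist (T g) (T h) \<le> 1 / 2 * dist g h"
    proof (intro allI dist_bound)
      fix g h :: "real \<Rightarrow>\<^sub>C complex" and t
      have "dist (apply_bcontfun (T g) t) (apply_bcontfun (T h) t)
        = norm (F (\<lambda>u. apply_bcontfun g u - apply_bcontfun h u) (c t) - 1)"
        unfolding T dist_norm by (subst diffF[OF contg contg c]) simp
      also have "\<dots> \<le> C / m * dist g h"
        by (intro F1 continuous_on_diff contg c) (simp add: dist_norm[symmetric] dist_bounded)
      also have "\<dots> \<le> 1 / 2 * dist g h"
        using m by (intro mult_right_mono) (auto simp: field_simps)
      finally show "dist (apply_bcontfun (T g) t) (apply_bcontfun (T h) t) \<le> 1 / 2 * dist g h" .
    qed
  qed auto
  then obtain \<gamma> where \<gamma>: "T \<gamma> = \<gamma>" by blast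
  define g where "g = apply_bcontfun \<gamma>"
  have gF: "g t = F g t" if "t \<in> {0..1}" for t
    using T[of \<gamma> t] that by (simp add: \<gamma> g_def c_id)
  have cg: "continuous_on {0..1} g" unfolding g_def by (rule contg)
  obtain z where z: "z \<in> {0..1}" "\<And>t. t \<in> {0..1} \<Longrightarrow> norm (g t) \<le> norm (g z)"
    using continuous_attains_sup[OF compact_Icc _ continuous_on_norm[OF cg]] by fastforce
  \<comment> \<open>At a maximum point z of |g| the equation gives |g z| \<le> 1 + |g z|/2. The
    resulting bound 2 is the source of the constant \<open>2 * C\<close> in the conclusions.\<close>
  have "norm (g z) \<le> 1 + norm (g z - 1)" using norm_triangle_ineq[of 1 "g z - 1"] by simp
  also have "norm (g z - 1) \<le> C / m * norm (g z)" using F1[OF cg z(1) z(2)] gF[OF z(1)] by simp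
  also have "\<dots> \<le> 1 / 2 * norm (g z)" using m by (intro mult_right_mono) (auto simp: field_simps)
  finally have "norm (g z) \<le> 2" by simp
  then have g2: "norm (g t) \<le> 2" if "t \<in> {0..1}" for t using z(2)[OF that] by simp
  show ?thesis
  proof (rule that[of g "k g"])
    fix t :: real assume t: "t \<in> {0..1}"
    show "(g has_vector_derivative of_real (p t) * k g t) (at t within {0..1})"
      by (rule has_vector_derivative_transform[OF t _ dF[OF cg t]]) (rule gF)
    show "(k g has_vector_derivative - 2 * \<mu> * of_real (p t) * k g t + of_real (q t) * g t) (at t within {0..1})"
      by (rule B(2)) (use cg t in auto)
    show "norm (g t - 1) \<le> 2 * C / norm \<mu>" using F1[OF cg t g2] gF[OF t] by (simp add: m_def mult.commute)
    show "norm (k g t) \<le> 2 * C" using B(4)[of g t 2] cg t g2 by (simp add: mult.commute)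
  next
    show "k g 0 = 0" by (simp add: k_def)
    show "g 0 = 1" using gF[of 0] by (simp add: F_def I1_def k_def)
  qed
qed

text \<open>The solution is \<open>f = \<rho> exp (\<mu> S) g\<close> with \<open>\<rho> = \<psi>\<^sup>-\<^sup>1\<^sup>/\<^sup>4\<close>. The potential entering the correction \<open>g\<close> does not
  depend on \<open>\<mu>\<close>, so \<open>g\<close> is within \<open>O(1 / \<mu>)\<close> of \<open>1\<close>.\<close>

lemma wkb_solution:
  fixes \<rho> \<rho>1 \<rho>2 S :: "real \<Rightarrow> real" and \<mu> :: complex and \<omega> C :: real
  assumes \<rho>: "\<And>t. t \<in> {0..1} \<Longrightarrow> \<rho> t > 0"
    and d\<rho>: "\<And>t. t \<in> {0..1} \<Longrightarrow> (\<rho> has_real_derivative \<rho>1 t) (at t within {0..1})"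
    and d\<rho>1: "\<And>t. t \<in> {0..1} \<Longrightarrow> (\<rho>1 has_real_derivative \<rho>2 t) (at t within {0..1})"
    and c\<rho>2: "continuous_on {0..1} \<rho>2"
    and S: "\<And>t. t \<in> {0..1} \<Longrightarrow> (S has_real_derivative 1 / (\<rho> t)\<^sup>2) (at t within {0..1})" and S0: "S 0 = 0"
    and C: "\<And>t. t \<in> {0..1} \<Longrightarrow> \<bar>\<omega>\<^sup>2 * (\<rho> t)\<^sup>2 - \<rho> t * \<rho>2 t\<bar> \<le> C"
    and \<mu>: "Re \<mu> \<ge> 0" "\<mu> \<noteq> 0" "2 * C \<le> norm \<mu>"
  obtains f f1 g k where
    "\<And>t. t \<in> {0..1} \<Longrightarrow> (f has_vector_derivative f1 t) (at t within {0..1})"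
    "\<And>t. t \<in> {0..1} \<Longrightarrow> (f1 has_vector_derivative (of_real (\<omega>\<^sup>2) + \<mu>\<^sup>2 * of_real (1 / \<rho> t ^ 4)) * f t) (at t within {0..1})"
    "f 0 = of_real (\<rho> 0)" "f1 0 = of_real (\<rho>1 0) + \<mu> / of_real (\<rho> 0)"
    "f 1 = of_real (\<rho> 1) * exp (\<mu> * of_real (S 1)) * g"
    "f1 1 = (of_real (\<rho>1 1) * g + (\<mu> * g + k) / of_real (\<rho> 1)) * exp (\<mu> * of_real (S 1))"
    "norm (g - 1) \<le> 2 * C / norm \<mu>" "norm k \<le> 2 * C"
proof -
  \<comment> \<open>With S' = 1/\<rho>^2 the terms linear in \<mu> cancel when \<rho> exp(\<mu> S)
    is inserted into the equation, and the residual is (\<rho>'' - \<omega>^2 \<rho>) exp(\<mu> S).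
    Its coefficient multiplied by -\<rho> is \<open>?q\<close>.\<close>
  let ?q = "\<lambda>t. \<omega>\<^sup>2 * (\<rho> t)\<^sup>2 - \<rho> t * \<rho>2 t"
  have c\<rho>: "continuous_on {0..1} \<rho>"
    using d\<rho> by (intro continuous_on_vector_derivative) (auto simp: has_real_derivative_iff_has_vector_derivative)
  have cq: "continuous_on {0..1} ?q" by (intro continuous_intros c\<rho> c\<rho>2)
  have p0: "1 / (\<rho> t)\<^sup>2 \<ge> 0" for t by simp
  obtain g k where
    dg: "\<And>t. t \<in> {0..1} \<Longrightarrow> (g has_vector_derivative of_real (1 / (\<rho> t)\<^sup>2) * k t) (at t within {0..1})"
    and dk: "\<And>t. t \<in> {0..1} \<Longrightarrow> (k has_vector_derivative - 2 * \<mu> * of_real (1 / (\<rho> t)\<^sup>2) * k t + of_real (?q t) * g t) (at t within {0..1})"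
    and g0: "g 0 = 1" "k 0 = 0" and bg: "\<And>t. t \<in> {0..1} \<Longrightarrow> norm (g t - 1) \<le> 2 * C / norm \<mu>"
    and bk: "\<And>t. t \<in> {0..1} \<Longrightarrow> norm (k t) \<le> 2 * C"
    using damped_system_solution[OF S p0 cq C \<mu>] by blast
  define f where "f t = of_real (\<rho> t) * exp (\<mu> * of_real (S t)) * g t" for t
  define f1 where "f1 t = (of_real (\<rho>1 t) * g t + (\<mu> * g t + k t) * of_real (1 / \<rho> t)) * exp (\<mu> * of_real (S t))" for t
  have vd: "((\<lambda>t. complex_of_real (\<rho> t)) has_vector_derivative of_real (\<rho>1 t)) (at t within {0..1})"
    "((\<lambda>t. complex_of_real (\<rho>1 t)) has_vector_derivative of_real (\<rho>2 t)) (at t within {0..1})"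
    "((\<lambda>t. complex_of_real (1 / \<rho> t)) has_vector_derivative of_real (- \<rho>1 t / (\<rho> t)\<^sup>2)) (at t within {0..1})"
    "((\<lambda>t. exp (\<mu> * of_real (S t))) has_vector_derivative \<mu> * of_real (1 / (\<rho> t)\<^sup>2) * exp (\<mu> * of_real (S t))) (at t within {0..1})"
    if t: "t \<in> {0..1}" for t
  proof -
    show "((\<lambda>t. complex_of_real (\<rho> t)) has_vector_derivative of_real (\<rho>1 t)) (at t within {0..1})"
      "((\<lambda>t. complex_of_real (\<rho>1 t)) has_vector_derivative of_real (\<rho>2 t)) (at t within {0..1})"
      using d\<rho>[OF t] d\<rho>1[OF t] by (simp_all only: has_real_derivative_iff_has_vector_derivative has_vector_derivative_of_real)
    have "((\<lambda>t. 1 / \<rho> t) has_real_derivative - \<rho>1 t / (\<rho> t)\<^sup>2) (at t within {0..1})"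
      using DERIV_inverse_fun[OF d\<rho>[OF t]] \<rho>[OF t] by (simp add: inverse_eq_divide power2_eq_square)
    then show "((\<lambda>t. complex_of_real (1 / \<rho> t)) has_vector_derivative of_real (- \<rho>1 t / (\<rho> t)\<^sup>2)) (at t within {0..1})"
      by (simp only: has_real_derivative_iff_has_vector_derivative has_vector_derivative_of_real)
    have "((\<lambda>t. \<mu> * complex_of_real (S t)) has_vector_derivative \<mu> * of_real (1 / (\<rho> t)\<^sup>2)) (at t within {0..1})"
      using S[OF t] by (intro has_vector_derivative_mult_right has_vector_derivative_of_real)
        (simp only: has_real_derivative_iff_has_vector_derivative)
    from field_vector_diff_chain_within[OF this, of exp "exp (\<mu> * of_real (S t))"]
    show "((\<lambda>t. exp (\<mu> * of_real (S t))) has_vector_derivative \<mu> * of_real (1 / (\<rho> t)\<^sup>2) * exp (\<mu> * of_real (S t))) (at t within {0..1})"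
      by (simp add: comp_def DERIV_exp[THEN DERIV_subset])
  qed
  show ?thesis
  proof (rule that[of f f1 "g 1" "k 1"])
    fix t :: real assume t: "t \<in> {0..1}"
    have \<rho>0: "complex_of_real (\<rho> t) \<noteq> 0" using \<rho>[OF t] by simp
    show "(f has_vector_derivative f1 t) (at t within {0..1})"
      unfolding f_def
      by (rule has_vector_derivative_eq_rhs[OF has_vector_derivative_mult[OF has_vector_derivative_mult[OF vd(1)[OF t] vd(4)[OF t]] dg[OF t]]])
        (use \<rho>0 in \<open>simp add: f1_def field_simps power2_eq_square\<close>)
    let ?d = "(of_real (\<rho>1 t) * g t + (\<mu> * g t + k t) * of_real (1 / \<rho> t)) * (\<mu> * of_real (1 / (\<rho> t)\<^sup>2) * exp (\<mu> * of_real (S t)))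
        + ((of_real (\<rho>1 t) * (of_real (1 / (\<rho> t)\<^sup>2) * k t) + of_real (\<rho>2 t) * g t) +
           ((\<mu> * g t + k t) * of_real (- \<rho>1 t / (\<rho> t)\<^sup>2) + (\<mu> * (of_real (1 / (\<rho> t)\<^sup>2) * k t)
              + (- 2 * \<mu> * of_real (1 / (\<rho> t)\<^sup>2) * k t + of_real (?q t) * g t)) * of_real (1 / \<rho> t))) * exp (\<mu> * of_real (S t))"
    have d1: "(f1 has_vector_derivative ?d) (at t within {0..1})"
      unfolding f1_def
      by (intro has_vector_derivative_mult has_vector_derivative_add has_vector_derivative_mult_right vd t dg dk)
    show "(f1 has_vector_derivative (of_real (\<omega>\<^sup>2) + \<mu>\<^sup>2 * of_real (1 / \<rho> t ^ 4)) * f t) (at t within {0..1})"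
    proof (rule has_vector_derivative_eq_rhs[OF d1])
      define r where "r = complex_of_real (\<rho> t)"
      define r1 where "r1 = complex_of_real (\<rho>1 t)"
      define r2 where "r2 = complex_of_real (\<rho>2 t)"
      define E where "E = exp (\<mu> * of_real (S t))"
      have r: "r \<noteq> 0" using \<rho>0 by (simp add: r_def)
      have alg: "(r1 * G + (\<mu> * G + K) * (1 / r)) * (\<mu> * (1 / r\<^sup>2) * E)
        + ((r1 * (1 / r\<^sup>2 * K) + r2 * G) + ((\<mu> * G + K) * (- r1 / r\<^sup>2) + (\<mu> * (1 / r\<^sup>2 * K)
              + (- 2 * \<mu> * (1 / r\<^sup>2) * K + (w\<^sup>2 * r\<^sup>2 - r * r2) * G)) * (1 / r))) * E
        = (w\<^sup>2 + \<mu>\<^sup>2 * (1 / r ^ 4)) * (r * E * G)" for G K w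
        using r by (simp add: divide_simps) (simp add: algebra_simps power2_eq_square power4_eq_xxxx)
      show "?d
        = (of_real (\<omega>\<^sup>2) + \<mu>\<^sup>2 * of_real (1 / \<rho> t ^ 4)) * f t"
        using alg[of "g t" "k t" "of_real \<omega>"] unfolding r_def r1_def r2_def E_def f_def by simp
    qed
  next
    show "f 0 = of_real (\<rho> 0)" by (simp add: f_def S0 g0)
    show "f1 0 = of_real (\<rho>1 0) + \<mu> / of_real (\<rho> 0)" by (simp add: f1_def S0 g0)
    show "f 1 = of_real (\<rho> 1) * exp (\<mu> * of_real (S 1)) * g 1" by (simp add: f_def)
    show "f1 1 = (of_real (\<rho>1 1) * g 1 + (\<mu> * g 1 + k 1) / of_real (\<rho> 1)) * exp (\<mu> * of_real (S 1))"
      by (simp add: f1_def)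
  qed (use bg bk in auto)
qed

text \<open>For Re s > 0 the parameter \<mu> = csqrt(2 s) has |arg \<mu>| < \<pi>/4, hence Re \<mu>
  > |\<mu>|/sqrt 2; the constant 1/2 leaves room. A limit along this filter is uniform in the
  argument of \<mu>, as inversion along a vertical line requires.\<close>

definition sector_filter :: "complex filter" where
  "sector_filter = inf at_infinity (principal {\<mu>. Re \<mu> \<ge> norm \<mu> / 2})"

lemma eventually_sector_filter:
  "eventually P sector_filter \<longleftrightarrow> (\<exists>B. \<forall>\<mu>. B \<le> norm \<mu> \<longrightarrow> Re \<mu> \<ge> norm \<mu> / 2 \<longrightarrow> P \<mu>)"
  by (simp add: sector_filter_def eventually_inf_principal eventually_at_infinity)

lemma sector_filter_inverse_tendsto: "((\<lambda>\<mu>. 1 / \<mu>) \<longlongrightarrow> 0) sector_filter"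
  unfolding sector_filter_def
  unfolding divide_inverse mult_1 by (rule tendsto_mono[OF inf_le1 tendsto_inverse_0])

lemma sector_filter_norm: "filterlim norm at_top sector_filter"
  unfolding sector_filter_def by (rule filterlim_mono[OF filterlim_norm_at_top order_refl inf_le1])

lemma sector_filter_exp_tendsto:
  assumes "\<theta> > 0"
  shows "((\<lambda>\<mu>. exp (- (\<mu> * of_real \<theta>))) \<longlongrightarrow> (0::complex)) sector_filter"
proof (rule tendsto_norm_zero_cancel, rule tendsto_sandwich)
  show "((\<lambda>_. 0) \<longlongrightarrow> (0::real)) sector_filter" by simp
  show "\<forall>\<^sub>F \<mu> in sector_filter. 0 \<le> norm (exp (- (\<mu> * complex_of_real \<theta>)))" by simp
  show "\<forall>\<^sub>F \<mu> in sector_filter. norm (exp (- (\<mu> * of_real \<theta>))) \<le> exp (- (\<theta> / 2 * norm \<mu>))"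
    unfolding eventually_sector_filter
  proof (intro exI allI impI)
    fix \<mu> :: complex assume "norm \<mu> / 2 \<le> Re \<mu>"
    then have "norm \<mu> / 2 * \<theta> \<le> Re \<mu> * \<theta>" using assms by (intro mult_right_mono) auto
    then show "norm (exp (- (\<mu> * of_real \<theta>))) \<le> exp (- (\<theta> / 2 * norm \<mu>))" by (simp add: mult.commute)
  qed
  have "filterlim (\<lambda>\<mu>. \<theta> / 2 * norm \<mu>) at_top sector_filter"
    using assms by (intro filterlim_tendsto_pos_mult_at_top[OF tendsto_const _ sector_filter_norm]) auto
  then show "((\<lambda>\<mu>. exp (- (\<theta> / 2 * norm \<mu>))) \<longlongrightarrow> 0) sector_filter"
    by (intro filterlim_compose[OF exp_at_bot] filterlim_compose[OF filterlim_uminus_at_bot_at_top])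
qed

text \<open>The second, decaying solution is the WKB solution of the time-reversed equation.\<close>

lemma discr_limit_asymptotics:
  fixes \<rho> \<rho>1 \<rho>2 S :: "real \<Rightarrow> real" and \<omega> :: real
  assumes \<omega>: "\<omega> > 0" and \<rho>: "\<And>t. t \<in> {0..1} \<Longrightarrow> \<rho> t > 0"
    and d\<rho>: "\<And>t. t \<in> {0..1} \<Longrightarrow> (\<rho> has_real_derivative \<rho>1 t) (at t within {0..1})"
    and d\<rho>1: "\<And>t. t \<in> {0..1} \<Longrightarrow> (\<rho>1 has_real_derivative \<rho>2 t) (at t within {0..1})"
    and c\<rho>2: "continuous_on {0..1} \<rho>2"
    and S: "\<And>t. t \<in> {0..1} \<Longrightarrow> (S has_real_derivative 1 / (\<rho> t)\<^sup>2) (at t within {0..1})" and S0: "S 0 = 0"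
    and \<theta>: "S 1 > 0"
  obtains D where
    "\<forall>\<^sub>F \<mu> in sector_filter.
       (\<lambda>n. grid_discr \<omega> (\<lambda>t. 1 / \<rho> t ^ 4) (\<mu>\<^sup>2) n) \<longlonglongrightarrow> D \<mu>"
    "((\<lambda>\<mu>. D \<mu> * exp (- (\<mu> * of_real (S 1)))) \<longlongrightarrow> of_real ((\<rho> 1 / \<rho> 0 + \<rho> 0 / \<rho> 1) / 2)) sector_filter"
proof -
  define \<theta> where "\<theta> = S 1"
  have c\<rho>: "continuous_on {0..1} \<rho>"
    using d\<rho> by (intro continuous_on_vector_derivative) (auto simp: has_real_derivative_iff_has_vector_derivative)
  have "bounded ((\<lambda>t. \<omega>\<^sup>2 * (\<rho> t)\<^sup>2 - \<rho> t * \<rho>2 t) ` {0..1})"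
    by (intro compact_imp_bounded compact_continuous_image continuous_intros c\<rho> c\<rho>2 compact_Icc)
  then obtain C where C: "\<And>t. t \<in> {0..1} \<Longrightarrow> \<bar>\<omega>\<^sup>2 * (\<rho> t)\<^sup>2 - \<rho> t * \<rho>2 t\<bar> \<le> C"
  proof -
    assume "bounded ((\<lambda>t. \<omega>\<^sup>2 * (\<rho> t)\<^sup>2 - \<rho> t * \<rho>2 t) ` {0..1})"
    then obtain C where "\<forall>x\<in>(\<lambda>t. \<omega>\<^sup>2 * (\<rho> t)\<^sup>2 - \<rho> t * \<rho>2 t) ` {0..1}. norm x \<le> C" unfolding bounded_iff by blast
    then show thesis using that[of C] by simp
  qed
  let ?r0 = "complex_of_real (\<rho> 0)" and ?r1 = "complex_of_real (\<rho> 1)"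
    and ?s0 = "complex_of_real (\<rho>1 0)" and ?s1 = "complex_of_real (\<rho>1 1)"
  let ?E = "\<lambda>\<mu>. exp (\<mu> * of_real \<theta>)"
  define \<psi> where "\<psi> t = 1 / \<rho> t ^ 4" for t
  have c\<psi>: "continuous_on {0..1} \<psi>"
    unfolding \<psi>_def using \<rho> by (intro continuous_intros c\<rho>) (auto simp: less_imp_neq[symmetric])
  have refl_img: "(\<lambda>t::real. 1 - t) ` {0..1} = {0..1}"
    by (auto intro!: image_eqI[where x="1 - _"])
  have refl_mem: "1 - t \<in> {0..1}" if "t \<in> {0..1}" for t :: real using that by auto
  have refl_der: "((\<lambda>t. f (1 - t)) has_real_derivative - f' (1 - t)) (at t within {0..1})"
    if "\<And>t. t \<in> {0..1} \<Longrightarrow> (f has_real_derivative f' t) (at t within {0..1})" "t \<in> {0..1}"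
    for f f' and t :: real
  proof -
    have 1: "((\<lambda>t. 1 - t) has_real_derivative - 1) (at t within {0..1})"
      by (rule derivative_eq_intros refl | simp)+
    have 2: "(f has_real_derivative f' (1 - t)) (at (1 - t) within (\<lambda>t. 1 - t) ` {0..1})"
      unfolding refl_img by (rule that(1)[OF refl_mem[OF that(2)]])
    show ?thesis using DERIV_image_chain[OF 2 1] by (simp add: comp_def)
  qed
  have refl_vder: "((\<lambda>t. f (1 - t)) has_vector_derivative - f' (1 - t)) (at t within {0..1})"
    if "\<And>t. t \<in> {0..1} \<Longrightarrow> (f has_vector_derivative f' t) (at t within {0..1})" "t \<in> {0..1}"
    for f f' :: "real \<Rightarrow> complex" and t :: real
  proof -
    have 1: "((\<lambda>t. 1 - t) has_vector_derivative - 1) (at t within {0..1})"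
      unfolding has_real_derivative_iff_has_vector_derivative[symmetric]
      by (rule derivative_eq_intros refl | simp)+
    have 2: "(f has_vector_derivative f' (1 - t)) (at (1 - t) within (\<lambda>t. 1 - t) ` {0..1})"
      unfolding refl_img by (rule that(1)[OF refl_mem[OF that(2)]])
    show ?thesis using vector_diff_chain_within[OF 1 2] by (simp add: comp_def)
  qed
  define B where "B = max 1 (2 * C)"
  \<comment> \<open>The trace formula minus 2 with the WKB endpoint values inserted.
    \<open>g\<close>, \<open>k\<close> are the corrections of the growing solution at 1;
    \<open>G\<close>, \<open>K\<close> are those of the decaying one at 0, the end of reversed
    time.\<close>
  define T where "T \<mu> g k G K = ((?r1 * ?E \<mu> * g) * (- (- ?s0 * G + (\<mu> * G + K) / ?r0) * ?E \<mu>)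
         - ((?s1 * g + (\<mu> * g + k) / ?r1) * ?E \<mu>) * (?r0 * ?E \<mu> * G)
         - ?r1 * (?s0 + \<mu> / ?r0) + (- (- ?s1 + \<mu> / ?r1)) * ?r0) / (- ?E \<mu> * (2 * \<mu> * G + K)) - 2" for \<mu> g k G K
  define P where "P \<mu> g k G K \<longleftrightarrow>
      norm (g - 1) \<le> 2 * C / norm \<mu> \<and> norm k \<le> 2 * C \<and> norm (G - 1) \<le> 2 * C / norm \<mu> \<and> norm K \<le> 2 * C \<and>
      (2 * \<mu> * G + K \<noteq> 0 \<longrightarrow>
      (\<lambda>n. grid_discr \<omega> \<psi> (\<mu>\<^sup>2) n) \<longlonglongrightarrow>
      T \<mu> g k G K)" for \<mu> g k G K
  have "\<exists>g k G K. P \<mu> g k G K" if \<mu>: "norm \<mu> \<ge> B" "Re \<mu> \<ge> norm \<mu> / 2" for \<mu>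
  proof -
    have \<mu>': "Re \<mu> \<ge> 0" "\<mu> \<noteq> 0" "2 * C \<le> norm \<mu>"
      using \<mu> norm_ge_zero[of \<mu>] by (auto simp: B_def simp del: norm_ge_zero)
    obtain f f1 g k where f:
      "\<And>t. t \<in> {0..1} \<Longrightarrow> (f has_vector_derivative f1 t) (at t within {0..1})"
      "\<And>t. t \<in> {0..1} \<Longrightarrow> (f1 has_vector_derivative (of_real (\<omega>\<^sup>2) + \<mu>\<^sup>2 * of_real (1 / \<rho> t ^ 4)) * f t) (at t within {0..1})"
      "f 0 = of_real (\<rho> 0)" "f1 0 = of_real (\<rho>1 0) + \<mu> / of_real (\<rho> 0)"
      "f 1 = of_real (\<rho> 1) * exp (\<mu> * of_real (S 1)) * g"
      "f1 1 = (of_real (\<rho>1 1) * g + (\<mu> * g + k) / of_real (\<rho> 1)) * exp (\<mu> * of_real (S 1))"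
      "norm (g - 1) \<le> 2 * C / norm \<mu>" "norm k \<le> 2 * C"
      using wkb_solution[OF \<rho> d\<rho> d\<rho>1 c\<rho>2 S S0 C \<mu>'] by blast
    have r\<rho>1: "((\<lambda>t. - \<rho>1 (1 - t)) has_real_derivative \<rho>2 (1 - t)) (at t within {0..1})" if "t \<in> {0..1}" for t
      using DERIV_minus[OF refl_der[OF d\<rho>1 that]] by simp
    have r\<rho>2: "continuous_on {0..1} (\<lambda>t. \<rho>2 (1 - t))"
      by (intro continuous_on_compose2[OF c\<rho>2] continuous_intros) auto
    have rS: "((\<lambda>t. S 1 - S (1 - t)) has_real_derivative 1 / (\<rho> (1 - t))\<^sup>2) (at t within {0..1})" if "t \<in> {0..1}" for t
      using DERIV_diff[OF DERIV_const[of "S 1"] refl_der[OF S that]] by simp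
    have rS0: "S 1 - S (1 - 0) = 0" by simp
    obtain h h1 G K where h:
      "\<And>t. t \<in> {0..1} \<Longrightarrow> (h has_vector_derivative h1 t) (at t within {0..1})"
      "\<And>t. t \<in> {0..1} \<Longrightarrow> (h1 has_vector_derivative (of_real (\<omega>\<^sup>2) + \<mu>\<^sup>2 * of_real (1 / \<rho> (1 - t) ^ 4)) * h t) (at t within {0..1})"
      "h 0 = of_real (\<rho> (1 - 0))" "h1 0 = of_real (- \<rho>1 (1 - 0)) + \<mu> / of_real (\<rho> (1 - 0))"
      "h 1 = of_real (\<rho> (1 - 1)) * exp (\<mu> * of_real (S 1 - S (1 - 1))) * G"
      "h1 1 = (of_real (- \<rho>1 (1 - 1)) * G + (\<mu> * G + K) / of_real (\<rho> (1 - 1))) * exp (\<mu> * of_real (S 1 - S (1 - 1)))"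
      "norm (G - 1) \<le> 2 * C / norm \<mu>" "norm K \<le> 2 * C"
      using wkb_solution[of "\<lambda>t. \<rho> (1 - t)" "\<lambda>t. - \<rho>1 (1 - t)" "\<lambda>t. \<rho>2 (1 - t)" "\<lambda>t. S 1 - S (1 - t)" \<omega> C \<mu>,
          OF \<rho>[OF refl_mem] refl_der[OF d\<rho>] r\<rho>1 r\<rho>2 rS rS0 C[OF refl_mem] \<mu>'] by blast
    define H where "H t = h (1 - t)" for t
    define H1 where "H1 t = - h1 (1 - t)" for t
    have dH: "(H has_vector_derivative H1 t) (at t within {0..1})" if "t \<in> {0..1}" for t
      unfolding H_def H1_def by (rule refl_vder[OF h(1) that])
    have dH1: "(H1 has_vector_derivative (of_real (\<omega>\<^sup>2) + \<mu>\<^sup>2 * of_real (\<psi> t)) * H t) (at t within {0..1})" if "t \<in> {0..1}" for t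
      using has_vector_derivative_minus[OF refl_vder[OF h(2) that]]
      unfolding H_def H1_def \<psi>_def by simp
    have df1: "(f1 has_vector_derivative (of_real (\<omega>\<^sup>2) + \<mu>\<^sup>2 * of_real (\<psi> t)) * f t) (at t within {0..1})" if "t \<in> {0..1}" for t
      unfolding \<psi>_def by (rule f(2)[OF that])
    have H: "H 0 = ?r0 * ?E \<mu> * G" "H1 0 = - (- ?s0 * G + (\<mu> * G + K) / ?r0) * ?E \<mu>"
      "H 1 = ?r1" "H1 1 = - (- ?s1 + \<mu> / ?r1)"
      using h(3-6) by (simp_all add: H_def H1_def S0 \<theta>_def left_diff_distrib)
    note F = f(3-6)[folded \<theta>_def]
    have W: "f 0 * H1 0 - f1 0 * H 0 = - ?E \<mu> * (2 * \<mu> * G + K)"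
      unfolding F H using \<rho>[of 0] by (simp add: field_simps)
    have "P \<mu> g k G K"
      unfolding P_def
    proof (intro conjI impI)
      assume nz: "2 * \<mu> * G + K \<noteq> 0"
      have W0: "f 0 * H1 0 - f1 0 * H 0 \<noteq> 0" unfolding W using nz by simp
      show "(\<lambda>n. grid_discr \<omega> \<psi> (\<mu>\<^sup>2) n) \<longlonglongrightarrow>
        T \<mu> g k G K"
        using discr_tendsto_trace[OF \<omega> c\<psi> f(1) df1 dH dH1 W0] unfolding W unfolding F H T_def .
    qed (use f(7,8) h(7,8) in auto)
    then show ?thesis by blast
  qed
  \<comment> \<open>The corrections are chosen for each \<mu> separately; the limits below are drawn
    from their bounds alone.\<close>
  then obtain g k G K where gk: "\<And>\<mu>. norm \<mu> \<ge> B \<Longrightarrow> Re \<mu> \<ge> norm \<mu> / 2 \<Longrightarrow> P \<mu> (g \<mu>) (k \<mu>) (G \<mu>) (K \<mu>)"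
    by metis
  have ev: "\<forall>\<^sub>F \<mu> in sector_filter. P \<mu> (g \<mu>) (k \<mu>) (G \<mu>) (K \<mu>) \<and> \<mu> \<noteq> 0"
    unfolding eventually_sector_filter
    by (rule exI[of _ B]) (use gk in \<open>auto simp: B_def\<close>)
  have inv: "((\<lambda>\<mu>. 2 * C / norm \<mu>) \<longlongrightarrow> 0) sector_filter"
    by (rule real_tendsto_divide_at_top[OF tendsto_const sector_filter_norm])
  have small: "(x \<longlongrightarrow> l) sector_filter" if "\<forall>\<^sub>F \<mu> in sector_filter. norm (x \<mu> - l) \<le> 2 * C / norm \<mu>" for x and l :: complex
    by (rule LIM_zero_cancel) (rule Lim_null_comparison[OF that inv])
  have g1: "(g \<longlongrightarrow> 1) sector_filter" and G1: "(G \<longlongrightarrow> 1) sector_filter"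
    by (rule small; use ev in \<open>auto simp: P_def elim: eventually_mono\<close>)+
  have k1: "((\<lambda>\<mu>. k \<mu> / \<mu>) \<longlongrightarrow> 0) sector_filter" and K1: "((\<lambda>\<mu>. K \<mu> / \<mu>) \<longlongrightarrow> 0) sector_filter"
    by (rule small; use ev in \<open>auto simp: P_def norm_divide divide_right_mono elim!: eventually_mono\<close>)+
  note i1 = sector_filter_inverse_tendsto
  have E1: "((\<lambda>\<mu>. exp (- (\<mu> * of_real \<theta>))) \<longlongrightarrow> 0) sector_filter"
    using sector_filter_exp_tendsto assms(8) by (simp add: \<theta>_def)
  have r: "?r0 \<noteq> 0" "?r1 \<noteq> 0" using \<rho>[of 0] \<rho>[of 1] by auto
  define D where "D \<mu> = T \<mu> (g \<mu>) (k \<mu>) (G \<mu>) (K \<mu>)" for \<mu>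
  have den: "((\<lambda>\<mu>. 2 * G \<mu> + K \<mu> / \<mu>) \<longlongrightarrow> 2 * 1 + 0) sector_filter"
    by (intro tendsto_intros G1 K1)
  then have den_ev: "\<forall>\<^sub>F \<mu> in sector_filter. 2 * G \<mu> + K \<mu> / \<mu> \<noteq> 0"
    by (rule tendsto_imp_eventually_ne) simp
  show ?thesis
  proof (rule that[of D])
    show "\<forall>\<^sub>F \<mu> in sector_filter.
       (\<lambda>n. grid_discr \<omega> (\<lambda>t. 1 / \<rho> t ^ 4) (\<mu>\<^sup>2) n) \<longlonglongrightarrow> D \<mu>"
      using ev den_ev
    proof eventually_elim
      case (elim \<mu>)
      have "2 * \<mu> * G \<mu> + K \<mu> = \<mu> * (2 * G \<mu> + K \<mu> / \<mu>)" using elim by (simp add: field_simps)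
      then have "2 * \<mu> * G \<mu> + K \<mu> \<noteq> 0" using elim by simp
      with elim show ?case unfolding P_def D_def \<psi>_def by simp
    qed
    \<comment> \<open>D(\<mu>) exp(-\<mu> \<theta>) after cancelling \<mu> and the exponentials.
      Every ingredient now has a limit: g, G tend to 1, and k/\<mu>, K/\<mu>, 1/\<mu>, exp(-\<mu>
      \<theta>) tend to 0. Only the two quotients of \<open>?r0\<close> and \<open>?r1\<close>
      survive.\<close>
    let ?T = "\<lambda>\<mu>. (?r1 * g \<mu> * (- ?s0 * G \<mu> * (1 / \<mu>) + (G \<mu> + K \<mu> / \<mu>) / ?r0)
        + (?s1 * g \<mu> * (1 / \<mu>) + (g \<mu> + k \<mu> / \<mu>) / ?r1) * (?r0 * G \<mu>)
        + (?r1 * (?s0 * (1 / \<mu>) + 1 / ?r0) + (- ?s1 * (1 / \<mu>) + 1 / ?r1) * ?r0) * (exp (- (\<mu> * of_real \<theta>)))\<^sup>2)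
       / (2 * G \<mu> + K \<mu> / \<mu>) - 2 * exp (- (\<mu> * of_real \<theta>))"
    have "(?T \<longlongrightarrow> (?r1 * 1 * (- ?s0 * 1 * 0 + (1 + 0) / ?r0)
        + (?s1 * 1 * 0 + (1 + 0) / ?r1) * (?r0 * 1)
        + (?r1 * (?s0 * 0 + 1 / ?r0) + (- ?s1 * 0 + 1 / ?r1) * ?r0) * 0\<^sup>2)
       / (2 * 1 + 0) - 2 * 0) sector_filter"
      by (intro tendsto_intros g1 G1 k1 K1 i1 E1 den r) auto
    also have "(?r1 * 1 * (- ?s0 * 1 * 0 + (1 + 0) / ?r0)
        + (?s1 * 1 * 0 + (1 + 0) / ?r1) * (?r0 * 1)
        + (?r1 * (?s0 * 0 + 1 / ?r0) + (- ?s1 * 0 + 1 / ?r1) * ?r0) * 0\<^sup>2)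
       / (2 * 1 + 0) - 2 * 0 = of_real ((\<rho> 1 / \<rho> 0 + \<rho> 0 / \<rho> 1) / 2)"
      by simp
    finally have lim: "(?T \<longlongrightarrow> of_real ((\<rho> 1 / \<rho> 0 + \<rho> 0 / \<rho> 1) / 2)) sector_filter" .
    have "\<forall>\<^sub>F \<mu> in sector_filter. ?T \<mu> = D \<mu> * exp (- (\<mu> * of_real \<theta>))"
      using ev den_ev
    proof eventually_elim
      case (elim \<mu>)
      then have \<mu>: "\<mu> \<noteq> 0" by simp
      define E where "E = ?E \<mu>"
      have E: "E \<noteq> 0" "exp (- (\<mu> * of_real \<theta>)) = 1 / E" by (auto simp: E_def exp_minus inverse_eq_divide)
      define N where "N = 2 * G \<mu> + K \<mu> / \<mu>"
      have N: "N \<noteq> 0" "2 * \<mu> * G \<mu> + K \<mu> = \<mu> * N" using elim \<mu> by (auto simp: N_def field_simps)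
      define a where "a = K \<mu> / \<mu>"
      define b where "b = k \<mu> / \<mu>"
      have ab: "K \<mu> = a * \<mu>" "k \<mu> = b * \<mu>" using \<mu> by (auto simp: a_def b_def)
      have "D \<mu> + 2 = ((?r1 * E * g \<mu>) * (- (- ?s0 * G \<mu> + (\<mu> * G \<mu> + K \<mu>) / ?r0) * E)
         - ((?s1 * g \<mu> + (\<mu> * g \<mu> + k \<mu>) / ?r1) * E) * (?r0 * E * G \<mu>)
         - ?r1 * (?s0 + \<mu> / ?r0) + (- (- ?s1 + \<mu> / ?r1)) * ?r0) / (- E * (\<mu> * N))"
        unfolding D_def T_def N E_def by simp
      also have "\<dots> = ((?r1 * g \<mu> * (- ?s0 * G \<mu> * (1 / \<mu>) + (G \<mu> + a) / ?r0)
        + (?s1 * g \<mu> * (1 / \<mu>) + (g \<mu> + b) / ?r1) * (?r0 * G \<mu>)) * E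
        + (?r1 * (?s0 * (1 / \<mu>) + 1 / ?r0) + (- ?s1 * (1 / \<mu>) + 1 / ?r1) * ?r0) * (1 / E)) / N"
      proof -
        have "(?r1 * E * g \<mu>) * (- (- ?s0 * G \<mu> + (\<mu> * G \<mu> + K \<mu>) / ?r0) * E)
         - ((?s1 * g \<mu> + (\<mu> * g \<mu> + k \<mu>) / ?r1) * E) * (?r0 * E * G \<mu>)
         - ?r1 * (?s0 + \<mu> / ?r0) + (- (- ?s1 + \<mu> / ?r1)) * ?r0
         = - E * \<mu> * ((?r1 * g \<mu> * (- ?s0 * G \<mu> * (1 / \<mu>) + (G \<mu> + a) / ?r0)
        + (?s1 * g \<mu> * (1 / \<mu>) + (g \<mu> + b) / ?r1) * (?r0 * G \<mu>)) * E
        + (?r1 * (?s0 * (1 / \<mu>) + 1 / ?r0) + (- ?s1 * (1 / \<mu>) + 1 / ?r1) * ?r0) * (1 / E))"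
          unfolding ab using \<mu> E(1) r by (simp add: divide_simps) (simp add: algebra_simps)
        moreover have "(- E * \<mu> * Z) / (- E * (\<mu> * N)) = Z / N" for Z
          using \<mu> E(1) N(1) by (simp add: field_simps)
        ultimately show ?thesis by (simp only:)
      qed
      finally have "D \<mu> + 2 = \<dots>" .
      moreover have "D \<mu> + 2 = (X * E + Y * (1 / E)) / N \<Longrightarrow> (X + Y * (1 / E)\<^sup>2) / N - 2 * (1 / E) = D \<mu> * (1 / E)" for X Y
      proof -
        assume "D \<mu> + 2 = (X * E + Y * (1 / E)) / N"
        then have De: "D \<mu> = (X * E + Y * (1 / E)) / N - 2" by (simp add: eq_diff_eq)
        show ?thesis unfolding De using E(1) N(1) by (simp add: field_simps power2_eq_square)
      qed
      ultimately show ?case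
        unfolding E(2) N_def a_def b_def by blast
    qed
    with lim show "((\<lambda>\<mu>. D \<mu> * exp (- (\<mu> * of_real (S 1)))) \<longlongrightarrow> of_real ((\<rho> 1 / \<rho> 0 + \<rho> 0 / \<rho> 1) / 2)) sector_filter"
      unfolding \<theta>_def[symmetric] by (rule Lim_transform_eventually)
  qed
qed

text \<open>On refining the grid the exact identity becomes
  \<open>(L s)\<^sup>2 * D \<mu> = D0\<close>, and D grows like \<kappa> exp(\<mu> \<theta>); so
  \<open>c\<^sup>2 = D0 / \<kappa>\<close>, and the square root halves the exponent. The error is
  relative and its threshold concerns Re s only, the form needed for integration along vertical
  lines.\<close>

lemma bogoliubov_norm_laplace_asymptotics:
  fixes Y :: "real \<Rightarrow> 'a \<Rightarrow> real" and \<psi> :: "real \<Rightarrow> real" and \<omega> \<theta> :: real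
  assumes M: "prob_space M" and \<omega>: "\<omega> > 0" and Y: "bogoliubov_process M \<omega> Y"
    and pos: "\<And>t. t \<in> {0..1} \<Longrightarrow> \<psi> t > 0" and C2: "C2_on {0..1} \<psi>"
    and \<theta>: "\<theta> = (LBINT t:{0..1}. sqrt (\<psi> t))"
  defines "c \<equiv> sqrt ((exp \<omega> + exp (- \<omega>) - 2) / (((\<psi> 0 / \<psi> 1) powr (1/4) + (\<psi> 1 / \<psi> 0) powr (1/4)) / 2))"
  obtains Q where "Q \<in> borel_measurable M" "\<And>x. x \<in> space M \<Longrightarrow> Q x \<ge> 0"
    "\<And>x. x \<in> space M \<Longrightarrow> weighted_norm \<psi> (\<lambda>t. Y t x) = sqrt (Q x)" "\<theta> > 0" "c > 0"
    "\<And>\<delta>. \<delta> > 0 \<Longrightarrow> \<exists>\<sigma>0>0. \<forall>s. Re s \<ge> \<sigma>0 \<longrightarrow>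
      norm ((LINT x|M. exp (- s * complex_of_real (Q x))) - of_real c * exp (- (of_real (\<theta> / 2) * csqrt (2 * s))))
        \<le> \<delta> * norm (of_real c * exp (- (of_real (\<theta> / 2) * csqrt (2 * s))))"
proof -
  interpret prob_space M by fact
  obtain \<psi>1 \<psi>2 where d\<psi>: "\<And>t. t \<in> {0..1} \<Longrightarrow> (\<psi> has_real_derivative \<psi>1 t) (at t within {0..1})"
    and d\<psi>1: "\<And>t. t \<in> {0..1} \<Longrightarrow> (\<psi>1 has_real_derivative \<psi>2 t) (at t within {0..1})"
    and c\<psi>2: "continuous_on {0..1} \<psi>2"
    using C2 unfolding C2_on_def by blast
  have c\<psi>: "continuous_on {0..1} \<psi>" and c\<psi>1: "continuous_on {0..1} \<psi>1"
    by (rule DERIV_continuous_on, rule d\<psi> d\<psi>1, assumption)+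
  \<comment> \<open>The power -1/4 is the WKB amplitude: it makes 1/\<rho>^2 = sqrt \<psi> the
    derivative of the phase \<open>S\<close>.\<close>
  define \<rho> where "\<rho> t = \<psi> t powr (-1/4)" for t
  define \<rho>1 where "\<rho>1 t = -1/4 * \<psi> t powr (-1/4 - 1) * \<psi>1 t" for t
  define \<rho>2 where "\<rho>2 t = (-1/4) * \<psi> t powr (-1/4 - 1) * \<psi>2 t + ((-1/4) * ((-1/4 - 1) * \<psi> t powr (-1/4 - 1 - 1) * \<psi>1 t)) * \<psi>1 t" for t
  define S where "S t = integral {0..t} (\<lambda>u. sqrt (\<psi> u))" for t
  have \<rho>: "\<rho> t > 0" if "t \<in> {0..1}" for t using pos[OF that] by (simp add: \<rho>_def)
  have d\<rho>: "(\<rho> has_real_derivative \<rho>1 t) (at t within {0..1})" if "t \<in> {0..1}" for t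
    unfolding \<rho>_def \<rho>1_def by (rule DERIV_chain'[OF d\<psi>[OF that] has_real_derivative_powr[OF pos[OF that]]])
  have d\<rho>1: "(\<rho>1 has_real_derivative \<rho>2 t) (at t within {0..1})" if "t \<in> {0..1}" for t
    unfolding \<rho>1_def \<rho>2_def
    by (intro DERIV_mult' DERIV_cmult d\<psi>1 that DERIV_chain'[OF d\<psi>[OF that] has_real_derivative_powr[OF pos[OF that]]])
  have c\<rho>2: "continuous_on {0..1} \<rho>2"
    unfolding \<rho>2_def using pos by (intro continuous_intros c\<psi> c\<psi>1 c\<psi>2) (auto simp: less_imp_neq[symmetric])
  have \<rho>sq: "1 / (\<rho> t)\<^sup>2 = sqrt (\<psi> t)" "1 / \<rho> t ^ 4 = \<psi> t" if "t \<in> {0..1}" for t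
  proof -
    have "(\<rho> t)\<^sup>2 = \<psi> t powr (-1/2)" "\<rho> t ^ 4 = \<psi> t powr (- 1)"
      using pos[OF that] by (simp_all add: \<rho>_def powr_power)
    then show "1 / (\<rho> t)\<^sup>2 = sqrt (\<psi> t)" "1 / \<rho> t ^ 4 = \<psi> t"
      using pos[OF that] by (simp_all add: powr_minus_divide powr_half_sqrt)
  qed
  have csq: "continuous_on {0..1} (\<lambda>u. sqrt (\<psi> u))" by (intro continuous_intros c\<psi>)
  have dS: "(S has_real_derivative 1 / (\<rho> t)\<^sup>2) (at t within {0..1})" if "t \<in> {0..1}" for t
    unfolding \<rho>sq[OF that] S_def using integral_has_real_derivative[OF csq that] .
  have S0: "S 0 = 0" by (simp add: S_def)
  have S1: "S 1 = \<theta>"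
    unfolding S_def \<theta> by (subst set_borel_integral_eq_integral(2)) (auto intro!: borel_integrable_atLeastAtMost' csq)
  have \<theta>pos: "\<theta> > 0"
  proof -
    obtain z where z: "z \<in> {0..1}" "\<And>t. t \<in> {0..1} \<Longrightarrow> sqrt (\<psi> z) \<le> sqrt (\<psi> t)"
      using continuous_attains_inf[OF compact_Icc _ csq] by fastforce
    have "integral {0..1} (\<lambda>_::real. sqrt (\<psi> z)) \<le> integral {0..1} (\<lambda>u. sqrt (\<psi> u))"
      using z by (intro integral_le integrable_continuous_real csq continuous_intros) auto
    then have "sqrt (\<psi> z) \<le> \<theta>" using S1 by (simp add: S_def)
    then show ?thesis using pos[OF z(1)] by (smt (verit) real_sqrt_gt_zero)
  qed
  define \<kappa> where "\<kappa> = (\<rho> 1 / \<rho> 0 + \<rho> 0 / \<rho> 1) / 2"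
  have \<kappa>pos: "\<kappa> > 0" using \<rho>[of 0] \<rho>[of 1] by (auto simp: \<kappa>_def intro!: add_pos_pos divide_pos_pos)
  have \<kappa>: "\<kappa> = ((\<psi> 0 / \<psi> 1) powr (1/4) + (\<psi> 1 / \<psi> 0) powr (1/4)) / 2"
    using pos[of 0] pos[of 1] by (simp add: \<kappa>_def \<rho>_def powr_minus_divide powr_divide)
  define D0 where "D0 = exp \<omega> + exp (- \<omega>) - 2"
  have D0: "D0 > 0"
  proof -
    have "D0 = (exp (\<omega> / 2) - exp (- \<omega> / 2))\<^sup>2"
      by (simp add: D0_def power2_eq_square algebra_simps exp_add[symmetric])
    then show ?thesis using \<omega> by simp
  qed
  have c: "c = sqrt (D0 / \<kappa>)" "c > 0" "c\<^sup>2 = D0 / \<kappa>"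
    using D0 \<kappa>pos by (simp_all add: c_def D0_def \<kappa>)
  obtain D where
    D: "\<forall>\<^sub>F \<mu> in sector_filter.
       (\<lambda>n. grid_discr \<omega> (\<lambda>t. 1 / \<rho> t ^ 4) (\<mu>\<^sup>2) n) \<longlonglongrightarrow> D \<mu>"
    and Dlim: "((\<lambda>\<mu>. D \<mu> * exp (- (\<mu> * of_real (S 1)))) \<longlongrightarrow> of_real ((\<rho> 1 / \<rho> 0 + \<rho> 0 / \<rho> 1) / 2)) sector_filter"
    using discr_limit_asymptotics[OF \<omega> \<rho> d\<rho> d\<rho>1 c\<rho>2 dS S0] \<theta>pos S1 by blast
  \<comment> \<open>\<open>Q\<close> is an integral path by path. By continuity of the paths it is
    the pointwise limit of the Riemann sums \<open>Qn\<close>, each a function of finitely many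
    samples, and so inherits their measurability.\<close>
  define Q where "Q x = integral {0..1} (\<lambda>t. (Y t x)\<^sup>2 * \<psi> t)" for x
  define Qn where "Qn n x = (\<Sum>k<n. \<psi> (real k / real n) / real n * (Y (real k / real n) x)\<^sup>2)" for n x
  have cY: "continuous_on {0..1} (\<lambda>t. (Y t x)\<^sup>2 * \<psi> t)" if "x \<in> space M" for x
    using Y that unfolding bogoliubov_process_def by (intro continuous_intros c\<psi>) blast
  have grid: "real k / real n \<in> {0..1}" if "k < n" for k n using that by auto
  have QnQ: "(\<lambda>n. Qn n x) \<longlonglongrightarrow> Q x" if "x \<in> space M" for x
    using riemann_sum_tendsto_integral[OF cY[OF that]] by (simp add: Qn_def Q_def mult.commute)
  note measY = bogoliubov_process_measurable[OF Y]
  have measQn[measurable]: "Qn n \<in> borel_measurable M" for n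
    unfolding Qn_def by (intro borel_measurable_sum borel_measurable_times borel_measurable_power measY grid borel_measurable_const) auto
  have measQ[measurable]: "Q \<in> borel_measurable M"
    by (rule borel_measurable_LIMSEQ_real[OF QnQ measQn])
  have Qn0: "Qn n x \<ge> 0" for n x
    unfolding Qn_def using pos[OF grid] by (intro sum_nonneg mult_nonneg_nonneg divide_nonneg_nonneg) (auto intro: less_imp_le)
  have Q0: "Q x \<ge> 0" if "x \<in> space M" for x
    by (rule LIMSEQ_le_const[OF QnQ[OF that]]) (use Qn0 in auto)
  have wn: "weighted_norm \<psi> (\<lambda>t. Y t x) = sqrt (Q x)" if "x \<in> space M" for x
    unfolding weighted_norm_def Q_def
    by (subst set_borel_integral_eq_integral(2)) (auto intro!: borel_integrable_atLeastAtMost' cY that)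
  define L where "L s = (LINT x|M. exp (- s * complex_of_real (Q x)))" for s
  have Ln: "(\<lambda>n. LINT x|M. exp (- s * complex_of_real (Qn n x))) \<longlonglongrightarrow> L s" if s: "Re s > 0" for s
    unfolding L_def
  proof (rule integral_dominated_convergence[where w="\<lambda>_. 1"])
    show "AE x in M. (\<lambda>n. exp (- s * complex_of_real (Qn n x))) \<longlonglongrightarrow> exp (- s * complex_of_real (Q x))"
      by (intro AE_I2 tendsto_intros QnQ)
    show "AE x in M. norm (exp (- s * complex_of_real (Qn n x))) \<le> 1" for n
      using Qn0 s by (intro AE_I2) (simp add: mult_nonneg_nonneg)
  qed simp_all
  have LD: "(L s)\<^sup>2 * d = of_real D0"
    if s: "Re s > 0" and d: "(\<lambda>n. grid_discr \<omega> (\<lambda>t. 1 / \<rho> t ^ 4) (2 * s) n) \<longlonglongrightarrow> d" for s d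
  proof -
    have "(LINT x|M. exp (- s * complex_of_real (Qn n x)))\<^sup>2 *
       grid_discr \<omega> (\<lambda>t. 1 / \<rho> t ^ 4) (2 * s) n = of_real D0" for n
    proof -
      have eq: "\<psi> (real k / real n) = 1 / \<rho> (real k / real n) ^ 4" if "k < n" for k
        using \<rho>sq(2)[OF grid[OF that]] by simp
      have Qe: "Qn n x = (\<Sum>k<n. 1 / \<rho> (real k / real n) ^ 4 / real n * (Y (real k / real n) x)\<^sup>2)" for x
        unfolding Qn_def by (intro sum.cong refl) (simp add: eq)
      show ?thesis unfolding Qe D0_def
        by (rule bogoliubov_discrete_laplace_complex[OF M \<omega> Y _ _ _ s]) (auto simp: divide_strict_right_mono)
    qed
    moreover have "(\<lambda>n. (LINT x|M. exp (- s * complex_of_real (Qn n x)))\<^sup>2 *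
       grid_discr \<omega> (\<lambda>t. 1 / \<rho> t ^ 4) (2 * s) n) \<longlonglongrightarrow> (L s)\<^sup>2 * d"
      by (intro tendsto_intros Ln s d)
    ultimately show ?thesis by (simp add: LIMSEQ_const_iff)
  qed
  have Lhol: "L holomorphic_on {s. Re s > 0}"
    unfolding L_def by (rule laplace_transform_holomorphic[OF M measQ Q0])
  \<comment> \<open>The quotient that must tend to 1. The identity gives access to its square only,
    so the sign is settled separately.\<close>
  define R where "R s = L s * exp (of_real (\<theta> / 2) * csqrt (2 * s)) / of_real c" for s
  have "\<exists>\<sigma>0>0. \<forall>s. Re s \<ge> \<sigma>0 \<longrightarrow> norm (R s - 1) \<le> \<delta>" if \<delta>: "\<delta> > 0" for \<delta>
  proof -
    \<comment> \<open>e \<le> 1/4 keeps |w| \<ge> 1/2 and yields |R^2 - 1| \<le> 2 e < 1, enough to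
      exclude purely imaginary values of R.\<close>
    define e where "e = min \<delta> (1/2) / 2"
    have e: "e > 0" "2 * e \<le> \<delta>" "e \<le> 1/4" using \<delta> by (auto simp: e_def)
    have "((\<lambda>\<mu>. D \<mu> * exp (- (\<mu> * of_real \<theta>)) / of_real \<kappa>) \<longlongrightarrow> of_real \<kappa> / of_real \<kappa>) sector_filter"
      using Dlim \<kappa>pos unfolding S1 \<kappa>_def[symmetric] by (intro tendsto_intros) auto
    then have "\<forall>\<^sub>F \<mu> in sector_filter. dist (D \<mu> * exp (- (\<mu> * of_real \<theta>)) / of_real \<kappa>) 1 < e"
      using \<kappa>pos e(1) by (simp add: tendsto_iff)
    from eventually_conj[OF D this] obtain B where
      B: "\<And>\<mu>. B \<le> norm \<mu> \<Longrightarrow> Re \<mu> \<ge> norm \<mu> / 2 \<Longrightarrow>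
        (\<lambda>n. grid_discr \<omega> (\<lambda>t. 1 / \<rho> t ^ 4) (\<mu>\<^sup>2) n) \<longlonglongrightarrow> D \<mu>"
        "\<And>\<mu>. B \<le> norm \<mu> \<Longrightarrow> Re \<mu> \<ge> norm \<mu> / 2 \<Longrightarrow> dist (D \<mu> * exp (- (\<mu> * of_real \<theta>)) / of_real \<kappa>) 1 < e"
      unfolding eventually_sector_filter by blast
    \<comment> \<open>|\<mu>|^2 = 2 |s| \<ge> 2 Re s, so Re s \<ge> B^2 forces |\<mu>| \<ge> B; the
      1 keeps \<open>\<sigma>0\<close> positive.\<close>
    define \<sigma>0 where "\<sigma>0 = max 1 (B\<^sup>2)"
    have \<sigma>0: "\<sigma>0 > 0" by (simp add: \<sigma>0_def)
    have R2: "norm ((R s)\<^sup>2 - 1) \<le> 2 * e" if s: "Re s \<ge> \<sigma>0" for s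
    proof -
      have s0: "Re s > 0" using s \<sigma>0 by simp
      define \<mu> where "\<mu> = csqrt (2 * s)"
      have \<mu>2: "\<mu>\<^sup>2 = 2 * s" by (simp add: \<mu>_def)
      have Re\<mu>: "Re \<mu> \<ge> 0" using csqrt_principal[of "2 * s"] by (auto simp: \<mu>_def)
      have "(Re \<mu>)\<^sup>2 - (Im \<mu>)\<^sup>2 = 2 * Re s"
        using arg_cong[OF \<mu>2, of Re] by (simp add: power2_eq_square)
      then have 1: "(Im \<mu>)\<^sup>2 \<le> (Re \<mu>)\<^sup>2" "(norm \<mu>)\<^sup>2 \<ge> 2 * Re s"
        using s0 zero_le_power2[of "Im \<mu>"] unfolding cmod_power2 by linarith+
      have "(norm \<mu> / 2)\<^sup>2 \<le> (Re \<mu>)\<^sup>2" 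
      proof -
        have "(Im \<mu>)\<^sup>2 \<le> 3 * (Re \<mu>)\<^sup>2" using 1(1) zero_le_power2[of "Re \<mu>"] by linarith
        then show ?thesis unfolding power_divide cmod_power2 by simp
      qed
      then have sec: "Re \<mu> \<ge> norm \<mu> / 2" by (rule power2_le_imp_le[OF _ Re\<mu>])
      have "\<bar>B\<bar>\<^sup>2 \<le> (norm \<mu>)\<^sup>2" using 1(2) s s0 by (simp add: \<sigma>0_def)
      then have big: "B \<le> norm \<mu>" using power2_le_imp_le[of "\<bar>B\<bar>" "norm \<mu>"] by simp
      have "(L s)\<^sup>2 * D \<mu> = of_real D0"
        using B(1)[OF big sec] unfolding \<mu>2 by (rule LD[OF s0])
      define w where "w = D \<mu> * exp (- (\<mu> * of_real \<theta>)) / of_real \<kappa>"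
      have w: "norm (w - 1) < e" using B(2)[OF big sec] by (simp add: w_def dist_norm)
      have "(R s)\<^sup>2 * w = (L s)\<^sup>2 * D \<mu> * (exp (of_real (\<theta> / 2) * \<mu>))\<^sup>2 * exp (- (\<mu> * of_real \<theta>)) / (of_real (c\<^sup>2) * of_real \<kappa>)"
        by (simp add: R_def w_def \<mu>_def power_mult_distrib power_divide)
      also have "(exp (of_real (\<theta> / 2) * \<mu>))\<^sup>2 = exp (\<mu> * of_real \<theta>)"
        by (simp add: exp_double[symmetric] mult.commute)
      also have "(L s)\<^sup>2 * D \<mu> * exp (\<mu> * of_real \<theta>) * exp (- (\<mu> * of_real \<theta>)) / (of_real (c\<^sup>2) * of_real \<kappa>) = 1"
        unfolding \<open>(L s)\<^sup>2 * D \<mu> = of_real D0\<close> c(3) using D0 \<kappa>pos by (simp add: exp_minus)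
      finally have Rw: "(R s)\<^sup>2 * w = 1" .
      have "1 \<le> norm (w - 1) + norm w" using norm_triangle_ineq4[of w "w - 1"] by simp
      then have wn: "norm w \<ge> 1/2" using w e by linarith
      have "((R s)\<^sup>2 - 1) * w = 1 - w" using Rw by (simp add: algebra_simps)
      then have "norm ((R s)\<^sup>2 - 1) * norm w = norm (w - 1)" by (metis norm_minus_commute norm_mult)
      moreover have "norm ((R s)\<^sup>2 - 1) * (1/2) \<le> norm ((R s)\<^sup>2 - 1) * norm w" using wn by (intro mult_left_mono) auto
      ultimately show ?thesis using w by linarith
    qed
    \<comment> \<open>A purely imaginary R would make R^2 a nonpositive real, at distance at least 1
      from 1.\<close>
    have Rne: "Re (R s) \<noteq> 0" if s: "Re s \<ge> \<sigma>0" for s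
    proof
      assume "Re (R s) = 0"
      then have "Re ((R s)\<^sup>2 - 1) \<le> - 1" by (simp add: power2_eq_square)
      then have "norm ((R s)\<^sup>2 - 1) \<ge> 1" using abs_Re_le_cmod[of "(R s)\<^sup>2 - 1"] by linarith
      then show False using R2[OF s] e by linarith
    qed
    have contR: "continuous_on {s. Re s \<ge> \<sigma>0} (\<lambda>s. Re (R s))"
    proof -
      have "continuous_on {s. Re s \<ge> \<sigma>0} L"
        by (rule continuous_on_subset[OF holomorphic_on_imp_continuous_on[OF Lhol]]) (use \<sigma>0 in auto)
      moreover have "continuous_on {s. Re s \<ge> \<sigma>0} (\<lambda>s. csqrt (2 * s))"
        by (rule continuous_on_compose2[OF holomorphic_on_imp_continuous_on[OF holomorphic_on_csqrt]])
          (use \<sigma>0 in \<open>auto intro!: continuous_intros simp: complex_nonpos_Reals_iff\<close>)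
      ultimately show ?thesis unfolding R_def using c(2) by (intro continuous_intros) auto
    qed
    have conn: "connected ((\<lambda>s. Re (R s)) ` {s. Re s \<ge> \<sigma>0})"
      by (rule connected_continuous_image[OF contR convex_connected[OF convex_halfspace_Re_ge]])
    have Rpos0: "Re (R (of_real \<sigma>0)) > 0"
    proof -
      have "L (of_real \<sigma>0) = of_real (LINT x|M. exp (- (\<sigma>0 * Q x)))"
        unfolding L_def integral_complex_of_real[symmetric]
        by (intro Bochner_Integration.integral_cong refl) (simp only: exp_of_real[symmetric] of_real_mult of_real_minus mult_minus_left)
      moreover have "csqrt (2 * of_real \<sigma>0) = of_real (sqrt (2 * \<sigma>0))"
        using \<sigma>0 csqrt_of_real_nonneg[of "2 * of_real \<sigma>0"] by simp
      moreover have "(LINT x|M. exp (- (\<sigma>0 * Q x))) \<ge> 0" by simp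
      ultimately have "Re (R (of_real \<sigma>0)) = (LINT x|M. exp (- (\<sigma>0 * Q x))) * exp (\<theta> / 2 * sqrt (2 * \<sigma>0)) / c"
        by (simp only: R_def exp_of_real of_real_mult[symmetric] of_real_divide[symmetric] Re_complex_of_real)
      then have "Re (R (of_real \<sigma>0)) \<ge> 0" using c(2) by simp
      then show ?thesis using Rne[of "of_real \<sigma>0"] by simp
    qed
    \<comment> \<open>Re R is continuous and nonzero on a connected half plane and positive at the
      real point \<open>\<sigma>0\<close>, where the transform is real and nonnegative; hence it is
      positive throughout.\<close>
    have Rpos: "Re (R s) > 0" if s: "Re s \<ge> \<sigma>0" for s
    proof (rule ccontr)
      assume "\<not> Re (R s) > 0"
      then have "0 \<in> (\<lambda>s. Re (R s)) ` {s. Re s \<ge> \<sigma>0}"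
      proof -
        have mem: "Re (R s) \<in> (\<lambda>s. Re (R s)) ` {s. Re s \<ge> \<sigma>0}" "Re (R (of_real \<sigma>0)) \<in> (\<lambda>s. Re (R s)) ` {s. Re s \<ge> \<sigma>0}"
          by (intro imageI; use s in simp)+
        show ?thesis
          by (rule connectedD_interval[OF conn mem]) (use Rpos0 \<open>\<not> Re (R s) > 0\<close> in linarith)+
      qed
      then obtain u where "u \<in> {s. Re s \<ge> \<sigma>0}" "0 = Re (R u)" by (rule imageE)
      then have "Re u \<ge> \<sigma>0" "Re (R u) = 0" by simp_all
      then show False using Rne by blast
    qed
    have "norm (R s - 1) \<le> \<delta>" if s: "Re s \<ge> \<sigma>0" for s
    proof -
      \<comment> \<open>Positivity of Re R gives |R + 1| \<ge> 1, so R - 1 is controlled by R^2 -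
        1.\<close>
      have "1 \<le> Re (R s + 1)" using Rpos[OF s] by simp
      then have "1 \<le> norm (R s + 1)" using complex_Re_le_cmod order_trans by blast
      then have "norm (R s - 1) * 1 \<le> norm (R s - 1) * norm (R s + 1)" by (intro mult_left_mono) auto
      also have "\<dots> = norm ((R s)\<^sup>2 - 1)" by (simp add: norm_mult[symmetric] power2_eq_square algebra_simps)
      finally show ?thesis using R2[OF s] e by simp
    qed
    then show ?thesis using \<sigma>0 by blast
  qed
  then have fin: "\<exists>\<sigma>0>0. \<forall>s. Re s \<ge> \<sigma>0 \<longrightarrow>
      norm (L s - of_real c * exp (- (of_real (\<theta> / 2) * csqrt (2 * s))))
        \<le> \<delta> * norm (of_real c * exp (- (of_real (\<theta> / 2) * csqrt (2 * s))))" if \<delta>: "\<delta> > 0" for \<delta>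
  proof -
    have "norm (L s - of_real c * exp (- (of_real (\<theta> / 2) * csqrt (2 * s))))
      = norm (R s - 1) * norm (of_real c * exp (- (of_real (\<theta> / 2) * csqrt (2 * s))))" for s
    proof -
      have "L s - of_real c * exp (- (of_real (\<theta> / 2) * csqrt (2 * s)))
        = (R s - 1) * (of_real c * exp (- (of_real (\<theta> / 2) * csqrt (2 * s))))"
        using c(2) by (simp add: R_def exp_minus field_simps)
      then show ?thesis by (simp only: norm_mult)
    qed
    moreover obtain \<sigma>0 where "\<sigma>0 > 0" "\<And>s. Re s \<ge> \<sigma>0 \<Longrightarrow> norm (R s - 1) \<le> \<delta>"
      using \<open>\<And>\<delta>. \<delta> > 0 \<Longrightarrow> \<exists>\<sigma>0>0. \<forall>s. Re s \<ge> \<sigma>0 \<longrightarrow> norm (R s - 1) \<le> \<delta>\<close>[OF \<delta>] by blast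
    ultimately show ?thesis by (metis mult_right_mono norm_ge_zero)
  qed
  show ?thesis
    by (rule that[of Q]) (use measQ Q0 wn \<theta>pos c(2) fin in \<open>auto simp: L_def\<close>)
qed

section \<open>Comparison of distribution functions through Laplace transforms\<close>

text \<open>The exponentially tilted (Esscher) law: its characteristic function is the Laplace
  transform of \<open>N\<close> on the line Re s = \<sigma>, divided by \<open>l\<close>. The factor
  \<open>l\<close> stays on the left so that the right-hand sides are linear in
  \<open>N\<close>.\<close>

lemma tilted_distribution:
  fixes N :: "real measure" and \<sigma> :: real
  assumes N: "real_distribution N" and nonneg: "AE q in N. q \<ge> 0" and \<sigma>: "\<sigma> > 0"
  defines "l \<equiv> LINT q|N. exp (- \<sigma> * q)"
  defines "T \<equiv> density N (\<lambda>q. ennreal (exp (- \<sigma> * q) / l))"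
  shows "integrable N (\<lambda>q. exp (- \<sigma> * q))" and "l > 0" and "real_distribution T"
    and "\<And>A. A \<in> sets borel \<Longrightarrow> l * measure T A = (LINT q|N. exp (- \<sigma> * q) * indicator A q)"
    and "\<And>t. of_real l * char T t = (LINT q|N. exp (- (of_real \<sigma> - \<i> * of_real t) * of_real q))"
proof -
  interpret N: real_distribution N by fact
  show int: "integrable N (\<lambda>q. exp (- \<sigma> * q))"
  proof (rule N.integrable_const_bound[where B=1])
    show "AE q in N. norm (exp (- \<sigma> * q)) \<le> 1" using nonneg by eventually_elim (use \<sigma> in simp)
  qed measurable
  show l: "l > 0"
  proof -
    have "l \<noteq> 0"
    proof
      assume "l = 0"
      then have "AE q in N. exp (- \<sigma> * q) = 0"
        using integral_nonneg_eq_0_iff_AE[OF int] by (simp add: l_def)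
      then have "AE q in N. False" by eventually_elim simp
      then show False using N.AE_False by simp
    qed
    moreover have "l \<ge> 0" unfolding l_def by (rule Bochner_Integration.integral_nonneg) simp
    ultimately show ?thesis by simp
  qed
  have T_sets: "sets T = sets borel" by (simp add: T_def)
  have d[measurable]: "(\<lambda>q. exp (- \<sigma> * q) / l) \<in> borel_measurable N" by measurable
  have Tint: "(LINT q|T. f q) = (LINT q|N. (exp (- \<sigma> * q) / l) *\<^sub>R f q)"
    if "f \<in> borel_measurable borel" for f :: "real \<Rightarrow> 'c::{banach, second_countable_topology}"
    unfolding T_def using that l by (intro integral_density) auto
  have "emeasure T (space T) = (\<integral>\<^sup>+q. ennreal (exp (- \<sigma> * q) / l) \<partial>N)"
    unfolding T_def by (subst emeasure_density) (auto intro!: nn_integral_cong)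
  also have "\<dots> = ennreal (LINT q|N. exp (- \<sigma> * q) / l)"
    using l int by (intro nn_integral_eq_integral) auto
  also have "(LINT q|N. exp (- \<sigma> * q) / l) = 1"
    using l by (simp add: l_def)
  finally have P: "prob_space T" by (intro prob_spaceI) simp
  show RT: "real_distribution T"
    by (intro real_distribution.intro P real_distribution_axioms.intro T_sets)
  interpret T: real_distribution T by fact
  show "l * measure T A = (LINT q|N. exp (- \<sigma> * q) * indicator A q)" if A: "A \<in> sets borel" for A
  proof -
    have "measure T A = (LINT q|T. indicator A q)" using A by simp
    also have "\<dots> = (LINT q|N. (exp (- \<sigma> * q) * indicator A q) / l)"
      using A by (subst Tint) auto
    finally show ?thesis using l by simp
  qed
  show "of_real l * char T t = (LINT q|N. exp (- (of_real \<sigma> - \<i> * of_real t) * of_real q))" for t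
  proof -
    have "char T t = (LINT q|N. (exp (- \<sigma> * q) / l) *\<^sub>R iexp (t * q))"
      unfolding char_def by (rule Tint) measurable
    also have "\<dots> = (LINT q|N. exp (- (of_real \<sigma> - \<i> * of_real t) * of_real q) / of_real l)"
    proof (intro Bochner_Integration.integral_cong refl)
      fix q
      have "exp (- (of_real \<sigma> - \<i> * of_real t) * of_real q) = exp (complex_of_real (- \<sigma> * q)) * iexp (t * q)"
        unfolding exp_add[symmetric] by (simp add: algebra_simps)
      then show "(exp (- \<sigma> * q) / l) *\<^sub>R iexp (t * q) = exp (- (of_real \<sigma> - \<i> * of_real t) * of_real q) / of_real l"
        by (simp only: exp_of_real scaleR_conv_of_real of_real_divide times_divide_eq_left)
    qed
    finally show ?thesis using l by simp
  qed
qed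

text \<open>Levy inversion of both tilted laws with the same kernel; the difference is estimated
  before the cutoff tends to infinity. The kernel is at most b - a in modulus, so the bound is
  linear in the length of the interval, which the later average over lengths exploits.\<close>

lemma tilted_interval_comparison_atomless:
  fixes N1 N2 :: "real measure" and \<sigma> C :: real and g :: "real \<Rightarrow> real"
  assumes N1: "real_distribution N1" "AE q in N1. q \<ge> 0" and N2: "real_distribution N2" "AE q in N2. q \<ge> 0"
    and \<sigma>: "\<sigma> > 0" and g: "integrable lborel g"
    and bd: "\<And>t. norm ((LINT q|N1. exp (- (of_real \<sigma> - \<i> * of_real t) * complex_of_real q))
      - of_real C * (LINT q|N2. exp (- (of_real \<sigma> - \<i> * of_real t) * of_real q))) \<le> g t"
    and ab: "a \<le> b" and atoms: "measure N1 {a} = 0" "measure N1 {b} = 0" "measure N2 {a} = 0" "measure N2 {b} = 0"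
  shows "\<bar>(LINT q|N1. exp (- \<sigma> * q) * indicator {a<..b} q) - C * (LINT q|N2. exp (- \<sigma> * q) * indicator {a<..b} q)\<bar>
    \<le> (b - a) * (LINT t|lborel. g t) / (2 * pi)"
proof -
  \<comment> \<open>At t = 0 the quotient is 0 by the convention for division by zero, which
    respects the bound \<open>b - a\<close>.\<close>
  define F where "F = (\<lambda>t::real. (iexp (- (t * a)) - iexp (- (t * b))) / (\<i> * of_real t))"
  have F_meas[measurable]: "F \<in> borel_measurable borel" unfolding F_def by measurable
  define L where "L N t = (LINT q|N. exp (- (of_real \<sigma> - \<i> * of_real t) * complex_of_real q))" for N t
  let ?I = "\<lambda>N (T::nat). CLBINT t=ereal (- real T)..ereal (real T). F t * L N t"
  let ?J = "\<lambda>N (T::nat). CLBINT t:{- real T<..<real T}. F t * L N t"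
  define \<nu> where "\<nu> N = (LINT q|N. exp (- \<sigma> * q) * indicator {a<..b} q)" for N :: "real measure"
  have F_bound: "norm (F t) \<le> b - a" for t
  proof (cases "t = 0")
    case False
    then have "norm (F t) \<le> - a - - b"
      using Levy_Inversion_aux2[of "- b" "- a" t] ab by (simp only: F_def mult_minus_right neg_le_iff_le simp_thms True_implies_equals)
    then show ?thesis by simp
  qed (use ab in \<open>simp add: F_def\<close>)
  have inv: "(\<lambda>T::nat. 1 / (2 * pi) * ?I N T) \<longlonglongrightarrow> of_real (\<nu> N)
      \<and> (\<forall>T::nat. set_integrable lborel {- real T<..<real T} (\<lambda>t. F t * L N t))"
    if N: "real_distribution N" "AE q in N. q \<ge> 0" "measure N {a} = 0" "measure N {b} = 0" for N
  proof -
    define l where "l = (LINT q|N. exp (- \<sigma> * q))"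
    define T where "T = density N (\<lambda>q. ennreal (exp (- \<sigma> * q) / l))"
    note tilt = tilted_distribution[OF N(1,2) \<sigma>, folded l_def, folded T_def]
    interpret T: real_distribution T by (rule tilt(3))
    interpret N: real_distribution N by fact
    have L: "L N t = of_real l * char T t" for t by (simp add: L_def tilt(5))
    have "(\<lambda>q. exp (- \<sigma> * q) * indicator {x} q) = (\<lambda>q. exp (- \<sigma> * x) * indicator {x} q)" for x
      by (auto split: split_indicator)
    then have "(LINT q|N. exp (- \<sigma> * q) * indicator {x} q) = exp (- \<sigma> * x) * measure N {x}" for x
      by simp
    with N(3,4) have "(LINT q|N. exp (- \<sigma> * q) * indicator {a} q) = 0" "(LINT q|N. exp (- \<sigma> * q) * indicator {b} q) = 0"
      by simp_all
    then have T0: "measure T {a} = 0" "measure T {b} = 0"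
      using tilt(4)[of "{a}"] tilt(4)[of "{b}"] tilt(2) by auto
    have lim: "(\<lambda>T'::nat. 1 / (2 * pi) * (CLBINT t=ereal (- real T')..ereal (real T'). F t * char T t)) \<longlonglongrightarrow> of_real (measure T {a<..b})"
      using T.Levy_Inversion[OF ab T0] by (simp add: F_def)
    have "(\<lambda>T'::nat. of_real l * (1 / (2 * pi) * (CLBINT t=ereal (- real T')..ereal (real T'). F t * char T t))) \<longlonglongrightarrow> of_real l * of_real (measure T {a<..b})"
      by (intro tendsto_intros lim)
    moreover have "of_real l * of_real (measure T {a<..b}) = complex_of_real (\<nu> N)"
      using tilt(4)[of "{a<..b}"] by (simp add: \<nu>_def flip: of_real_mult)
    moreover have "of_real l * (1 / (2 * pi) * (CLBINT t=ereal (- real T')..ereal (real T'). F t * char T t)) = 1 / (2 * pi) * ?I N T'" for T' :: nat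
    proof -
      have "?I N T' = (CLBINT t=ereal (- real T')..ereal (real T'). of_real l * (F t * char T t))"
        unfolding L by (simp only: mult.left_commute)
      also have "\<dots> = of_real l * (CLBINT t=ereal (- real T')..ereal (real T'). F t * char T t)" by (rule interval_lebesgue_integral_mult_right)
      finally show ?thesis by (simp only: mult.left_commute)
    qed
    ultimately have 1: "(\<lambda>T::nat. 1 / (2 * pi) * ?I N T) \<longlonglongrightarrow> of_real (\<nu> N)" by simp
    have "set_integrable lborel {-T'<..<T'} (\<lambda>t. F t * L N t)" for T' :: real
      unfolding set_integrable_def
    proof (rule Bochner_Integration.integrable_bound)
      show "integrable lborel (\<lambda>t. ((b - a) * l) * indicator {-T'<..<T'} t)"
        by (intro integrable_mult_right integrable_real_indicator emeasure_bounded_finite) auto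
      show "(\<lambda>t. indicator {-T'<..<T'} t *\<^sub>R (F t * L N t)) \<in> borel_measurable lborel" unfolding L by measurable
      have "norm (F t * L N t) \<le> (b - a) * l" for t
        unfolding L norm_mult[of "F t"] using F_bound[of t] T.cmod_char_le_1[of t] tilt(2) ab
        by (intro mult_mono) (auto simp: norm_mult mult_left_le)
      then show "AE t in lborel. norm (indicator {-T'<..<T'} t *\<^sub>R (F t * L N t)) \<le> norm ((b - a) * l * indicator {-T'<..<T'} t)"
        by (intro AE_I2) (auto split: split_indicator intro: order_trans[OF _ abs_ge_self])
    qed
    with 1 show ?thesis by blast
  qed
  note i1 = inv[OF N1 atoms(1,2)] and i2 = inv[OF N2 atoms(3,4)]
  have lim: "(\<lambda>T::nat. norm (1 / (2 * pi) * ?I N1 T - of_real C * (1 / (2 * pi) * ?I N2 T)))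
     \<longlonglongrightarrow> norm (complex_of_real (\<nu> N1) - of_real C * of_real (\<nu> N2))"
    using i1 i2 by (intro tendsto_intros) auto
  have g0: "g t \<ge> 0" for t using bd[of t] norm_ge_zero order_trans by blast
  have "norm (1 / (2 * pi) * ?I N1 T - of_real C * (1 / (2 * pi) * ?I N2 T))
     \<le> (b - a) * (LINT t|lborel. g t) / (2 * pi)" for T :: nat
  proof -
    have S: "(CLBINT t=ereal (- real T)..ereal (real T). f t) = (CLBINT t:{- real T<..<real T}. f t)" for f :: "real \<Rightarrow> complex"
      by (subst interval_lebesgue_integral_le_eq) auto
    have i2': "set_integrable lborel {- real T<..<real T} (\<lambda>t. of_real C * (F t * L N2 t))"
      using i2 by (intro set_integrable_mult_right) auto
    have "?J N1 T - of_real C * ?J N2 T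
      = ?J N1 T - (CLBINT t:{- real T<..<real T}. of_real C * (F t * L N2 t))"
      by (simp only: set_integral_mult_right)
    also have "\<dots> = (CLBINT t:{- real T<..<real T}. F t * L N1 t - of_real C * (F t * L N2 t))"
      using i1 i2' by (intro set_integral_diff(2)[symmetric]) auto
    also have "norm \<dots> \<le> (LINT t|lborel. (b - a) * g t)"
      unfolding set_lebesgue_integral_def
    proof (rule Bochner_Integration.integral_norm_bound[THEN order_trans], rule integral_mono)
      show "integrable lborel (\<lambda>t. norm (indicator {- real T<..<real T} t *\<^sub>R (F t * L N1 t - of_real C * (F t * L N2 t))))"
        using i1 i2' unfolding set_integrable_def[symmetric]
        by (intro integrable_norm) (auto simp: set_integrable_def[symmetric] intro!: set_integral_diff(1))
      show "integrable lborel (\<lambda>t. (b - a) * g t)" using g by simp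
      fix t
      have "norm (F t * L N1 t - of_real C * (F t * L N2 t)) = norm (F t) * norm (L N1 t - of_real C * L N2 t)"
        unfolding norm_mult[symmetric] by (simp add: algebra_simps)
      also have "\<dots> \<le> (b - a) * g t"
        using F_bound[of t] bd[of t] ab by (intro mult_mono) (auto simp: L_def)
      finally show "norm (indicator {- real T<..<real T} t *\<^sub>R (F t * L N1 t - of_real C * (F t * L N2 t))) \<le> (b - a) * g t"
        using g0[of t] ab by (auto split: split_indicator)
    qed
    finally have *: "norm (?J N1 T - of_real C * ?J N2 T) \<le> (b - a) * (LINT t|lborel. g t)"
      by simp
    have "1 / (2 * pi) * ?I N1 T - of_real C * (1 / (2 * pi) * ?I N2 T)
      = (?J N1 T - of_real C * ?J N2 T) / of_real (2 * pi)"
      unfolding S by (simp add: diff_divide_distrib)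
    then show ?thesis using divide_right_mono[OF *, of "2 * pi"] by (simp only: norm_divide norm_of_real) simp
  qed
  then have "norm (complex_of_real (\<nu> N1) - of_real C * of_real (\<nu> N2)) \<le> (b - a) * (LINT t|lborel. g t) / (2 * pi)"
    by (intro LIMSEQ_le_const2[OF lim]) auto
  moreover have "norm (complex_of_real (\<nu> N1) - of_real C * of_real (\<nu> N2)) = \<bar>\<nu> N1 - C * \<nu> N2\<bar>"
    by (simp only: of_real_mult[symmetric] of_real_diff[symmetric] norm_of_real)
  ultimately show ?thesis by (simp add: \<nu>_def)
qed

text \<open>Levy inversion asks for endpoints that are not atoms. A finite measure has countably
  many atoms, so each interval to the right of \<open>x\<close> contains a point that is an atom of
  neither law.\<close>

lemma atomless_sequence_from_right:
  fixes N1 N2 :: "real measure"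
  assumes "finite_measure N1" "finite_measure N2"
  obtains u where "u \<longlonglongrightarrow> (x::real)" "\<And>n. x < u n" "\<And>n. u n < x + 1 / real (Suc n)"
    "\<And>n. measure N1 {u n} = 0" "\<And>n. measure N2 {u n} = 0"
proof -
  define S where "S = {y. measure N1 {y} \<noteq> 0} \<union> {y. measure N2 {y} \<noteq> 0}"
  have S: "countable S"
    unfolding S_def using assms by (intro countable_Un finite_measure.countable_support)
  have "\<exists>y. y \<in> {x<..<x + 1 / real (Suc n)} - S" for n
  proof (rule ccontr)
    assume "\<not> ?thesis"
    then have "{x<..<x + 1 / real (Suc n)} \<subseteq> S" by blast
    then have "countable {x<..<x + 1 / real (Suc n)}" using S by (rule countable_subset)
    then show False using uncountable_open_interval[of x "x + 1 / real (Suc n)"] by simp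
  qed
  then obtain u where u: "\<And>n. u n \<in> {x<..<x + 1 / real (Suc n)} - S" by metis
  show ?thesis
  proof (rule that[of u])
    show "u \<longlonglongrightarrow> x"
    proof (rule tendsto_sandwich[where f="\<lambda>_. x" and h="\<lambda>n. x + inverse (real (Suc n))"])
      have "(\<lambda>n. x + inverse (real (Suc n))) \<longlonglongrightarrow> x + 0"
        by (intro tendsto_add tendsto_const LIMSEQ_inverse_real_of_nat)
      then show "(\<lambda>n. x + inverse (real (Suc n))) \<longlonglongrightarrow> x" by simp
    qed (use u in \<open>auto simp: inverse_eq_divide intro!: always_eventually less_imp_le\<close>)
  qed (use u in \<open>auto simp: S_def\<close>)
qed

text \<open>Approach from strictly above matches intervals open on the left and closed on the right:
  the indicators converge at every point, endpoints included.\<close>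

lemma indicator_right_limit:
  fixes a b :: real
  assumes u: "u \<longlonglongrightarrow> a" "\<And>n. a < u n" and v: "v \<longlonglongrightarrow> b" "\<And>n. b < v n"
  shows "(\<lambda>n. indicator {u n<..v n} q :: real) \<longlonglongrightarrow> indicator {a<..b} q"
proof (rule tendsto_eventually)
  have 1: "\<forall>\<^sub>F n in sequentially. (u n < q) = (a < q)"
  proof (cases "a < q")
    case True
    then show ?thesis using order_tendstoD(2)[OF u(1)] by (auto elim: eventually_mono)
  next
    case False
    then show ?thesis using u(2) by (auto intro!: always_eventually) (meson less_trans)
  qed
  have 2: "\<forall>\<^sub>F n in sequentially. (q \<le> v n) = (q \<le> b)"
  proof (cases "b < q")
    case True
    then show ?thesis using order_tendstoD(2)[OF v(1) True] by (simp add: not_le)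
  next
    case False
    have "q \<le> v n" for n using False v(2)[of n] by linarith
    then show ?thesis using False by simp
  qed
  show "\<forall>\<^sub>F n in sequentially. indicator {u n<..v n} q = (indicator {a<..b} q :: real)"
    using 1 2 by eventually_elim (auto simp: indicator_def)
qed

text \<open>Removes the condition on atoms by moving both endpoints slightly to the right and
  passing to the limit.\<close>

lemma tilted_interval_comparison:
  fixes N1 N2 :: "real measure" and \<sigma> C :: real and g :: "real \<Rightarrow> real"
  assumes N1: "real_distribution N1" "AE q in N1. q \<ge> 0" and N2: "real_distribution N2" "AE q in N2. q \<ge> 0"
    and \<sigma>: "\<sigma> > 0" and g: "integrable lborel g"
    and bd: "\<And>t. norm ((LINT q|N1. exp (- (of_real \<sigma> - \<i> * of_real t) * complex_of_real q))
      - of_real C * (LINT q|N2. exp (- (of_real \<sigma> - \<i> * of_real t) * of_real q))) \<le> g t"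
    and ab: "a < b"
  shows "\<bar>(LINT q|N1. exp (- \<sigma> * q) * indicator {a<..b} q) - C * (LINT q|N2. exp (- \<sigma> * q) * indicator {a<..b} q)\<bar>
    \<le> (b - a) * (LINT t|lborel. g t) / (2 * pi)"
proof -
  interpret N1: real_distribution N1 by fact
  interpret N2: real_distribution N2 by fact
  obtain u where u: "u \<longlonglongrightarrow> a" "\<And>n. a < u n" "\<And>n. u n < a + 1 / real (Suc n)"
    "\<And>n. measure N1 {u n} = 0" "\<And>n. measure N2 {u n} = 0"
    using atomless_sequence_from_right[OF N1.finite_measure_axioms N2.finite_measure_axioms] by blast
  obtain v where v: "v \<longlonglongrightarrow> b" "\<And>n. b < v n" "\<And>n. v n < b + 1 / real (Suc n)"
    "\<And>n. measure N1 {v n} = 0" "\<And>n. measure N2 {v n} = 0"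
    using atomless_sequence_from_right[OF N1.finite_measure_axioms N2.finite_measure_axioms] by blast
  have lim: "(\<lambda>n. LINT q|N. exp (- \<sigma> * q) * indicator {u n<..v n} q) \<longlonglongrightarrow> (LINT q|N. exp (- \<sigma> * q) * indicator {a<..b} q)"
    if N: "real_distribution N" "AE q in N. q \<ge> 0" for N
  proof -
    interpret N: real_distribution N by fact
    show ?thesis
    proof (rule integral_dominated_convergence[where w="\<lambda>_. 1"])
      show "AE q in N. (\<lambda>n. exp (- \<sigma> * q) * indicator {u n<..v n} q) \<longlonglongrightarrow> exp (- \<sigma> * q) * indicator {a<..b} q"
        by (intro AE_I2 tendsto_mult tendsto_const indicator_right_limit u v)
      show "AE q in N. norm (exp (- \<sigma> * q) * indicator {u n<..v n} q) \<le> 1" for n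
        using N(2) by eventually_elim (use \<sigma> in \<open>auto split: split_indicator\<close>)
    qed simp_all
  qed
  have L: "(\<lambda>n. \<bar>(LINT q|N1. exp (- \<sigma> * q) * indicator {u n<..v n} q) - C * (LINT q|N2. exp (- \<sigma> * q) * indicator {u n<..v n} q)\<bar>)
     \<longlonglongrightarrow> \<bar>(LINT q|N1. exp (- \<sigma> * q) * indicator {a<..b} q) - C * (LINT q|N2. exp (- \<sigma> * q) * indicator {a<..b} q)\<bar>"
    by (intro tendsto_intros lim N1 N2)
  have R: "(\<lambda>n. (v n - u n) * (LINT t|lborel. g t) / (2 * pi)) \<longlonglongrightarrow> (b - a) * (LINT t|lborel. g t) / (2 * pi)"
    by (intro tendsto_intros u v) simp
  have "\<forall>\<^sub>F n in sequentially. u n < b" using order_tendstoD(2)[OF u(1) ab] .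
  then have "\<forall>\<^sub>F n in sequentially. \<bar>(LINT q|N1. exp (- \<sigma> * q) * indicator {u n<..v n} q) - C * (LINT q|N2. exp (- \<sigma> * q) * indicator {u n<..v n} q)\<bar>
     \<le> (v n - u n) * (LINT t|lborel. g t) / (2 * pi)"
  proof eventually_elim
    case (elim n)
    then have "u n \<le> v n" using v(2)[of n] by simp
    then show ?case
      by (intro tilted_interval_comparison_atomless[OF N1 N2 \<sigma> g bd] u v)
  qed
  then show ?thesis by (intro tendsto_le[OF _ R L]) simp_all
qed

text \<open>Undo the exponential tilt: \<open>exp (- \<sigma> * (x - q))\<close> is the probability that an exponential
  variable of rate \<open>\<sigma>\<close> exceeds \<open>x - q\<close>, so the distribution function is an exponential average of
  tilted interval masses.\<close>

lemma cdf_eq_exponential_average: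
  fixes N :: "real measure" and \<sigma> x :: real
  assumes N: "real_distribution N" "AE q in N. q \<ge> 0" and \<sigma>: "\<sigma> > 0"
  defines "E \<equiv> density lborel (exponential_density \<sigma>)"
  shows "measure N {..x} = exp (\<sigma> * x) * (LINT v|E. (LINT q|N. exp (- \<sigma> * q) * indicator {x - v<..x} q))"
    and "integrable E (\<lambda>v. LINT q|N. exp (- \<sigma> * q) * indicator {x - v<..x} q)"
proof -
  interpret N: real_distribution N by fact
  interpret E: prob_space E unfolding E_def by (rule prob_space_exponential_density[OF \<sigma>])
  interpret P: pair_prob_space N E ..
  have setsE[measurable_cong]: "sets E = sets borel" by (simp add: E_def)
  have dE: "distributed E lborel (\<lambda>v. v) (exponential_density \<sigma>)"
    unfolding distributed_def E_def by (auto simp: distr_id2 exponential_density_def cong: distr_cong)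
  have tail: "measure E {y<..} = exp (- y * \<sigma>)" if "y \<ge> 0" for y
    using E.exponential_distributedD_gt[OF dE that \<sigma>] by (simp add: E_def greaterThan_def)
  have int: "integrable (N \<Otimes>\<^sub>M E) (\<lambda>(q, v). exp (- \<sigma> * q) * indicator {x - v<..x} q)"
  proof (rule P.P.integrable_const_bound[where B=1])
    have "AE z in N \<Otimes>\<^sub>M E. fst z \<ge> 0"
    proof (rule P.AE_pair_measure)
      show "{z \<in> space (N \<Otimes>\<^sub>M E). fst z \<ge> 0} \<in> sets (N \<Otimes>\<^sub>M E)" by measurable
      show "AE q in N. AE v in E. fst (q, v) \<ge> 0" using N(2) by eventually_elim simp
    qed
    then show "AE z in N \<Otimes>\<^sub>M E. norm (case z of (q, v) \<Rightarrow> exp (- \<sigma> * q) * indicator {x - v<..x} q) \<le> 1"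
      by eventually_elim (use \<sigma> in \<open>auto split: split_indicator\<close>)
    have "(\<lambda>(q, v). exp (- \<sigma> * q) * indicator {x - v<..x} q)
      = (\<lambda>z. exp (- \<sigma> * fst z) * (if x - snd z < fst z \<and> fst z \<le> x then 1 else 0 :: real))"
      by (auto simp: fun_eq_iff)
    also have "\<dots> \<in> borel_measurable (N \<Otimes>\<^sub>M E)" by measurable
    finally show "(\<lambda>(q, v). exp (- \<sigma> * q) * indicator {x - v<..x} q :: real) \<in> borel_measurable (N \<Otimes>\<^sub>M E)" .
  qed
  show "integrable E (\<lambda>v. LINT q|N. exp (- \<sigma> * q) * indicator {x - v<..x} q)"
    using P.integrable_snd[OF int] by simp
  have "(LINT v|E. (LINT q|N. exp (- \<sigma> * q) * indicator {x - v<..x} q)) = (LINT q|N. (LINT v|E. exp (- \<sigma> * q) * indicator {x - v<..x} q))"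
    using P.Fubini_integral[OF int] by simp
  also have "\<dots> = (LINT q|N. exp (- \<sigma> * x) * indicator {..x} q)"
  proof (intro Bochner_Integration.integral_cong refl)
    fix q
    have "(LINT v|E. exp (- \<sigma> * q) * indicator {x - v<..x} q) = (LINT v|E. (exp (- \<sigma> * q) * indicator {..x} q) * indicator {x - q<..} v)"
      by (intro Bochner_Integration.integral_cong refl) (auto split: split_indicator)
    also have "\<dots> = exp (- \<sigma> * q) * indicator {..x} q * measure E {x - q<..}"
      by (simp add: E_def)
    also have "\<dots> = exp (- \<sigma> * x) * indicator {..x} q"
      by (cases "q \<le> x") (simp_all add: tail exp_add[symmetric] algebra_simps)
    finally show "(LINT v|E. exp (- \<sigma> * q) * indicator {x - v<..x} q) = exp (- \<sigma> * x) * indicator {..x} q" .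
  qed
  also have "\<dots> = exp (- \<sigma> * x) * measure N {..x}" by simp
  finally show "measure N {..x} = exp (\<sigma> * x) * (LINT v|E. (LINT q|N. exp (- \<sigma> * q) * indicator {x - v<..x} q))"
    by (simp add: exp_minus)
qed

text \<open>The interval bound for {x - v<..x} is linear in v, and v has mean 1/\<sigma> under the
  exponential law; undoing the tilt contributes exp(\<sigma> x). This is the origin of the factor
  exp(\<sigma> x)/\<sigma>.\<close>

lemma cdf_comparison_via_laplace:
  fixes N1 N2 :: "real measure" and \<sigma> C :: real and g :: "real \<Rightarrow> real"
  assumes N1: "real_distribution N1" "AE q in N1. q \<ge> 0" and N2: "real_distribution N2" "AE q in N2. q \<ge> 0"
    and \<sigma>: "\<sigma> > 0" and g: "integrable lborel g"
    and bd: "\<And>t. norm ((LINT q|N1. exp (- (of_real \<sigma> - \<i> * of_real t) * complex_of_real q))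
      - of_real C * (LINT q|N2. exp (- (of_real \<sigma> - \<i> * of_real t) * of_real q))) \<le> g t"
  shows "\<bar>measure N1 {..x} - C * measure N2 {..x}\<bar> \<le> exp (\<sigma> * x) / \<sigma> * (LINT t|lborel. g t) / (2 * pi)"
proof -
  define E where "E = density lborel (exponential_density \<sigma>)"
  interpret E: prob_space E unfolding E_def by (rule prob_space_exponential_density[OF \<sigma>])
  have dE: "distributed E lborel (\<lambda>v. v) (exponential_density \<sigma>)"
    unfolding distributed_def E_def by (auto simp: distr_id2 exponential_density_def cong: distr_cong)
  have mean: "(LINT v|E. v) = 1 / \<sigma>" using E.exponential_distributed_expectation[OF \<sigma> dE] .
  \<comment> \<open>A nonintegrable function has integral 0 by convention, so the nonzero mean
    already gives integrability.\<close>
  then have intv: "integrable E (\<lambda>v. v)" using \<sigma> not_integrable_integral_eq[of E "\<lambda>v. v"] by auto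
  have pos: "AE v in E. v > 0"
  proof -
    have "E.prob {0<..} = 1"
      using E.exponential_distributedD_gt[OF dE _ \<sigma>, of 0] by (simp add: E_def greaterThan_def)
    then show ?thesis using E.AE_in_set_eq_1[of "{0<..}"] by (simp add: E_def)
  qed
  define n where "n N v = (LINT q|N. exp (- \<sigma> * q) * indicator {x - v<..x} q)" for N v
  note e1 = cdf_eq_exponential_average[OF N1 \<sigma>, of x, folded E_def, folded n_def]
  note e2 = cdf_eq_exponential_average[OF N2 \<sigma>, of x, folded E_def, folded n_def]
  let ?J = "(LINT t|lborel. g t) / (2 * pi)"
  have "\<bar>measure N1 {..x} - C * measure N2 {..x}\<bar> = \<bar>exp (\<sigma> * x) * (LINT v|E. n N1 v - C * n N2 v)\<bar>"
    using e1(2) e2(2) by (simp add: e1(1) e2(1) algebra_simps)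
  moreover have "\<bar>LINT v|E. n N1 v - C * n N2 v\<bar> \<le> (LINT v|E. ?J * v)"
  proof (rule order_trans[OF integral_abs_bound], rule integral_mono_AE)
    show "integrable E (\<lambda>v. \<bar>n N1 v - C * n N2 v\<bar>)" using e1(2) e2(2) by auto
    show "integrable E (\<lambda>v. ?J * v)" using intv by simp
    show "AE v in E. \<bar>n N1 v - C * n N2 v\<bar> \<le> ?J * v"
      using pos
    proof eventually_elim
      case (elim v)
      then show ?case
        using tilted_interval_comparison[OF N1 N2 \<sigma> g bd, of "x - v" x] by (simp add: n_def mult.commute)
    qed
  qed
  ultimately have "\<bar>measure N1 {..x} - C * measure N2 {..x}\<bar> \<le> exp (\<sigma> * x) * (LINT v|E. ?J * v)"
    unfolding abs_mult by (simp only: abs_exp_cancel) (intro mult_left_mono, simp_all)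
  also have "\<dots> = exp (\<sigma> * x) / \<sigma> * (LINT t|lborel. g t) / (2 * pi)"
    using mean by simp
  finally show ?thesis .
qed

section \<open>The law of an inverse squared normal variable\<close>

abbreviation (input) normal_law :: "real measure" where "normal_law \<equiv> std_normal_distribution"
abbreviation (input) \<phi> :: "real \<Rightarrow> real" where "\<phi> \<equiv> std_normal_density"

lemma std_normal_measure_eq:
  assumes "A \<in> sets borel"
  shows "measure normal_law A = (LINT z:A|lborel. \<phi> z)"
proof -
  have "measure normal_law A = (LINT z|normal_law. indicator A z)" using assms by simp
  also have "\<dots> = (LINT z|lborel. \<phi> z *\<^sub>R indicator A z)"
    using assms by (intro integral_density) auto
  finally show ?thesis by (simp add: set_lebesgue_integral_def mult.commute)
qed

text \<open>Splitting off the mass below x - 1 leaves an integral over a compact interval, to which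
  the fundamental theorem of calculus applies.\<close>

lemma std_normal_cdf_deriv:
  "((\<lambda>x. measure normal_law {..x}) has_real_derivative \<phi> x) (at x)"
proof -
  interpret prob_space normal_law by (intro prob_space_normal_density) simp
  define c where "c = x - 1"
  have cont: "continuous_on {c..x + 1} \<phi>"
    unfolding normal_density_def by (intro continuous_intros) auto
  have "((\<lambda>y. integral {c..y} \<phi>) has_real_derivative \<phi> x) (at x within {c..x + 1})"
    by (rule integral_has_real_derivative[OF cont]) (auto simp: c_def)
  moreover have "at x within {c..x + 1} = at x"
    by (rule at_within_interior) (auto simp: c_def)
  ultimately have "((\<lambda>y. integral {c..y} \<phi>) has_real_derivative \<phi> x) (at x)" by simp
  then have d: "((\<lambda>y. prob {..<c} + integral {c..y} \<phi>) has_real_derivative \<phi> x) (at x)"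
    using DERIV_add[OF DERIV_const] by fastforce
  have eq: "prob {..<c} + integral {c..y} \<phi> = prob {..y}" if "y > c" for y
  proof -
    have c2: "continuous_on {c..y} \<phi>"
      unfolding normal_density_def by (intro continuous_intros) auto
    have "prob {c..y} = integral {c..y} \<phi>"
      by (subst std_normal_measure_eq, simp, rule set_borel_integral_eq_integral(2), rule borel_integrable_atLeastAtMost'[OF c2])
    moreover have "prob ({..<c} \<union> {c..y}) = prob {..<c} + prob {c..y}"
      by (rule finite_measure_Union) auto
    moreover have "{..<c} \<union> {c..y} = {..y}" using that by auto
    ultimately show ?thesis by simp
  qed
  show ?thesis
  proof (rule DERIV_cong_ev[THEN iffD1, OF refl _ refl d])
    have "\<forall>\<^sub>F y in nhds x. y \<in> {c<..}" by (rule eventually_nhds_in_open) (auto simp: c_def)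
    then show "\<forall>\<^sub>F y in nhds x. prob {..<c} + integral {c..y} \<phi> = prob {..y}"
      by eventually_elim (rule eq, simp)
  qed
qed

lemma std_normal_cdf_limits:
  "((\<lambda>x. measure normal_law {..x}) \<longlongrightarrow> 1) at_top"
  "((\<lambda>x. measure normal_law {..x}) \<longlongrightarrow> 0) at_bot"
proof -
  interpret real_distribution normal_law by (rule real_dist_normal_dist)
  show "((\<lambda>x. measure normal_law {..x}) \<longlongrightarrow> 1) at_top"
    "((\<lambda>x. measure normal_law {..x}) \<longlongrightarrow> 0) at_bot"
    using cdf_lim_at_top_prob cdf_lim_at_bot by (simp_all add: cdf_def2[abs_def])
qed

lemma std_normal_density_isCont: "isCont \<phi> x"
  unfolding normal_density_def by (intro continuous_intros) auto

lemma integral_even_function: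
  fixes h :: "real \<Rightarrow> real"
  assumes h: "integrable lborel h" and even: "\<And>z. h (- z) = h z"
  shows "(LINT z|lborel. h z) = 2 * (LINT z:{0<..}|lborel. h z)"
proof -
  have i: "set_integrable lborel A h" if "A \<in> sets borel" for A
    unfolding set_integrable_def by (intro integrable_mult_indicator) (use h that in auto)
  have "(LINT z|lborel. h z) = (LINT z:{0<..} \<union> {..<0}|lborel. h z)"
    unfolding set_lebesgue_integral_def
  proof (rule integral_cong_AE)
    show "AE z in lborel. h z = indicator ({0<..} \<union> {..<0}) z *\<^sub>R h z"
      using AE_lborel_singleton[of "0::real"] by eventually_elim (auto simp: indicator_def)
  qed (use h in auto)
  also have "\<dots> = (LINT z:{0<..}|lborel. h z) + (LINT z:{..<0}|lborel. h z)"
    by (rule set_integral_Un) (auto intro: i)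
  also have "(LINT z:{..<0}|lborel. h z) = (LINT z:{z. - z \<in> {..<0}}|lborel. h (- z))"
    by (rule set_integral_reflect)
  also have "{z. - z \<in> {..<0::real}} = {0<..}" by auto
  finally show ?thesis by (simp add: even)
qed

text \<open>\<open>1 / z\<^sup>2\<close> has the law of the time at which Brownian motion first
  reaches level 1. For z > 0 both \<open>exp (- b) * \<phi> (z - b / z)\<close> and
  \<open>exp b * \<phi> (z + b / z)\<close> equal the integrand, and the inner derivatives 1 + b/z^2
  and 1 - b/z^2 average to 1; this yields the explicit antiderivative \<open>F\<close>.\<close>

lemma std_normal_inverse_square_laplace_real:
  assumes b: "b > 0"
  shows "(LINT z|normal_law. exp (- (b\<^sup>2 / 2 * (1 / z\<^sup>2)))) = exp (- b)"
proof -
  define \<Phi> where "\<Phi> x = measure normal_law {..x}" for x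
  define h where "h z = \<phi> z * exp (- (b\<^sup>2 / 2 * (1 / z\<^sup>2)))" for z
  define F where "F z = (exp (- b) * \<Phi> (z - b / z) + exp b * \<Phi> (z + b / z)) / 2" for z
  have d\<Phi>: "(\<Phi> has_real_derivative \<phi> x) (at x)" for x
    unfolding \<Phi>_def by (rule std_normal_cdf_deriv)
  have top: "(\<Phi> \<longlongrightarrow> 1) at_top" and bot: "(\<Phi> \<longlongrightarrow> 0) at_bot"
    unfolding \<Phi>_def by (rule std_normal_cdf_limits)+
  have e: "exp (- b) * \<phi> (z - b / z) = h z" "exp b * \<phi> (z + b / z) = h z" if "z > 0" for z
  proof -
    have "- b + - (z - b / z)\<^sup>2 / 2 = - z\<^sup>2 / 2 + - (b\<^sup>2 / 2 * (1 / z\<^sup>2))"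
      "b + - (z + b / z)\<^sup>2 / 2 = - z\<^sup>2 / 2 + - (b\<^sup>2 / 2 * (1 / z\<^sup>2))"
      using that by (simp_all add: power2_eq_square field_simps)
    then have "exp (- b) * exp (- (z - b / z)\<^sup>2 / 2) = exp (- z\<^sup>2 / 2) * exp (- (b\<^sup>2 / 2 * (1 / z\<^sup>2)))"
      "exp b * exp (- (z + b / z)\<^sup>2 / 2) = exp (- z\<^sup>2 / 2) * exp (- (b\<^sup>2 / 2 * (1 / z\<^sup>2)))"
      by (simp_all only: exp_add[symmetric])
    then show "exp (- b) * \<phi> (z - b / z) = h z" "exp b * \<phi> (z + b / z) = h z"
      by (simp_all add: h_def normal_density_def)
  qed
  have dF: "(F has_real_derivative h z) (at z)" if z: "z > 0" for z
  proof -
    have 1: "((\<lambda>z. z - b / z) has_real_derivative 1 + b / z\<^sup>2) (at z)"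
      "((\<lambda>z. z + b / z) has_real_derivative 1 - b / z\<^sup>2) (at z)"
      using z by (auto intro!: derivative_eq_intros simp: power2_eq_square)
    have "(F has_real_derivative (exp (- b) * (\<phi> (z - b / z) * (1 + b / z\<^sup>2))
        + exp b * (\<phi> (z + b / z) * (1 - b / z\<^sup>2))) / 2) (at z)"
      unfolding F_def by (intro DERIV_cdivide DERIV_add DERIV_cmult DERIV_chain2[OF d\<Phi>] 1)
    moreover have "(exp (- b) * (\<phi> (z - b / z) * (1 + b / z\<^sup>2))
        + exp b * (\<phi> (z + b / z) * (1 - b / z\<^sup>2))) / 2 = h z"
      unfolding mult.assoc[symmetric] e[OF z] by (simp add: algebra_simps)
    ultimately show ?thesis by simp
  qed
  have "(LBINT z=ereal 0..\<infinity>. h z) = (exp (- b) * 1 + exp b * 1) / 2 - (exp (- b) * 0 + exp b * 1) / 2"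
  proof (rule interval_integral_FTC_nonneg(2)[where F=F])
    show "(F has_real_derivative h z) (at z)" if "ereal 0 < ereal z" "ereal z < \<infinity>" for z
      using that by (intro dF) simp
    show "isCont h z" if "ereal 0 < ereal z" "ereal z < \<infinity>" for z
      unfolding h_def using that by (intro continuous_intros std_normal_density_isCont) auto
    show "AE z in lborel. ereal 0 < ereal z \<longrightarrow> ereal z < \<infinity> \<longrightarrow> 0 \<le> h z" by (simp add: h_def)
    have "filterlim (\<lambda>z. z - b / z) at_bot (at_right 0)" "filterlim (\<lambda>z. z + b / z) at_top (at_right 0)"
      "filterlim (\<lambda>z. z - b / z) at_top at_top" "filterlim (\<lambda>z. z + b / z) at_top at_top"
      using b by real_asymp+
    note l = this
    have "(F \<longlongrightarrow> (exp (- b) * 0 + exp b * 1) / 2) (at_right 0)"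
      unfolding F_def by (intro tendsto_intros filterlim_compose[OF bot l(1)] filterlim_compose[OF top l(2)]) simp
    then show "((F \<circ> real_of_ereal) \<longlongrightarrow> (exp (- b) * 0 + exp b * 1) / 2) (at_right (ereal 0))"
      by (simp only: ereal_tendsto_simps)
    have "(F \<longlongrightarrow> (exp (- b) * 1 + exp b * 1) / 2) at_top"
      unfolding F_def by (intro tendsto_intros filterlim_compose[OF top l(3)] filterlim_compose[OF top l(4)]) simp
    then show "((F \<circ> real_of_ereal) \<longlongrightarrow> (exp (- b) * 1 + exp b * 1) / 2) (at_left \<infinity>)"
      by (simp only: ereal_tendsto_simps)
  qed simp
  then have half: "(LINT z:{0<..}|lborel. h z) = exp (- b) / 2"
    by (subst (asm) interval_lebesgue_integral_le_eq) (auto simp: field_simps)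
  have hm[measurable]: "h \<in> borel_measurable borel" unfolding h_def by measurable
  have "integrable lborel h"
  proof (rule Bochner_Integration.integrable_bound)
    show "integrable lborel \<phi>" by simp
    show "AE z in lborel. norm (h z) \<le> norm (\<phi> z)"
      by (intro AE_I2) (simp add: h_def mult_left_le)
  qed simp
  then have "(LINT z|lborel. h z) = 2 * (LINT z:{0<..}|lborel. h z)"
    by (rule integral_even_function) (simp add: h_def normal_density_def)
  moreover have "(LINT z|normal_law. exp (- (b\<^sup>2 / 2 * (1 / z\<^sup>2)))) = (LINT z|lborel. h z)"
    unfolding h_def by (subst integral_density) auto
  ultimately show ?thesis using half by simp
qed

lemma std_normal_inverse_square_laplace:
  assumes a: "a > 0" and s: "Re s > 0"
  shows "(LINT z|normal_law. exp (- s * complex_of_real (a\<^sup>2 / z\<^sup>2))) = exp (- (of_real a * csqrt (2 * s)))"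
proof (rule halfplane_identity[OF _ _ _ s, where f="\<lambda>s. LINT z|normal_law. exp (- s * complex_of_real (a\<^sup>2 / z\<^sup>2))"
    and g="\<lambda>s. exp (- (of_real a * csqrt (2 * s)))"])
  show "(\<lambda>s. LINT z|normal_law. exp (- s * complex_of_real (a\<^sup>2 / z\<^sup>2))) holomorphic_on {s. Re s > 0}"
    by (rule laplace_transform_holomorphic) (auto intro: prob_space_normal_density)
  show "(\<lambda>s. exp (- (of_real a * csqrt (2 * s)))) holomorphic_on {s. Re s > 0}"
    by (intro holomorphic_intros) (auto simp: complex_nonpos_Reals_iff)
  fix r :: real assume r: "r > 0"
  define b where "b = a * sqrt (2 * r)"
  have b: "b > 0" "b\<^sup>2 / 2 = r * a\<^sup>2" using a r by (auto simp: b_def power_mult_distrib)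
  have "(LINT z|normal_law. exp (- complex_of_real r * complex_of_real (a\<^sup>2 / z\<^sup>2)))
    = (LINT z|normal_law. complex_of_real (exp (- (b\<^sup>2 / 2 * (1 / z\<^sup>2)))))"
  proof (intro Bochner_Integration.integral_cong refl)
    fix z :: real
    have "- complex_of_real r * complex_of_real (a\<^sup>2 / z\<^sup>2) = complex_of_real (- (b\<^sup>2 / 2 * (1 / z\<^sup>2)))"
      unfolding b(2) by simp
    then show "exp (- complex_of_real r * complex_of_real (a\<^sup>2 / z\<^sup>2)) = complex_of_real (exp (- (b\<^sup>2 / 2 * (1 / z\<^sup>2))))"
      by (simp only: exp_of_real)
  qed
  also have "\<dots> = complex_of_real (exp (- b))"
    by (simp only: integral_complex_of_real std_normal_inverse_square_laplace_real[OF b(1)])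
  also have "\<dots> = exp (- (of_real a * csqrt (2 * of_real r)))"
    using r csqrt_of_real_nonneg[of "2 * of_real r"] by (simp add: b_def exp_of_real[symmetric])
  finally show "(LINT z|normal_law. exp (- complex_of_real r * complex_of_real (a\<^sup>2 / z\<^sup>2)))
    = exp (- (of_real a * csqrt (2 * of_real r)))" .
qed

text \<open>Mills ratio: -\<phi>(z)/z is an antiderivative of \<phi>(z) (1 + 1/z^2), and beyond y
  the second factor lies between 1 and 1 + 1/y^2.\<close>

lemma std_normal_tail_bounds:
  assumes y: "y > 0"
  defines "T \<equiv> (LINT z:{y<..}|lborel. \<phi> z)"
  shows "T \<le> \<phi> y / y" and "\<phi> y / y \<le> (1 + 1 / y\<^sup>2) * T"
proof -
  let ?f = "\<lambda>z. \<phi> z * (1 + 1 / z\<^sup>2)"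
  let ?F = "\<lambda>z. - (\<phi> z / z)"
  have d: "(?F has_real_derivative ?f z) (at z)" if z: "z > 0" for z
  proof -
    have "(\<phi> has_real_derivative - z * \<phi> z) (at z)"
      unfolding normal_density_def by (auto intro!: derivative_eq_intros simp: field_simps)
    with z show ?thesis
      by (intro DERIV_cong[OF DERIV_minus[OF DERIV_divide[OF _ DERIV_ident]]]) (auto simp: field_simps power2_eq_square)
  qed
  have A: "((?F \<circ> real_of_ereal) \<longlongrightarrow> ?F y) (at_right (ereal y))"
  proof -
    have "isCont ?F y" using y by (intro continuous_intros std_normal_density_isCont) auto
    then have "(?F \<longlongrightarrow> ?F y) (at_right y)"
      using continuous_at_imp_continuous_at_within[of y ?F] by (simp add: continuous_within)
    then show ?thesis by (simp only: ereal_tendsto_simps)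
  qed
  have B: "((?F \<circ> real_of_ereal) \<longlongrightarrow> 0) (at_left \<infinity>)"
  proof -
    have "(?F \<longlongrightarrow> 0) at_top" unfolding normal_density_def by real_asymp
    then show ?thesis by (simp only: ereal_tendsto_simps)
  qed
  have c: "isCont ?f z" if "z > 0" for z
    using that by (intro continuous_intros std_normal_density_isCont) auto
  have nn: "AE z in lborel. ereal y < ereal z \<longrightarrow> ereal z < \<infinity> \<longrightarrow> 0 \<le> ?f z" by (auto intro!: AE_I2)
  have lt: "ereal y < \<infinity>" by simp
  have d': "(?F has_real_derivative ?f z) (at z)" if "ereal y < ereal z" "ereal z < \<infinity>" for z
    using that y by (intro d) simp
  have c': "isCont ?f z" if "ereal y < ereal z" "ereal z < \<infinity>" for z
    using that y by (intro c) simp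
  have int: "set_integrable lborel {y<..} ?f"
    using interval_integral_FTC_nonneg(1)[OF lt d' c' nn A B] by simp
  have val: "(LINT z:{y<..}|lborel. ?f z) = \<phi> y / y"
  proof -
    have "(LBINT z=ereal y..\<infinity>. ?f z) = 0 - ?F y"
      by (rule interval_integral_FTC_nonneg(2)[OF lt d' c' nn A B])
    then show ?thesis by (subst (asm) interval_lebesgue_integral_le_eq) auto
  qed
  have iT: "set_integrable lborel {y<..} \<phi>"
    unfolding set_integrable_def by (intro integrable_mult_indicator) auto
  show "T \<le> \<phi> y / y"
    unfolding val[symmetric] T_def
    by (rule set_integral_mono[OF iT int]) (simp add: distrib_left)
  have "(LINT z:{y<..}|lborel. ?f z) \<le> (LINT z:{y<..}|lborel. (1 + 1 / y\<^sup>2) * \<phi> z)"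
  proof (rule set_integral_mono[OF int])
    show "set_integrable lborel {y<..} (\<lambda>z. (1 + 1 / y\<^sup>2) * \<phi> z)" using iT by simp
    fix z assume "z \<in> {y<..}"
    then have "1 / z\<^sup>2 \<le> 1 / y\<^sup>2" using y by (intro divide_left_mono power_mono) auto
    then have "\<phi> z * (1 + 1 / z\<^sup>2) \<le> \<phi> z * (1 + 1 / y\<^sup>2)"
      by (intro mult_left_mono add_left_mono) simp_all
    then show "?f z \<le> (1 + 1 / y\<^sup>2) * \<phi> z" by (simp only: mult.commute)
  qed
  then show "\<phi> y / y \<le> (1 + 1 / y\<^sup>2) * T" unfolding val T_def by simp
qed

text \<open>The event consists of two equal Gaussian tails starting at y = a / sqrt x, with 1/y^2 =
  x/a^2. The point z = 0 also satisfies the inequality, since division by zero gives 0, but it is a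
  null set.\<close>

lemma std_normal_inverse_square_cdf_bounds:
  assumes a: "a > 0" and x: "x > 0"
  defines "F \<equiv> measure (distr normal_law borel (\<lambda>z. a\<^sup>2 / z\<^sup>2)) {..x}"
    and "H \<equiv> sqrt (2 * x / pi) / a * exp (- (a\<^sup>2 / (2 * x)))"
  shows "F \<le> H" and "H \<le> (1 + x / a\<^sup>2) * F"
proof -
  define y where "y = a / sqrt x"
  have y: "y > 0" "y\<^sup>2 = a\<^sup>2 / x" using a x by (auto simp: y_def power_divide)
  define T where "T = (LINT z:{y<..}|lborel. \<phi> z)"
  let ?A = "{z::real. a\<^sup>2 / z\<^sup>2 \<le> x}"
  let ?h = "\<lambda>z. indicator ?A z * \<phi> z"
  have A[measurable]: "?A \<in> sets borel" by measurable
  have "F = measure normal_law ?A"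
    unfolding F_def by (subst measure_distr) (auto intro!: arg_cong2[where f=measure])
  also have "\<dots> = (LINT z|lborel. ?h z)"
    by (subst std_normal_measure_eq[OF A]) (simp add: set_lebesgue_integral_def)
  also have "\<dots> = 2 * (LINT z:{0<..}|lborel. ?h z)"
  proof (rule integral_even_function)
    show "integrable lborel ?h"
      by (rule Bochner_Integration.integrable_bound[where f=\<phi>]) (auto split: split_indicator)
  qed (simp add: normal_density_def indicator_def)
  also have "(LINT z:{0<..}|lborel. ?h z) = T"
    unfolding T_def set_lebesgue_integral_def
  proof (rule integral_cong_AE)
    show "AE z in lborel. indicator {0<..} z *\<^sub>R ?h z = indicator {y<..} z *\<^sub>R \<phi> z"
      using AE_lborel_singleton[of y]
    proof eventually_elim
      case (elim z)
      have "(a\<^sup>2 / z\<^sup>2 \<le> x) = (y < z)" if "z > 0"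
      proof -
        have "(a\<^sup>2 / z\<^sup>2 \<le> x) = (y\<^sup>2 \<le> z\<^sup>2)" using that x by (simp add: y(2) field_simps)
        also have "\<dots> = (y \<le> z)" using that y(1) by (simp add: power_mono_iff)
        finally show ?thesis using elim by auto
      qed
      then show ?case using y(1) by (auto simp: indicator_def)
    qed
  qed auto
  finally have F: "F = 2 * T" .
  have H: "H = 2 * (\<phi> y / y)"
  proof -
    have "2 * (\<phi> y / y) = 2 * (1 / sqrt (2 * pi)) * (sqrt x / a) * exp (- (a\<^sup>2 / (2 * x)))"
      using x by (simp add: normal_density_def y(2)) (simp add: y_def)
    moreover have "2 * (1 / sqrt (2 * pi)) * sqrt x = sqrt (2 * x / pi)"
      by (simp add: real_sqrt_mult real_sqrt_divide field_simps)
    ultimately show ?thesis unfolding H_def by (simp only: times_divide_eq_right mult.assoc)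
  qed
  have x_eq: "1 / y\<^sup>2 = x / a\<^sup>2" using y(2) by simp
  show "F \<le> H" using std_normal_tail_bounds(1)[OF y(1)] unfolding F H T_def by simp
  have "2 * (\<phi> y / y) \<le> 2 * ((1 + x / a\<^sup>2) * T)"
    using std_normal_tail_bounds(2)[OF y(1)] unfolding T_def x_eq by (intro mult_left_mono) simp_all
  then show "H \<le> (1 + x / a\<^sup>2) * F" unfolding F H by (simp only: mult.left_commute)
qed

section \<open>Small ball asymptotics\<close>

text \<open>If x + i y is the root, then x^2 - 2 \<sigma> = y^2 = \<tau>^2/x^2; dividing by x +
  sqrt(2 \<sigma>) \<le> 2 x gives the gain \<tau>^2/(2 x^3). The parameter \<open>m\<close> fixes
  the scale: x \<le> 2 m produces the denominator 16 m^3. It is used with m^2 equal to \<sigma> or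
  to |\<tau>|.\<close>

lemma csqrt_halfplane_bounds:
  fixes \<sigma> \<tau> m :: real
  assumes \<sigma>: "\<sigma> > 0" and m: "\<sigma> \<le> m\<^sup>2" "\<bar>\<tau>\<bar> \<le> m\<^sup>2" "m > 0"
  shows "Re (csqrt (2 * (of_real \<sigma> - \<i> * of_real \<tau>))) \<ge> sqrt (2 * \<sigma>) + \<tau>\<^sup>2 / (16 * m ^ 3)"
proof -
  define z where "z = csqrt (2 * (of_real \<sigma> - \<i> * of_real \<tau>))"
  define x where "x = Re z"
  define y where "y = Im z"
  have z2: "z\<^sup>2 = 2 * (of_real \<sigma> - \<i> * of_real \<tau>)" by (simp add: z_def)
  have re: "x\<^sup>2 - y\<^sup>2 = 2 * \<sigma>" and im: "x * y = - \<tau>"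
    using arg_cong[OF z2, of Re] arg_cong[OF z2, of Im] by (simp_all add: power2_eq_square x_def y_def mult.commute)
  have x0: "x \<ge> 0" using csqrt_principal[of "2 * (of_real \<sigma> - \<i> * of_real \<tau>)"] by (auto simp: x_def z_def)
  have x2: "x\<^sup>2 \<ge> 2 * \<sigma>" using re zero_le_power2[of y] by linarith
  have xp: "x > 0" using x0 x2 \<sigma> by (cases "x = 0") auto
  have xs: "sqrt (2 * \<sigma>) \<le> x" using x2 x0 by (intro real_le_lsqrt)
  have y2: "y\<^sup>2 = \<tau>\<^sup>2 / x\<^sup>2" using im xp by (simp add: field_simps) (metis power2_minus power_mult_distrib mult.commute)
  \<comment> \<open>Otherwise x^2 (x^2 - 2 \<sigma>) would exceed 3 m^4, whereas it equals \<tau>^2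
    \<le> m^4.\<close>
  have xle: "x\<^sup>2 \<le> 3 * m\<^sup>2"
  proof (rule ccontr)
    assume "\<not> ?thesis"
    then have h: "x\<^sup>2 > 3 * m\<^sup>2" by simp
    then have "x\<^sup>2 - 2 * \<sigma> > m\<^sup>2" using m(1) by linarith
    with h have "x\<^sup>2 * (x\<^sup>2 - 2 * \<sigma>) > (3 * m\<^sup>2) * m\<^sup>2" using m(3) by (intro mult_strict_mono) auto
    moreover have "x\<^sup>2 * (x\<^sup>2 - 2 * \<sigma>) = \<tau>\<^sup>2"
    proof -
      have "x\<^sup>2 - 2 * \<sigma> = y\<^sup>2" using re by simp
      then show ?thesis using y2 xp by simp
    qed
    moreover have "\<tau>\<^sup>2 \<le> m\<^sup>2 * m\<^sup>2" using mult_mono[OF m(2) m(2)] by (simp add: power2_eq_square abs_mult_self_eq)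
    moreover have "m\<^sup>2 * m\<^sup>2 \<ge> 0" by simp
    ultimately show False by linarith
  qed
  have "x \<le> 2 * m"
  proof (rule power2_le_imp_le)
    have "(2 * m)\<^sup>2 = 4 * m\<^sup>2" by (simp add: power_mult_distrib)
    then show "x\<^sup>2 \<le> (2 * m)\<^sup>2" using xle zero_le_power2[of m] by linarith
  qed (use m(3) in simp)
  then have "x ^ 3 \<le> (2 * m) ^ 3" using x0 by (intro power_mono) auto
  then have x3: "2 * x ^ 3 \<le> 16 * m ^ 3" by (simp add: power_mult_distrib)
  have "(x - sqrt (2 * \<sigma>)) * (2 * x) \<ge> (x - sqrt (2 * \<sigma>)) * (x + sqrt (2 * \<sigma>))"
    using xs by (intro mult_left_mono) auto
  also have "(x - sqrt (2 * \<sigma>)) * (x + sqrt (2 * \<sigma>)) = y\<^sup>2"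
    using re \<sigma> by (simp add: algebra_simps power2_eq_square)
  finally have "(x - sqrt (2 * \<sigma>)) * (2 * x) \<ge> \<tau>\<^sup>2 / x\<^sup>2" unfolding y2 .
  then have "x - sqrt (2 * \<sigma>) \<ge> \<tau>\<^sup>2 / x\<^sup>2 / (2 * x)" using xp by (subst pos_divide_le_eq) auto
  also have "\<tau>\<^sup>2 / x\<^sup>2 / (2 * x) = \<tau>\<^sup>2 / (2 * x ^ 3)" by (simp add: power2_eq_square power3_eq_cube)
  also have "\<tau>\<^sup>2 / (2 * x ^ 3) \<ge> \<tau>\<^sup>2 / (16 * m ^ 3)" using x3 xp m(3) by (intro divide_left_mono) auto
  finally show ?thesis by (simp add: x_def z_def)
qed

text \<open>The saddle has width \<sigma>^(3/4): for |\<tau>| \<le> \<sigma> the gain in the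
  exponent is quadratic in \<tau>/\<sigma>^(3/4), beyond that it is of order sqrt |\<tau>|. A Cauchy
  profile of this width dominates both regimes and has an elementary integral.\<close>

lemma norm_exp_csqrt_bound:
  fixes a :: real
  assumes a: "a > 0"
  obtains K where "K > 0"
    "\<And>\<sigma> \<tau>. \<sigma> \<ge> 1 \<Longrightarrow> norm (exp (- (of_real a * csqrt (2 * (of_real \<sigma> - \<i> * of_real \<tau>)))))
      \<le> K * exp (- (a * sqrt (2 * \<sigma>))) * inverse (1 + (\<tau> / \<sigma> powr (3/4))\<^sup>2)"
proof -
  \<comment> \<open>The first summand handles |\<tau>| \<le> \<sigma>, the second the far
    range.\<close>
  define K where "K = max 1 (16 / a) + 2 * (64 / a) ^ 4"
  have K: "K > 0" "K \<ge> max 1 (16 / a)" "K \<ge> 2 * (64 / a) ^ 4"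
    using a by (auto simp: K_def intro: add_pos_pos)
  have "norm (exp (- (of_real a * csqrt (2 * (of_real \<sigma> - \<i> * of_real \<tau>)))))
      \<le> K * exp (- (a * sqrt (2 * \<sigma>))) * inverse (1 + (\<tau> / \<sigma> powr (3/4))\<^sup>2)" if \<sigma>: "\<sigma> \<ge> 1" for \<sigma> \<tau>
  proof -
    define u where "u = (\<tau> / \<sigma> powr (3/4))\<^sup>2"
    define x where "x = Re (csqrt (2 * (of_real \<sigma> - \<i> * of_real \<tau>)))"
    have u0: "u \<ge> 0" by (simp add: u_def)
    have "sqrt \<sigma> ^ 3 = \<sigma> powr (3/2)" using \<sigma> by (simp add: powr_half_sqrt[symmetric] powr_power)
    also have "\<dots> = (\<sigma> powr (3/4))\<^sup>2" using \<sigma> by (simp add: powr_power)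
    finally have u_eq: "u = \<tau>\<^sup>2 / sqrt \<sigma> ^ 3" by (simp add: u_def power_divide)
    have ex: "exp (- (a * x)) = exp (- (a * sqrt (2 * \<sigma>))) * exp (- (a * (x - sqrt (2 * \<sigma>))))"
      by (simp add: exp_add[symmetric] algebra_simps)
    have "exp (- (a * (x - sqrt (2 * \<sigma>)))) \<le> K * inverse (1 + u)"
    proof (cases "\<bar>\<tau>\<bar> \<le> \<sigma>")
      case True
      have "x \<ge> sqrt (2 * \<sigma>) + \<tau>\<^sup>2 / (16 * sqrt \<sigma> ^ 3)"
        unfolding x_def by (rule csqrt_halfplane_bounds) (use \<sigma> True in auto)
      then have "x - sqrt (2 * \<sigma>) \<ge> u / 16" by (simp add: u_eq)
      then have "a * (x - sqrt (2 * \<sigma>)) \<ge> a * (u / 16)" using a by (intro mult_left_mono) auto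
      then have "1 + a * (u / 16) \<le> 1 + a * (x - sqrt (2 * \<sigma>))" by (rule add_left_mono)
      also have "\<dots> \<le> exp (a * (x - sqrt (2 * \<sigma>)))" by (rule exp_ge_add_one_self)
      finally have "1 + a / 16 * u \<le> exp (a * (x - sqrt (2 * \<sigma>)))" by simp
      moreover have "1 + u \<le> K * (1 + a / 16 * u)"
      proof -
        have "1 \<le> K" "1 \<le> K * (a / 16)" using K(2) a by (auto simp: pos_divide_le_eq)
        then have "1 + u \<le> K + K * (a / 16) * u"
          using mult_right_mono[of 1 "K * (a / 16)" u] u0 by (intro add_mono) auto
        then show ?thesis by (simp add: algebra_simps)
      qed
      ultimately have "1 + u \<le> K * exp (a * (x - sqrt (2 * \<sigma>)))"
        using K(1) by (meson mult_left_mono less_imp_le order_trans)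
      moreover have "inverse E \<le> K * inverse (1 + u)" if "1 + u \<le> K * E" "E > 0" for E
        using u0 that by (simp add: field_simps)
      ultimately show ?thesis unfolding exp_minus by simp
    next
      case False
      define w where "w = sqrt \<bar>\<tau>\<bar>"
      have w: "w\<^sup>2 = \<bar>\<tau>\<bar>" "w > 0" "w ^ 4 = \<tau>\<^sup>2"
      proof -
        show w2: "w\<^sup>2 = \<bar>\<tau>\<bar>" by (simp add: w_def)
        show "w > 0" using False \<sigma> by (simp add: w_def)
        have "w ^ 4 = (w\<^sup>2)\<^sup>2" by (simp flip: power_mult)
        then show "w ^ 4 = \<tau>\<^sup>2" by (simp add: w2)
      qed
      have "x \<ge> sqrt (2 * \<sigma>) + \<tau>\<^sup>2 / (16 * w ^ 3)"
        unfolding x_def by (rule csqrt_halfplane_bounds) (use \<sigma> False w in auto)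
      then have "x - sqrt (2 * \<sigma>) \<ge> w / 16"
        using w(2) unfolding w(3)[symmetric] by (simp add: power_eq_if field_simps)
      then have "a * (x - sqrt (2 * \<sigma>)) \<ge> a * (w / 16)" using a by (intro mult_left_mono) auto
      then have "exp (- (a * (x - sqrt (2 * \<sigma>)))) \<le> exp (- (a * w / 16))" by simp
      \<comment> \<open>The fourth power yields w^(-4) = 1/\<tau>^2, the decay of the Cauchy
        profile; 64 = 4 * 16 restores the exponent a w / 16.\<close>
      also have "\<dots> \<le> (64 / (a * w)) ^ 4"
      proof -
        have "a * w / 64 \<le> exp (a * w / 64)" using exp_ge_add_one_self[of "a * w / 64"] by linarith
        then have "(a * w / 64) ^ 4 \<le> exp (a * w / 64) ^ 4" using a w(2) by (intro power_mono) auto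
        also have "\<dots> = exp (a * w / 16)" by (simp flip: exp_of_nat_mult)
        finally show ?thesis using a w(2) by (simp add: exp_minus field_simps power_divide power_mult_distrib)
      qed
      also have "\<dots> = (64 / a) ^ 4 / \<tau>\<^sup>2" by (simp add: power_divide power_mult_distrib w(3))
      also have "\<dots> \<le> 2 * (64 / a) ^ 4 * inverse (1 + u)"
      proof -
        have "1 \<le> \<bar>\<tau>\<bar>\<^sup>2" using False \<sigma> by (intro one_le_power) linarith
        then have t1: "\<tau>\<^sup>2 \<ge> 1" by simp
        have "sqrt \<sigma> ^ 3 \<ge> 1" using \<sigma> by (intro one_le_power) simp
        then have "u \<le> \<tau>\<^sup>2 / 1" unfolding u_eq using \<sigma> by (intro divide_left_mono) auto
        then have "1 + u \<le> 2 * \<tau>\<^sup>2" using t1 by simp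
        then have "inverse (2 * \<tau>\<^sup>2) \<le> inverse (1 + u)" using u0 by (intro le_imp_inverse_le) auto
        then have le: "2 * (64 / a) ^ 4 * inverse (2 * \<tau>\<^sup>2) \<le> 2 * (64 / a) ^ 4 * inverse (1 + u)"
          by (intro mult_left_mono) auto
        have "2 * k * inverse (2 * r) = k / r" for k r :: real by (cases "r = 0") (simp_all add: field_simps)
        from le[unfolded this] show ?thesis .
      qed
      also have "\<dots> \<le> K * inverse (1 + u)" using K(3) u0 by (intro mult_right_mono) auto
      finally show ?thesis .
    qed
    then have "exp (- (a * x)) \<le> exp (- (a * sqrt (2 * \<sigma>))) * (K * inverse (1 + u))"
      unfolding ex by (intro mult_left_mono) auto
    then show ?thesis by (simp add: x_def u_def mult_ac)
  qed
  with K(1) show ?thesis by (rule that)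
qed

lemma integral_scaled_cauchy_density:
  fixes M :: real
  assumes M: "M > 0"
  shows "integrable lborel (\<lambda>t. inverse (1 + (t / M)\<^sup>2))"
    and "(LINT t|lborel. inverse (1 + (t / M)\<^sup>2)) = M * pi"
proof -
  have i: "integrable lborel (\<lambda>x::real. inverse (1 + x\<^sup>2))"
    using integrable_inverse_1_plus_square by (simp add: set_integrable_def)
  have v: "(LINT x|lborel. inverse (1 + x\<^sup>2)) = pi"
    using LBINT_inverse_1_plus_square by (simp add: interval_lebesgue_integral_def set_lebesgue_integral_def)
  have e: "(\<lambda>t. inverse (1 + (t / M)\<^sup>2)) = (\<lambda>t. inverse (1 + (0 + (1 / M) * t)\<^sup>2))" by simp
  show "integrable lborel (\<lambda>t. inverse (1 + (t / M)\<^sup>2))"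
    unfolding e by (rule lborel_integrable_real_affine[OF i]) (use M in simp)
  show "(LINT t|lborel. inverse (1 + (t / M)\<^sup>2)) = M * pi"
    using lborel_integral_real_affine[of "1 / M" "\<lambda>x. inverse (1 + x\<^sup>2)" 0] M v by (simp add: field_simps)
qed

text \<open>The reference law is that of \<open>a\<^sup>2 / Z\<^sup>2\<close>, whose distribution
  function lies between H/(1 + x/a^2) and H. A relative error \<delta> of the transforms becomes an
  error of at most \<delta> K' relative to c H, with K' independent of x and \<delta>.\<close>

lemma small_ball_from_laplace:
  fixes N1 :: "real measure" and a c :: real
  assumes N1: "real_distribution N1" "AE q in N1. q \<ge> 0" and a: "a > 0" and c: "c > 0"
    and L: "\<And>\<delta>. \<delta> > 0 \<Longrightarrow> \<exists>\<sigma>0>0. \<forall>s. Re s \<ge> \<sigma>0 \<longrightarrow>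
      norm ((LINT q|N1. exp (- s * complex_of_real q)) - of_real c * exp (- (of_real a * csqrt (2 * s))))
        \<le> \<delta> * norm (of_real c * exp (- (of_real a * csqrt (2 * s))))"
  defines "H \<equiv> \<lambda>x. sqrt (2 * x / pi) / a * exp (- (a\<^sup>2 / (2 * x)))"
  shows "((\<lambda>x. measure N1 {..x} / (c * H x)) \<longlongrightarrow> 1) (at_right 0)"
proof -
  define N2 where "N2 = distr normal_law borel (\<lambda>z::real. a\<^sup>2 / z\<^sup>2)"
  interpret Z: prob_space normal_law by (intro prob_space_normal_density) simp
  have N2: "real_distribution N2" unfolding N2_def by (rule Z.real_distribution_distr) measurable
  have N2': "AE q in N2. q \<ge> 0" unfolding N2_def by (subst AE_distr_iff) auto
  have L2: "(LINT q|N2. exp (- s * complex_of_real q)) = exp (- (of_real a * csqrt (2 * s)))" if "Re s > 0" for s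
    unfolding N2_def by (subst integral_distr) (use std_normal_inverse_square_laplace[OF a that] in auto)
  obtain K where K: "K > 0"
    "\<And>\<sigma> \<tau>. \<sigma> \<ge> 1 \<Longrightarrow> norm (exp (- (of_real a * csqrt (2 * (of_real \<sigma> - \<i> * of_real \<tau>)))))
      \<le> K * exp (- (a * sqrt (2 * \<sigma>))) * inverse (1 + (\<tau> / \<sigma> powr (3/4))\<^sup>2)"
    using norm_exp_csqrt_bound[OF a] by blast
  \<comment> \<open>What remains of the inversion bound relative to \<open>H\<close>: K/2 from the
    Cauchy integral over 2 \<pi>, (2/a^2)^(1/4) from \<sigma>^(-1/4), and the division by the
    constant of \<open>H\<close>.\<close>
  define K' where "K' = K / 2 * (2 / a\<^sup>2) powr (1/4) / (sqrt (2 / pi) / a)"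
  have K': "K' > 0" using K(1) a by (auto simp: K'_def)
  have Hpos: "H x > 0" if "x > 0" for x using that a by (simp add: H_def)
  have main: "\<forall>\<^sub>F x in at_right 0. \<bar>measure N1 {..x} - c * measure N2 {..x}\<bar> \<le> \<delta> * K' * (c * H x)" if \<delta>: "\<delta> > 0" for \<delta>
  proof -
    obtain \<sigma>0 where \<sigma>0: "\<sigma>0 > 0" "\<And>s. Re s \<ge> \<sigma>0 \<Longrightarrow>
      norm ((LINT q|N1. exp (- s * complex_of_real q)) - of_real c * exp (- (of_real a * csqrt (2 * s))))
        \<le> \<delta> * norm (of_real c * exp (- (of_real a * csqrt (2 * s))))"
      using L[OF \<delta>] by blast
    have "filterlim (\<lambda>x::real. a\<^sup>2 / (2 * x\<^sup>2)) at_top (at_right 0)" using a by real_asymp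
    then have "\<forall>\<^sub>F x in at_right 0. a\<^sup>2 / (2 * x\<^sup>2) \<ge> max 1 \<sigma>0" unfolding filterlim_at_top by blast
    then show ?thesis using eventually_at_right_less[of 0]
    proof eventually_elim
      case (elim x)
      \<comment> \<open>The saddle abscissa, characterised by sqrt(2 \<sigma>) = a/x; it passes
        every threshold \<open>\<sigma>0\<close> as x tends to 0.\<close>
      define \<sigma> where "\<sigma> = a\<^sup>2 / (2 * x\<^sup>2)"
      have "max 1 \<sigma>0 \<le> \<sigma>" using elim(1) by (simp only: \<sigma>_def)
      then have \<sigma>: "\<sigma> \<ge> 1" "\<sigma> \<ge> \<sigma>0" "\<sigma> > 0" by auto
      have x: "x > 0" using elim by simp
      define M where "M = \<sigma> powr (3/4)"
      have M: "M > 0" using \<sigma> by (simp add: M_def)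
      define g where "g t = \<delta> * c * K * exp (- (a * sqrt (2 * \<sigma>))) * inverse (1 + (t / M)\<^sup>2)" for t
      have gi: "integrable lborel g" unfolding g_def by (intro integrable_mult_right integral_scaled_cauchy_density M)
      have gv: "(LINT t|lborel. g t) = \<delta> * c * K * exp (- (a * sqrt (2 * \<sigma>))) * (M * pi)"
        unfolding g_def by (simp add: integral_scaled_cauchy_density[OF M])
      have bd: "norm ((LINT q|N1. exp (- (of_real \<sigma> - \<i> * of_real t) * complex_of_real q))
        - of_real c * (LINT q|N2. exp (- (of_real \<sigma> - \<i> * of_real t) * of_real q))) \<le> g t" for t
      proof -
        let ?s = "complex_of_real \<sigma> - \<i> * of_real t"
        have "norm ((LINT q|N1. exp (- ?s * complex_of_real q)) - of_real c * (LINT q|N2. exp (- ?s * of_real q)))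
          \<le> \<delta> * norm (of_real c * exp (- (of_real a * csqrt (2 * ?s))))"
          using \<sigma>0(2)[of ?s] L2[of ?s] \<sigma> by simp
        also have "\<dots> \<le> \<delta> * (c * (K * exp (- (a * sqrt (2 * \<sigma>))) * inverse (1 + (t / \<sigma> powr (3/4))\<^sup>2)))"
          using K(2)[OF \<sigma>(1), of t] \<delta> c unfolding norm_mult by (intro mult_left_mono mult_mono) auto
        finally show ?thesis by (simp add: g_def M_def mult.assoc)
      qed
      have "\<bar>measure N1 {..x} - c * measure N2 {..x}\<bar> \<le> exp (\<sigma> * x) / \<sigma> * (LINT t|lborel. g t) / (2 * pi)"
        by (rule cdf_comparison_via_laplace[OF N1 N2 N2' \<sigma>(3) gi bd])
      also have "\<dots> = \<delta> * c * K / 2 * (exp (\<sigma> * x) * exp (- (a * sqrt (2 * \<sigma>)))) * (M / \<sigma>)"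
        unfolding gv using \<sigma> by (simp add: field_simps)
      also have "exp (\<sigma> * x) * exp (- (a * sqrt (2 * \<sigma>))) = exp (- (a\<^sup>2 / (2 * x)))"
      proof -
        have "sqrt (2 * \<sigma>) = a / x" using a x by (simp add: \<sigma>_def real_sqrt_divide)
        moreover have "\<sigma> * x = a\<^sup>2 / (2 * x)" using x by (simp add: \<sigma>_def power2_eq_square)
        ultimately have "\<sigma> * x + - (a * sqrt (2 * \<sigma>)) = - (a\<^sup>2 / (2 * x))"
          using x by (simp add: field_simps power2_eq_square)
        then show ?thesis by (simp only: exp_add[symmetric])
      qed
      also have "M / \<sigma> = sqrt x * (2 / a\<^sup>2) powr (1/4)"
      proof -
        have "M / \<sigma> = \<sigma> powr (3/4) / \<sigma> powr 1" using \<sigma> by (simp add: M_def)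
        also have "\<dots> = \<sigma> powr (3/4 - 1)" by (rule powr_diff[symmetric])
        also have "3/4 - 1 = - (1/4 :: real)" by simp
        also have "\<sigma> powr - (1/4) = inverse (\<sigma> powr (1/4))" by (rule powr_minus)
        also have "\<dots> = (inverse \<sigma>) powr (1/4)" using \<sigma> by (simp add: inverse_powr)
        also have "inverse \<sigma> = x\<^sup>2 * (2 / a\<^sup>2)" by (simp add: \<sigma>_def)
        also have "\<dots> powr (1/4) = (x\<^sup>2) powr (1/4) * (2 / a\<^sup>2) powr (1/4)" by (rule powr_mult)
        also have "(x\<^sup>2) powr (1/4) = sqrt x"
        proof -
          have "x\<^sup>2 = x powr 2" using x by simp
          then have "(x\<^sup>2) powr (1/4) = x powr (2 * (1/4))" by (simp only: powr_powr)
          then show ?thesis using x by (simp add: powr_half_sqrt)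
        qed
        finally show ?thesis .
      qed
      also have "\<delta> * c * K / 2 * exp (- (a\<^sup>2 / (2 * x))) * (sqrt x * (2 / a\<^sup>2) powr (1/4)) = \<delta> * K' * (c * H x)"
      proof -
        have "sqrt (2 * x / pi) = sqrt (2 / pi) * sqrt x" by (simp flip: real_sqrt_mult)
        then show ?thesis using a by (simp add: H_def K'_def)
      qed
      finally show ?case .
    qed
  qed
  have dif: "((\<lambda>x. measure N1 {..x} / (c * H x) - measure N2 {..x} / H x) \<longlongrightarrow> 0) (at_right 0)"
  proof (rule tendstoI)
    fix e :: real assume e: "e > 0"
    define \<delta> where "\<delta> = e / (2 * K')"
    have \<delta>: "\<delta> > 0" "\<delta> * K' < e" using e K' by (auto simp: \<delta>_def)
    show "\<forall>\<^sub>F x in at_right 0. dist (measure N1 {..x} / (c * H x) - measure N2 {..x} / H x) 0 < e"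
      using main[OF \<delta>(1)] eventually_at_right_less[of 0]
    proof eventually_elim
      case (elim x)
      have p: "c * H x > 0" using Hpos[of x] elim c by simp
      have "measure N1 {..x} / (c * H x) - measure N2 {..x} / H x = (measure N1 {..x} - c * measure N2 {..x}) / (c * H x)"
        using c by (simp add: diff_divide_distrib)
      then have "\<bar>measure N1 {..x} / (c * H x) - measure N2 {..x} / H x\<bar> = \<bar>measure N1 {..x} - c * measure N2 {..x}\<bar> / (c * H x)"
        using p by (simp add: abs_divide)
      also have "\<dots> \<le> \<delta> * K'" using elim(1) p by (simp add: pos_divide_le_eq)
      finally show ?case using \<delta>(2) by (simp add: dist_real_def)
    qed
  qed
  have "((\<lambda>x. measure N2 {..x} / H x) \<longlongrightarrow> 1) (at_right 0)"
  proof (rule tendsto_sandwich)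
    show "\<forall>\<^sub>F x in at_right 0. 1 / (1 + x / a\<^sup>2) \<le> measure N2 {..x} / H x"
      using eventually_at_right_less[of 0]
    proof eventually_elim
      case (elim x)
      have "1 + x / a\<^sup>2 > 0" using elim by (intro add_pos_nonneg) auto
      moreover have "H x \<le> (1 + x / a\<^sup>2) * measure N2 {..x}"
        unfolding H_def N2_def by (rule std_normal_inverse_square_cdf_bounds(2)[OF a elim])
      ultimately show ?case using Hpos[OF elim] by (simp add: divide_simps mult.commute)
    qed
    show "\<forall>\<^sub>F x in at_right 0. measure N2 {..x} / H x \<le> 1"
      using eventually_at_right_less[of 0]
    proof eventually_elim
      case (elim x)
      have "measure N2 {..x} \<le> H x"
        unfolding H_def N2_def by (rule std_normal_inverse_square_cdf_bounds(1)[OF a elim])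
      then show ?case using Hpos[OF elim] by simp
    qed
    have "((\<lambda>x. 1 / (1 + x / a\<^sup>2)) \<longlongrightarrow> 1 / (1 + 0 / a\<^sup>2)) (at_right 0)"
      using a by (intro tendsto_intros) auto
    then show "((\<lambda>x. 1 / (1 + x / a\<^sup>2)) \<longlongrightarrow> 1) (at_right 0)" by simp
  qed simp
  from tendsto_add[OF dif this] show ?thesis by simp
qed

theorem theorem6:
  fixes M :: "'a measure" and Y :: "real \<Rightarrow> 'a \<Rightarrow> real"
    and \<psi> :: "real \<Rightarrow> real" and \<omega> \<theta> :: real
  assumes "prob_space M"
    and "\<omega> > 0"
    and "bogoliubov_process M \<omega> Y"
    and "\<And>t. t \<in> {0..1} \<Longrightarrow> \<psi> t > 0"
    and "C2_on {0..1} \<psi>"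
    and "\<theta> = (LBINT t:{0..1}. sqrt (\<psi> t))"
  shows "(\<lambda>\<epsilon>. measure M {x \<in> space M. weighted_norm \<psi> (\<lambda>t. Y t x) \<le> \<epsilon>})
    \<sim>[at_right 0]
    (\<lambda>\<epsilon>. 8 * sinh (\<omega> / 2) * \<psi> 0 powr (1/8) * \<psi> 1 powr (1/8)
        / (\<theta> * pi powr (1/2) * (\<psi> 0 powr (1/2) + \<psi> 1 powr (1/2)) powr (1/2))
        * \<epsilon> * exp (- (\<theta>\<^sup>2 / 8) * \<epsilon> powr (-2)))"
proof -
  interpret prob_space M by fact
  define c where "c = sqrt ((exp \<omega> + exp (- \<omega>) - 2) / (((\<psi> 0 / \<psi> 1) powr (1/4) + (\<psi> 1 / \<psi> 0) powr (1/4)) / 2))"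
  obtain Q where Q[measurable]: "Q \<in> borel_measurable M" and Q0: "\<And>x. x \<in> space M \<Longrightarrow> Q x \<ge> 0"
    and Qn: "\<And>x. x \<in> space M \<Longrightarrow> weighted_norm \<psi> (\<lambda>t. Y t x) = sqrt (Q x)" and \<theta>: "\<theta> > 0" and c: "c > 0"
    and L: "\<And>\<delta>. \<delta> > 0 \<Longrightarrow> \<exists>\<sigma>0>0. \<forall>s. Re s \<ge> \<sigma>0 \<longrightarrow>
      norm ((LINT x|M. exp (- s * complex_of_real (Q x))) - of_real c * exp (- (of_real (\<theta> / 2) * csqrt (2 * s))))
        \<le> \<delta> * norm (of_real c * exp (- (of_real (\<theta> / 2) * csqrt (2 * s))))"
    using bogoliubov_norm_laplace_asymptotics[OF assms, folded c_def] by blast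
  define a where "a = \<theta> / 2"
  have a: "a > 0" using \<theta> by (simp add: a_def)
  define N where "N = distr M borel Q"
  have N: "real_distribution N" unfolding N_def by (rule real_distribution_distr) measurable
  have N0: "AE q in N. q \<ge> 0" unfolding N_def by (subst AE_distr_iff) (auto intro!: AE_I2 Q0)
  have LN: "(LINT q|N. exp (- s * complex_of_real q)) = (LINT x|M. exp (- s * complex_of_real (Q x)))" for s
    unfolding N_def by (subst integral_distr) auto
  define H where "H x = sqrt (2 * x / pi) / a * exp (- (a\<^sup>2 / (2 * x)))" for x
  have lim: "((\<lambda>x. measure N {..x} / (c * H x)) \<longlongrightarrow> 1) (at_right 0)"
    unfolding H_def by (rule small_ball_from_laplace[OF N N0 a c]) (use L in \<open>simp only: LN a_def\<close>)
  \<comment> \<open>The norm is the square root of \<open>Q\<close>, so the radius \<epsilon>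
    corresponds to the argument \<epsilon>^2 of the distribution function.\<close>
  have "filterlim (\<lambda>\<epsilon>::real. \<epsilon>\<^sup>2) (at_right 0) (at_right 0)" by real_asymp
  from filterlim_compose[OF lim this]
  have lim2: "((\<lambda>\<epsilon>. measure N {..\<epsilon>\<^sup>2} / (c * H (\<epsilon>\<^sup>2))) \<longlongrightarrow> 1) (at_right 0)" .
  have ev: "\<forall>\<^sub>F \<epsilon> in at_right 0. measure N {..\<epsilon>\<^sup>2} / (c * H (\<epsilon>\<^sup>2))
    = measure M {x \<in> space M. weighted_norm \<psi> (\<lambda>t. Y t x) \<le> \<epsilon>} /
      (8 * sinh (\<omega> / 2) * \<psi> 0 powr (1/8) * \<psi> 1 powr (1/8)
        / (\<theta> * pi powr (1/2) * (\<psi> 0 powr (1/2) + \<psi> 1 powr (1/2)) powr (1/2))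
        * \<epsilon> * exp (- (\<theta>\<^sup>2 / 8) * \<epsilon> powr (-2)))"
    using eventually_at_right_less[of 0]
  proof eventually_elim
    case (elim \<epsilon>)
    have p0: "\<psi> 0 > 0" "\<psi> 1 > 0" using assms(4) by auto
    have "measure N {..\<epsilon>\<^sup>2} = measure M {x \<in> space M. Q x \<le> \<epsilon>\<^sup>2}"
      unfolding N_def by (subst measure_distr) (auto intro!: arg_cong2[where f=measure])
    also have "{x \<in> space M. Q x \<le> \<epsilon>\<^sup>2} = {x \<in> space M. weighted_norm \<psi> (\<lambda>t. Y t x) \<le> \<epsilon>}"
    proof -
      have "Q x \<le> \<epsilon>\<^sup>2 \<longleftrightarrow> sqrt (Q x) \<le> \<epsilon>" if "x \<in> space M" for x
        using Q0[OF that] elim by (metis less_imp_le real_sqrt_le_iff real_sqrt_unique)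
      then show ?thesis using Qn by auto
    qed
    finally have 1: "measure N {..\<epsilon>\<^sup>2} = measure M {x \<in> space M. weighted_norm \<psi> (\<lambda>t. Y t x) \<le> \<epsilon>}" .
    \<comment> \<open>Eighth roots make all powers of the endpoint values polynomial: \<kappa> =
      (A^4 + B^4)/(2 A^2 B^2), and its square root in \<open>c\<close> puts the product A B into the
      numerator.\<close>
    define A where "A = \<psi> 0 powr (1/8)"
    define B where "B = \<psi> 1 powr (1/8)"
    have AB: "A > 0" "B > 0" using p0 by (auto simp: A_def B_def)
    have pw: "\<psi> 0 powr (1/4) = A ^ 2" "\<psi> 1 powr (1/4) = B ^ 2" "\<psi> 0 powr (1/2) = A ^ 4" "\<psi> 1 powr (1/2) = B ^ 4"
      using p0 by (simp_all add: A_def B_def powr_power)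
    \<comment> \<open>The free discriminant 2 cosh(\<omega>) - 2 is a square, which is how
      sinh(\<omega>/2) enters. The factor 2 sqrt 2 in \<open>c\<close> and the factor 2 sqrt 2 in
      \<open>H\<close> multiply to 8.\<close>
    have D0: "exp \<omega> + exp (- \<omega>) - 2 = (2 * sinh (\<omega> / 2))\<^sup>2"
      by (simp add: sinh_def power2_eq_square algebra_simps exp_add[symmetric])
    have kap: "((\<psi> 0 / \<psi> 1) powr (1/4) + (\<psi> 1 / \<psi> 0) powr (1/4)) / 2 = (A ^ 4 + B ^ 4) / (2 * (A * B)\<^sup>2)"
      using AB p0 by (simp add: powr_divide pw field_simps power2_eq_square power4_eq_xxxx)
    define S where "S = sqrt (A ^ 4 + B ^ 4)"
    have S: "S > 0" using AB by (simp add: S_def add_pos_pos)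
    have sh: "sinh (\<omega> / 2) > 0" using assms(2) by simp
    have c_eq: "c = 2 * sinh (\<omega> / 2) * sqrt 2 * (A * B) / S"
    proof -
      have "(2 * sinh (\<omega> / 2))\<^sup>2 / ((A ^ 4 + B ^ 4) / (2 * (A * B)\<^sup>2)) = (2 * sinh (\<omega> / 2) * sqrt 2 * (A * B))\<^sup>2 / (A ^ 4 + B ^ 4)"
        by (simp add: power_mult_distrib)
      moreover have "sqrt \<dots> = 2 * sinh (\<omega> / 2) * sqrt 2 * (A * B) / S"
        using AB sh by (simp add: real_sqrt_divide S_def)
      ultimately show ?thesis unfolding c_def D0 kap by (simp only:)
    qed
    have H_eq: "H (\<epsilon>\<^sup>2) = 2 * sqrt 2 * \<epsilon> / (sqrt pi * \<theta>) * exp (- (\<theta>\<^sup>2 / 8) * \<epsilon> powr (-2))"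
    proof -
      have "sqrt (2 * \<epsilon>\<^sup>2 / pi) = sqrt 2 * \<epsilon> / sqrt pi" using elim by (simp add: real_sqrt_divide real_sqrt_mult)
      moreover have "- (a\<^sup>2 / (2 * \<epsilon>\<^sup>2)) = - (\<theta>\<^sup>2 / 8) * \<epsilon> powr (-2)"
        using elim by (simp add: a_def powr_minus powr_numeral power_divide field_simps)
      ultimately show ?thesis unfolding H_def by (simp add: a_def)
    qed
    have "c * H (\<epsilon>\<^sup>2) = 8 * sinh (\<omega> / 2) * A * B / (\<theta> * sqrt pi * S) * \<epsilon> * exp (- (\<theta>\<^sup>2 / 8) * \<epsilon> powr (-2))"
    proof -
      have "2 * sinh (\<omega> / 2) * sqrt 2 * (A * B) / S * (2 * sqrt 2 * \<epsilon> / (sqrt pi * \<theta>) * E)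
        = 8 * sinh (\<omega> / 2) * A * B / (\<theta> * sqrt pi * S) * \<epsilon> * E" for E
        by (simp add: field_simps)
      then show ?thesis unfolding c_eq H_eq .
    qed
    also have "sqrt pi = pi powr (1/2)" by (simp add: powr_half_sqrt)
    also have "S = (\<psi> 0 powr (1/2) + \<psi> 1 powr (1/2)) powr (1/2)"
      using AB by (simp add: S_def pw powr_half_sqrt)
    finally show ?case unfolding 1 A_def B_def by simp
  qed
  show ?thesis by (rule asymp_equivI') (rule Lim_transform_eventually[OF lim2 ev])
qed

end
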